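(* Let $k\ge 5$ and $g\ge k+1$, and regard $\mathrm{Ker}(\delta^{\mathrm{alg}}_k)/\mathrm{Ker}(c_k)$ (kernels taken in $\mathfrak{h}^\mathbb{Q}_{g,1}(k)$) as a representation of $\mathrm{Sp}(2g,\mathbb{Q})$. (i) If $k\equiv 1\pmod 4$, then $\mathrm{Ker}(\delta^{\mathrm{alg}}_k)/\mathrm{Ker}(c_k)$ contains an irreducible component isomorphic to $[1^k]$; in particular $\mathrm{Ker}(c_k)\subsetneq\mathrm{Ker}(\delta^{\mathrm{alg}}_k)$. (ii) If $k=8$, then $\mathrm{Ker}(\delta^{\mathrm{alg}}_8)/\mathrm{Ker}(c_8)$ contains an irreducible component isomorphic to $[3,1^5]$.
   Context: Let $H_{\mathbb{Q}}=H_1(\Sigma_{g,1};\mathbb{Q})$ for a compact oriented surface $\Sigma_{g,1}$ of genus $g$ with one boundary component; it has dimension $2g$ and carries the nondegenerate skew-symmetric intersection form $\langle\cdot,\cdot\rangle$, and $\mathrm{Sp}(2g,\mathbb{Q})$ is the group of linear automorphisms of $H_\mathbb{Q}$ preserving it, acting diagonally on tensor powers. Identify $H_{\mathbb{Q}}$ with $H_{\mathbb{Q}}^*$ via $v\mapsto\langle v,\cdot\rangle$; for $a\in H_\mathbb{Q}$ write $a^*=\langle a,\cdot\rangle$. Let $\mathcal{L}^{\mathbb{Q}}_{2g}(m)\subset H_{\mathbb{Q}}^{\otimes m}$ be the span of left-normed brackets $[a_1,\dots,a_m]=[\cdots[[a_1,a_2],a_3],\dots,a_m]$ with $[x,y]=x\otimes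 y-y\otimes x$. Define $\mathfrak{h}^{\mathbb{Q}}_{g,1}(k)$ to be the kernel of the bracket map $H_\mathbb{Q}\otimes\mathcal{L}^{\mathbb{Q}}_{2g}(k+1)\to\mathcal{L}^{\mathbb{Q}}_{2g}(k+2)$, $X\otimes u\mapsto[X,u]$; it is an $\mathrm{Sp}(2g,\mathbb{Q})$-submodule of $H_\mathbb{Q}^{\otimes k+2}$. For $m\ge 0$, let $\mathcal{C}^{\mathbb{Q}}_{2g}(m)$ be the quotient of $H_\mathbb{Q}^{\otimes m}$ by the span of all $a_1\otimes\cdots\otimes a_m-a_2\otimes\cdots\otimes a_m\otimes a_1$, with projection $\pi=\pi_m$. $c_k:\mathfrak{h}^\mathbb{Q}_{g,1}(k)\to\mathcal{C}^\mathbb{Q}_{2g}(k)$ is the restriction of $a_0\otimes a_1\otimes\cdots\otimes a_{k+1}\mapsto \langle a_0,a_1\rangle\,\pi_k(a_2\otimes\cdots\otimes a_{k+1})$. $\delta_k^{\mathrm{alg}}:\mathfrak{h}^\mathbb{Q}_{g,1}(k)\to\bigoplus_{p,q\ge1,\,p+q=k}\mathcal{C}^\mathbb{Q}_{2g}(p)\otimes\mathcal{C}^\mathbb{Q}_{2g}(q)$ is the restriction of the map sending $a_1\otimes\cdots\otimes a_{k+2}$ to $$\sum_{\substack{1\le i<j\le k+2\\ 1<j-i<k+1}} a_i^*(a_j)\Big(\pi(a_{i+1}\cdots a_{j-1})\otimes\pi(a_{j+1}\cdots a_{k+2}a_1\cdots a_{i-1}) - \pi(a_{j+1}\cdots a_{k+2}a_1\cdots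 a_{i-1})\otimes\pi(a_{i+1}\cdots a_{j-1})\Big)$$ (tensor signs between the $a$'s omitted). Both $c_k$ and $\delta^{\mathrm{alg}}_k$ are $\mathrm{Sp}(2g,\mathbb{Q})$-equivariant. For a partition $\lambda$ of length at most $g$, $[\lambda]$ denotes the irreducible rational representation of $\mathrm{Sp}(2g,\mathbb{Q})$ with highest weight $\lambda$; thus $[1^k]$ corresponds to $\lambda=(1,\dots,1)$ ($k$ ones) and $[3,1^5]$ to $\lambda=(3,1,1,1,1,1)$. *)

theory Defs
  imports Complex_Main
begin

text \<open>
  Concrete model.  H_Q = Q^(2g) with symplectic basis a_0..a_(g-1) (indices 0..g-1) and
  b_0..b_(g-1) (indices g..2g-1), with <a_i,b_j> = delta_ij.  A vector of H_Q is a function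
  nat => rat supported in {..<2g}; an element of the m-th tensor power is a function on
  words (nat lists) supported on words of length m with letters < 2g (coefficients with
  respect to the tensor basis).
\<close>

type_synonym vec = "nat \<Rightarrow> rat"
type_synonym tensor = "nat list \<Rightarrow> rat"

definition Jf :: "nat \<Rightarrow> nat \<Rightarrow> nat \<Rightarrow> rat" where
  "Jf g x y = (if x < g \<and> y = x + g then 1 else if y < g \<and> x = y + g then -1 else 0)"

definition vecs :: "nat \<Rightarrow> vec set" where
  "vecs g = {v. \<forall>i. 2 * g \<le> i \<longrightarrow> v i = 0}"

definition Tens :: "nat \<Rightarrow> nat \<Rightarrow> tensor set" where
  "Tens g m = {T. \<forall>w. T w \<noteq> 0 \<longrightarrow> length w = m \<and> (\<forall>x\<in>set w. x < 2 * g)}"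

definition words :: "nat \<Rightarrow> nat \<Rightarrow> nat list set" where
  "words g m = {u. length u = m \<and> set u \<subseteq> {..<2 * g}}"

definition lspan :: "tensor set \<Rightarrow> tensor set" where
  "lspan S = {T. \<exists>n (c :: nat \<Rightarrow> rat) v. (\<forall>i<n. v i \<in> S) \<and> T = (\<lambda>w. \<Sum>i<n. c i * v i w)}"

definition vt :: "vec \<Rightarrow> tensor" where
  "vt v w = (case w of [x] \<Rightarrow> v x | _ \<Rightarrow> 0)"

definition ptensor :: "vec list \<Rightarrow> tensor" where
  "ptensor vs w = (if length w = length vs then (\<Prod>i<length vs. (vs ! i) (w ! i)) else 0)"

definition tprod :: "nat \<Rightarrow> tensor \<Rightarrow> tensor \<Rightarrow> tensor" where
  "tprod p x y w = (if p \<le> length w then x (take p w) * y (drop p w) else 0)"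

definition tbr :: "nat \<Rightarrow> nat \<Rightarrow> tensor \<Rightarrow> tensor \<Rightarrow> tensor" where
  "tbr p q x y = (\<lambda>w. tprod p x y w - tprod q y x w)"

fun lnb_aux :: "tensor \<Rightarrow> nat \<Rightarrow> vec list \<Rightarrow> tensor" where
  "lnb_aux acc n [] = acc"
| "lnb_aux acc n (a # as) = lnb_aux (tbr n 1 acc (vt a)) (Suc n) as"

fun lnb :: "vec list \<Rightarrow> tensor" where
  "lnb [] = (\<lambda>w. 0)"
| "lnb (a # as) = lnb_aux (vt a) 1 as"

definition Lie :: "nat \<Rightarrow> nat \<Rightarrow> tensor set" where
  "Lie g m = lspan {lnb vs | vs. length vs = m \<and> set vs \<subseteq> vecs g}"

definition HL :: "nat \<Rightarrow> nat \<Rightarrow> tensor set" where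
  "HL g m = lspan {tprod 1 (vt X) u | X u. X \<in> vecs g \<and> u \<in> Lie g m}"

text \<open>The bracket map H (x) L(k+1) -> L(k+2), X (x) u |-> [X,u] = X (x) u - u (x) X,
  written as the linear map on the tensor power: (u (x) X)(w) = (X (x) u)(last w # butlast w).\<close>
definition br_map :: "tensor \<Rightarrow> tensor" where
  "br_map T = (\<lambda>w. if w = [] then 0 else T w - T (last w # butlast w))"

definition hk :: "nat \<Rightarrow> nat \<Rightarrow> tensor set" where
  "hk g k = {T \<in> HL g (k + 1). br_map T = (\<lambda>w. 0)}"

text \<open>Cyclic relations: span of a_1...a_m - a_2...a_m a_1; C(m) = H^m / Rel g m.\<close>
definition Rel :: "nat \<Rightarrow> nat \<Rightarrow> tensor set" where
  "Rel g m = lspan {(\<lambda>w. ptensor vs w - ptensor (tl vs @ [hd vs]) w) | vs.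
                     length vs = m \<and> set vs \<subseteq> vecs g}"

text \<open>C(p) (x) C(q) = (H^p (x) H^q) / (Rel_p (x) H^q + H^p (x) Rel_q)\<close>
definition Rel2 :: "nat \<Rightarrow> nat \<Rightarrow> nat \<Rightarrow> tensor set" where
  "Rel2 g p q = lspan ({tprod p r s | r s. r \<in> Rel g p \<and> s \<in> Tens g q}
                    \<union> {tprod p s r | s r. s \<in> Tens g p \<and> r \<in> Rel g q})"

text \<open>lift of c_k to H^k: contraction of the first two factors with the intersection form\<close>
definition cmap :: "nat \<Rightarrow> nat \<Rightarrow> tensor \<Rightarrow> tensor" where
  "cmap g k T w = (if length w = k then (\<Sum>x<2*g. \<Sum>y<2*g. Jf g x y * T (x # y # w)) else 0)"

definition KerC :: "nat \<Rightarrow> nat \<Rightarrow> tensor set" where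
  "KerC g k = {T \<in> hk g k. cmap g k T \<in> Rel g k}"

text \<open>contraction at (0-indexed) positions i < j of a degree k+2 tensor, producing
  (inner word u = positions i+1..j-1) (x) (outer word v = positions j+1..k+1, 0..i-1)\<close>
definition contr :: "nat \<Rightarrow> nat \<Rightarrow> nat \<Rightarrow> nat \<Rightarrow> tensor \<Rightarrow> nat list \<Rightarrow> nat list \<Rightarrow> rat" where
  "contr g k i j T u v = (\<Sum>x<2*g. \<Sum>y<2*g. Jf g x y *
       T (drop (k + 1 - j) v @ [x] @ u @ [y] @ take (k + 1 - j) v))"

text \<open>(p, k-p) component of the lift of delta_k^alg, as an element of H^p (x) H^(k-p)\<close>
definition dcomp :: "nat \<Rightarrow> nat \<Rightarrow> nat \<Rightarrow> tensor \<Rightarrow> tensor" where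
  "dcomp g k p T w = (if length w = k then
      (\<Sum>i\<le>k+1. \<Sum>j\<le>k+1. if i < j \<and> 1 < j - i \<and> j - i < k + 1 \<and> j - i - 1 = p
          then contr g k i j T (take p w) (drop p w) else 0)
    - (\<Sum>i\<le>k+1. \<Sum>j\<le>k+1. if i < j \<and> 1 < j - i \<and> j - i < k + 1 \<and> j - i - 1 = k - p
          then contr g k i j T (drop p w) (take p w) else 0)
    else 0)"

definition KerD :: "nat \<Rightarrow> nat \<Rightarrow> tensor set" where
  "KerD g k = {T \<in> hk g k. \<forall>p. 1 \<le> p \<and> p \<le> k - 1 \<longrightarrow> dcomp g k p T \<in> Rel2 g p (k - p)}"

definition Spg :: "nat \<Rightarrow> (nat \<Rightarrow> nat \<Rightarrow> rat) set" where
  "Spg g = {A. (\<forall>p q. (2 * g \<le> p \<or> 2 * g \<le> q) \<longrightarrow> A p q = 0) \<and>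
     (\<forall>p<2*g. \<forall>q<2*g. (\<Sum>r<2*g. \<Sum>s<2*g. A r p * Jf g r s * A s q) = Jf g p q)}"

definition act :: "nat \<Rightarrow> nat \<Rightarrow> (nat \<Rightarrow> nat \<Rightarrow> rat) \<Rightarrow> tensor \<Rightarrow> tensor" where
  "act g m A T w = (if length w = m then
      (\<Sum>u\<in>words g m. (\<Prod>i<m. A (w ! i) (u ! i)) * T u) else 0)"

definition lsub :: "tensor set \<Rightarrow> bool" where
  "lsub S \<longleftrightarrow> (\<lambda>w. 0) \<in> S \<and> (\<forall>x\<in>S. \<forall>y\<in>S. (\<lambda>w. x w + y w) \<in> S)
      \<and> (\<forall>c. \<forall>x\<in>S. (\<lambda>w. c * x w) \<in> S)"

definition invariant :: "nat \<Rightarrow> nat \<Rightarrow> tensor set \<Rightarrow> bool" where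
  "invariant g m S \<longleftrightarrow> (\<forall>A\<in>Spg g. \<forall>T\<in>S. act g m A T \<in> S)"

text \<open>W/K is a subrepresentation (W an invariant subspace containing K)\<close>
definition subrep :: "nat \<Rightarrow> nat \<Rightarrow> tensor set \<Rightarrow> tensor set \<Rightarrow> bool" where
  "subrep g m K W \<longleftrightarrow> lsub W \<and> invariant g m W \<and> K \<subseteq> W"

definition irred_quot :: "nat \<Rightarrow> nat \<Rightarrow> tensor set \<Rightarrow> tensor set \<Rightarrow> bool" where
  "irred_quot g m K W \<longleftrightarrow> K \<subset> W \<and> (\<forall>U. subrep g m K U \<and> U \<subseteq> W \<longrightarrow> U = K \<or> U = W)"

definition tor :: "nat \<Rightarrow> (nat \<Rightarrow> rat) \<Rightarrow> nat \<Rightarrow> nat \<Rightarrow> rat" where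
  "tor g t p q = (if p = q \<and> p < g then t p
                  else if p = q \<and> g \<le> p \<and> p < 2 * g then inverse (t (p - g)) else 0)"

definition weight_vec :: "nat \<Rightarrow> nat \<Rightarrow> tensor set \<Rightarrow> tensor set \<Rightarrow> (nat \<Rightarrow> int) \<Rightarrow> tensor \<Rightarrow> bool" where
  "weight_vec g m K W mu T \<longleftrightarrow> T \<in> W \<and> T \<notin> K \<and>
     (\<forall>t. (\<forall>i<g. t i \<noteq> 0) \<longrightarrow>
        (\<lambda>w. act g m (tor g t) T w - (\<Prod>i<g. t i powi mu i) * T w) \<in> K)"

text \<open>dominance order of weights: nu - mu is a nonnegative integral combination of the simple
  roots e_1-e_2, ..., e_(g-1)-e_g, 2 e_g\<close>
definition wle :: "nat \<Rightarrow> (nat \<Rightarrow> int) \<Rightarrow> (nat \<Rightarrow> int) \<Rightarrow> bool" where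
  "wle g mu nu \<longleftrightarrow> (\<forall>j\<le>g. 0 \<le> (\<Sum>i<j. nu i - mu i)) \<and> even (\<Sum>i<g. nu i - mu i)"

definition has_hw :: "nat \<Rightarrow> nat \<Rightarrow> tensor set \<Rightarrow> tensor set \<Rightarrow> (nat \<Rightarrow> int) \<Rightarrow> bool" where
  "has_hw g m K W lam \<longleftrightarrow> (\<exists>T. weight_vec g m K W lam T) \<and>
     (\<forall>mu T. weight_vec g m K W mu T \<longrightarrow> wle g mu lam)"

definition contains_irrep :: "nat \<Rightarrow> nat \<Rightarrow> tensor set \<Rightarrow> tensor set \<Rightarrow> (nat \<Rightarrow> int) \<Rightarrow> bool" where
  "contains_irrep g m V K lam \<longleftrightarrow>
     (\<exists>W. subrep g m K W \<and> W \<subseteq> V \<and> irred_quot g m K W \<and> has_hw g m K W lam)"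

end

theory Submission
  imports "Jordan_Normal_Form.Determinant" Defs
begin

text \<open>
  A Lie element \<open>L\<close> satisfies \<open>L(u y v) = (-1)^|u| \<Sum> L(y w)\<close>, where \<open>w\<close> runs over the shuffles of the
  reversal of \<open>u\<close> with \<open>v\<close>. An element \<open>T\<close> of the kernel of the bracket is in addition cyclically
  invariant, so all components of the cobracket of \<open>T\<close> are obtained from its first contraction
  \<open>c(T)\<close> by (signed) unshuffling. Hence the kernel of \<open>c\<close> lies in that of the cobracket, and the quotient
  is the space of those contractions \<open>c(T)\<close> that are killed by unshuffling into two cyclic words.

  Caterpillar trees whose end leaves form a symplectic pair and whose legs \<open>x\<close> lie in a Lagrangian have
  contraction \<open>(-1)^k x - rev x\<close>. For \<open>k \<equiv> 1 (mod 4)\<close> this reaches the alternating tensors; they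
  unshuffle to zero since one of the two cyclic words has even length. For \<open>k = 8\<close> one takes a product of
  three Lie elements of degree at least 2: unshuffling leaves a single Lie element of degree at
  least 2 in one of the two factors, and it vanishes as a cyclic word.

  The weight vectors used lie in \<open>H\<^sup>a \<otimes> \<Lambda>\<^sup>b\<close>, where the weight \<open>(a + 1, 1, \<dots>, 1)\<close> occurs
  exactly once. As the symplectic group is closed under transposition, the standard inner product then
  shows that the submodule generated by a vector of this weight is irreducible.
\<close>

section \<open>Shuffle sums and their cyclic symmetrisation\<close>

text \<open>Spaces of cyclic words are quotients, and membership in the spans \<open>Rel\<close> and
  \<open>Rel2\<close> is awkward to test directly. In characteristic zero a vanishing sum over
  rotations certifies it, so questions about the cobracket become identities between shuffle sums of
  one function, the contraction. The quotient of the two kernels is never decomposed. An equivariant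
  map on \<open>H^a \<otimes> \<Lambda>^b\<close> that is killed by unshuffling and is nonzero on
  cyclic words singles out a submodule of the quotient, and a single combination of trees that
  realises the highest weight vector suffices to make it nonzero. The congruence comes from two
  signs. Rotating an alternating tensor of degree \<open>k\<close> costs \<open>(-1)^(k-1)\<close>,
  so only odd \<open>k\<close> leaves a nonzero cyclic word; reversal costs
  \<open>(-1)^(k(k-1)/2)\<close>, and for odd \<open>k\<close> the contraction
  \<open>- x - rev x\<close> is nonzero exactly when this sign is 1. The bound
  \<open>k + 1 \<le> g\<close> leaves room for \<open>k\<close> isotropic leg letters and one
  further symplectic pair for the end leaves.\<close>

fun shuffle_sum :: "('a list \<Rightarrow> rat) \<Rightarrow> 'a list \<Rightarrow> 'a list \<Rightarrow> rat" where
  "shuffle_sum f [] v = f v"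
| "shuffle_sum f (x # u) [] = f (x # u)"
| "shuffle_sum f (x # u) (y # v) = shuffle_sum (\<lambda>w. f (x # w)) u (y # v) + shuffle_sum (\<lambda>w. f (y # w)) (x # u) v"

lemma shuffle_sum_Nil2 [simp]: "shuffle_sum f u [] = f u"
  by (cases u) auto

lemma shuffle_sum_cong:
  assumes "\<And>w. length w = length u + length v \<Longrightarrow> set w = set u \<union> set v \<Longrightarrow> f w = h w"
  shows "shuffle_sum f u v = shuffle_sum h u v"
  using assms
proof (induction f u v arbitrary: h rule: shuffle_sum.induct)
  case (3 f x u y v)
  have "shuffle_sum (\<lambda>w. f (x # w)) u (y # v) = shuffle_sum (\<lambda>w. h (x # w)) u (y # v)"
    by (rule "3.IH"(1)) (rule "3.prems", auto)
  moreover have "shuffle_sum (\<lambda>w. f (y # w)) (x # u) v = shuffle_sum (\<lambda>w. h (y # w)) (x # u) v"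
    by (rule "3.IH"(2)) (rule "3.prems", auto)
  ultimately show ?case by simp
qed auto

lemma shuffle_sum_zero [simp]: "shuffle_sum (\<lambda>w. 0) u v = 0"
  by (induction "\<lambda>w::'a list. 0::rat" u v rule: shuffle_sum.induct) auto

lemma shuffle_sum_add: "shuffle_sum (\<lambda>w. f w + h w) u v = shuffle_sum f u v + shuffle_sum h u v"
  by (induction f u v arbitrary: h rule: shuffle_sum.induct) auto

lemma shuffle_sum_mult: "shuffle_sum (\<lambda>w. c * f w) u v = c * shuffle_sum f u v"
  by (induction f u v rule: shuffle_sum.induct) (auto simp: algebra_simps)

lemma shuffle_sum_minus: "shuffle_sum (\<lambda>w. - f w) u v = - shuffle_sum f u v"
  using shuffle_sum_mult[of "-1" f] by simp

lemma shuffle_sum_diff: "shuffle_sum (\<lambda>w. f w - h w) u v = shuffle_sum f u v - shuffle_sum h u v"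
  using shuffle_sum_add[of f "\<lambda>w. - h w"] by (simp add: shuffle_sum_minus)

lemma shuffle_sum_sum: "shuffle_sum (\<lambda>w. \<Sum>i\<in>I. f i w) u v = (\<Sum>i\<in>I. shuffle_sum (f i) u v)"
  by (induction I rule: infinite_finite_induct) (auto simp: shuffle_sum_add)

text \<open>The last letter of a shuffle, like the first, comes from one of the two words. This
  recursion from the right gives access to reversal and rotation.\<close>

lemma shuffle_sum_snoc:
  "shuffle_sum f (u @ [x]) (v @ [y]) = shuffle_sum (\<lambda>w. f (w @ [x])) u (v @ [y]) + shuffle_sum (\<lambda>w. f (w @ [y])) (u @ [x]) v"
proof (induction "length u + length v" arbitrary: f u v rule: less_induct)
  case less
  show ?case
  proof (cases u)
    case Nil
    show ?thesis
    proof (cases v)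
      case (Cons b v')
      with less[of "[]" v' "\<lambda>w. f (b # w)"] Nil show ?thesis by simp
    qed (simp add: Nil)
  next
    case u: (Cons a u')
    show ?thesis
    proof (cases v)
      case Nil
      with less[of u' "[]" "\<lambda>w. f (a # w)"] u show ?thesis by simp
    next
      case (Cons b v')
      with less[of u' v "\<lambda>w. f (a # w)"] less[of u v' "\<lambda>w. f (b # w)"] u show ?thesis
        by simp
    qed
  qed
qed

lemma shuffle_sum_rev: "shuffle_sum (\<lambda>w. f (rev w)) u v = shuffle_sum f (rev u) (rev v)"
proof (induction "\<lambda>w. f (rev w)" u v arbitrary: f rule: shuffle_sum.induct)
  case (3 x u y v)
  from "3"(1)[of "\<lambda>w. f (w @ [x])"] "3"(2)[of "\<lambda>w. f (w @ [y])"]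
  show ?case by (simp add: shuffle_sum_snoc)
qed auto

text \<open>Up to reversal of \<open>u\<close> and a scalar, the symmetrisation of the component of the cobracket at the
  pair of cyclic words \<open>u\<close>, \<open>v\<close>, expressed through the contraction \<open>f\<close>.\<close>
definition bicyc_sum :: "('a list \<Rightarrow> rat) \<Rightarrow> 'a list \<Rightarrow> 'a list \<Rightarrow> rat" where
  "bicyc_sum f u v = (\<Sum>i<length u. \<Sum>j<length v. shuffle_sum f (rotate i u) (rotate j v))"

definition cyc_sum :: "('a list \<Rightarrow> rat) \<Rightarrow> 'a list \<Rightarrow> rat" where
  "cyc_sum f w = (\<Sum>i<length w. f (rotate i w))"

lemma sum_rotate_shift:
  fixes h :: "'a list \<Rightarrow> rat"
  shows "(\<Sum>i<length w. h (rotate (Suc i) w)) = (\<Sum>i<length w. h (rotate i w))"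
proof (cases "length w")
  case (Suc n)
  have "(\<Sum>i<length w. h (rotate (Suc i) w)) = (\<Sum>i<n. h (rotate (Suc i) w)) + h (rotate (length w) w)"
    using Suc by simp
  also have "rotate (length w) w = rotate 0 w"
    by simp
  finally show ?thesis
    unfolding Suc by (simp add: sum.lessThan_Suc_shift del: sum.lessThan_Suc rotate_Suc)
qed simp

lemma cyc_sum_rotate1: "cyc_sum f (rotate1 w) = cyc_sum f w"
  using sum_rotate_shift[of f w] by (simp add: cyc_sum_def rotate1_rotate_swap[symmetric])

lemma sum_rotate_rev:
  fixes h :: "'a list \<Rightarrow> rat"
  shows "(\<Sum>i<length w. h (rev (rotate i w))) = (\<Sum>i<length w. h (rotate i (rev w)))"
proof (cases "w = []")
  case False
  let ?n = "length w"
  have "(\<Sum>i<?n. h (rotate i (rev w))) = (\<Sum>i<?n. h (rev (rotate (?n - i) w)))"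
    by (intro sum.cong refl) (simp add: rotate_rev)
  also have "\<dots> = (\<Sum>i<?n. h (rev (rotate (Suc i) w)))"
    by (rule sum.reindex_bij_witness[of _ "\<lambda>i. ?n - Suc i" "\<lambda>i. ?n - Suc i"]) 
      (auto simp: Suc_diff_Suc simp del: rotate_Suc)
  also have "\<dots> = (\<Sum>i<?n. h (rev (rotate i w)))"
    by (rule sum_rotate_shift[of "\<lambda>w. h (rev w)"])
  finally show ?thesis by simp
qed simp

lemma bicyc_sum_rev1:
  "(\<Sum>i<length u. \<Sum>j<length v. shuffle_sum f (rev (rotate i u)) (rotate j v)) = bicyc_sum f (rev u) v"
  using sum_rotate_rev[of "\<lambda>x. \<Sum>j<length v. shuffle_sum f x (rotate j v)" u] by (simp add: bicyc_sum_def)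

lemma bicyc_sum_rev: "bicyc_sum (\<lambda>w. f (rev w)) u v = bicyc_sum f (rev u) (rev v)"
proof -
  have "bicyc_sum (\<lambda>w. f (rev w)) u v = (\<Sum>i<length u. \<Sum>j<length v. shuffle_sum f (rev (rotate i u)) (rev (rotate j v)))"
    by (simp add: bicyc_sum_def shuffle_sum_rev)
  also have "\<dots> = (\<Sum>i<length u. \<Sum>j<length v. shuffle_sum f (rev (rotate i u)) (rotate j (rev v)))"
    by (rule sum.cong[OF refl], rule sum_rotate_rev)
  finally show ?thesis by (simp flip: bicyc_sum_rev1)
qed

text \<open>Both sides sum over all words obtained from a shuffle of rotations of \<open>u\<close> and \<open>v\<close>, cut
  once by their first and once by their last letter.\<close>
lemma bicyc_sum_fun_rotate1:
  assumes "u \<noteq> []" "v \<noteq> []"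
  shows "bicyc_sum (\<lambda>w. f (rotate1 w)) u v = bicyc_sum f u v"
proof -
  define A where "A u v = shuffle_sum (\<lambda>w. f (w @ [hd u])) (tl u) v" for u v
  define B where "B u v = shuffle_sum (\<lambda>w. f (w @ [hd v])) u (tl v)" for u v
  have 1: "shuffle_sum (\<lambda>w. f (rotate1 w)) u v = A u v + B u v" if "u \<noteq> []" "v \<noteq> []" for u v
    using that by (cases u; cases v) (auto simp: A_def B_def)
  have 2: "shuffle_sum f u v = shuffle_sum (\<lambda>w. f (w @ [last u])) (butlast u) v + shuffle_sum (\<lambda>w. f (w @ [last v])) u (butlast v)"
    if "u \<noteq> []" "v \<noteq> []" for u v
    using that shuffle_sum_snoc[of f "butlast u" "last u" "butlast v" "last v"] by simp
  have 3: "shuffle_sum (\<lambda>w. f (w @ [last (rotate1 u)])) (butlast (rotate1 u)) v = A u v" if "u \<noteq> []" for u v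
    using that by (cases u) (auto simp: A_def)
  have 4: "shuffle_sum (\<lambda>w. f (w @ [last (rotate1 v)])) u (butlast (rotate1 v)) = B u v" if "v \<noteq> []" for u v
    using that by (cases v) (auto simp: B_def)
  let ?n = "length u" let ?m = "length v"
  have "bicyc_sum f u v = (\<Sum>i<?n. \<Sum>j<?m. shuffle_sum (\<lambda>w. f (w @ [last (rotate i u)])) (butlast (rotate i u)) (rotate j v))
     + (\<Sum>i<?n. \<Sum>j<?m. shuffle_sum (\<lambda>w. f (w @ [last (rotate j v)])) (rotate i u) (butlast (rotate j v)))"
    using assms by (simp add: bicyc_sum_def 2 sum.distrib)
  \<comment> \<open>\<open>last\<close> and \<open>butlast\<close> of \<open>rotate1 u\<close> are
    \<open>hd\<close> and \<open>tl\<close> of \<open>u\<close>; shifting the rotation index by one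
    therefore turns a cut at the last letter into a cut at the first.\<close>
  also have "(\<Sum>i<?n. \<Sum>j<?m. shuffle_sum (\<lambda>w. f (w @ [last (rotate i u)])) (butlast (rotate i u)) (rotate j v))
     = (\<Sum>i<?n. \<Sum>j<?m. A (rotate i u) (rotate j v))"
    using sum_rotate_shift[of "\<lambda>x. \<Sum>j<?m. shuffle_sum (\<lambda>w. f (w @ [last x])) (butlast x) (rotate j v)" u] assms
    by (simp add: 3)
  also have "(\<Sum>i<?n. \<Sum>j<?m. shuffle_sum (\<lambda>w. f (w @ [last (rotate j v)])) (rotate i u) (butlast (rotate j v)))
     = (\<Sum>i<?n. \<Sum>j<?m. B (rotate i u) (rotate j v))"
  proof (rule sum.cong[OF refl])
    fix i
    show "(\<Sum>j<?m. shuffle_sum (\<lambda>w. f (w @ [last (rotate j v)])) (rotate i u) (butlast (rotate j v))) =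
       (\<Sum>j<?m. B (rotate i u) (rotate j v))"
      using sum_rotate_shift[of "\<lambda>x. shuffle_sum (\<lambda>w. f (w @ [last x])) (rotate i u) (butlast x)" v] assms
      by (simp add: 4)
  qed
  also have "(\<Sum>i<?n. \<Sum>j<?m. A (rotate i u) (rotate j v)) + (\<Sum>i<?n. \<Sum>j<?m. B (rotate i u) (rotate j v))
     = bicyc_sum (\<lambda>w. f (rotate1 w)) u v"
    using assms by (simp add: bicyc_sum_def 1 sum.distrib)
  finally show ?thesis by simp
qed

lemma bicyc_sum_mult: "bicyc_sum (\<lambda>w. c * f w) u v = c * bicyc_sum f u v"
  by (simp add: bicyc_sum_def shuffle_sum_mult sum_distrib_left)

lemma bicyc_sum_diff: "bicyc_sum (\<lambda>w. f w - h w) u v = bicyc_sum f u v - bicyc_sum h u v"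
  by (simp add: bicyc_sum_def shuffle_sum_diff sum_subtractf)

lemma bicyc_sum_cong:
  assumes "\<And>w. length w = length u + length v \<Longrightarrow> f w = h w"
  shows "bicyc_sum f u v = bicyc_sum h u v"
  unfolding bicyc_sum_def by (intro sum.cong refl shuffle_sum_cong) (simp add: assms)

text \<open>This yields the inclusion of the kernel of \<open>cmap\<close> in that of the cobracket.\<close>
lemma bicyc_sum_eq_0:
  assumes "u \<noteq> []" "v \<noteq> []" and 0: "\<And>w. cyc_sum f w = 0"
  shows "bicyc_sum f u v = 0"
proof -
  let ?k = "length u + length v"
  have *: "bicyc_sum (\<lambda>w. f (rotate i w)) u v = bicyc_sum f u v" for i
  proof (induction i)
    case (Suc i)
    show ?case
      using bicyc_sum_fun_rotate1[OF assms(1,2), of "\<lambda>w. f (rotate i w)"] Suc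
      by (simp add: rotate1_rotate_swap)
  qed simp
  \<comment> \<open>Averaging: up to the factor \<open>?k\<close>, \<open>f\<close> may be replaced
    by its sum over all rotations, which is \<open>cyc_sum f\<close>.\<close>
  have "of_nat ?k * bicyc_sum f u v = (\<Sum>i<?k. bicyc_sum (\<lambda>w. f (rotate i w)) u v)"
    by (simp add: *)
  also have "\<dots> = bicyc_sum (\<lambda>w. \<Sum>i<?k. f (rotate i w)) u v"
    by (simp add: bicyc_sum_def shuffle_sum_sum sum.swap[of _ "{..<?k}"])
  also have "\<dots> = bicyc_sum (\<lambda>w. 0) u v"
  proof (rule bicyc_sum_cong)
    fix w :: "'a list"
    assume "length w = ?k"
    with 0[of w] show "(\<Sum>i<?k. f (rotate i w)) = 0" by (simp add: cyc_sum_def)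
  qed
  also have "\<dots> = 0" by (simp add: bicyc_sum_def)
  finally have "of_nat ?k * bicyc_sum f u v = 0" .
  moreover have "(of_nat ?k :: rat) \<noteq> 0"
    using assms by (subst of_nat_eq_0_iff) simp
  ultimately show ?thesis by (metis mult_eq_0_iff)
qed

section \<open>Cyclic relations as vanishing cyclic sums\<close>

lemma lsubI:
  assumes "(\<lambda>w. 0) \<in> U" "\<And>x y. x \<in> U \<Longrightarrow> y \<in> U \<Longrightarrow> (\<lambda>w. x w + y w) \<in> U"
    "\<And>c x. x \<in> U \<Longrightarrow> (\<lambda>w. c * x w) \<in> U"
  shows "lsub U"
  using assms by (auto simp: lsub_def)

lemma lsub_zero: "lsub U \<Longrightarrow> (\<lambda>w. 0) \<in> U"
  and lsub_add: "lsub U \<Longrightarrow> x \<in> U \<Longrightarrow> y \<in> U \<Longrightarrow> (\<lambda>w. x w + y w) \<in> U"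
  and lsub_mult: "lsub U \<Longrightarrow> x \<in> U \<Longrightarrow> (\<lambda>w. c * x w) \<in> U"
  by (auto simp: lsub_def)

lemma lsub_minus: "lsub U \<Longrightarrow> x \<in> U \<Longrightarrow> (\<lambda>w. - x w) \<in> U"
  using lsub_mult[of U x "-1"] by simp

lemma lsub_diff: "lsub U \<Longrightarrow> x \<in> U \<Longrightarrow> y \<in> U \<Longrightarrow> (\<lambda>w. x w - y w) \<in> U"
  using lsub_add[of U x "\<lambda>w. - y w"] by (simp add: lsub_minus)

lemma lsub_sum:
  assumes "lsub U" "\<And>i. i \<in> I \<Longrightarrow> f i \<in> U"
  shows "(\<lambda>w. \<Sum>i\<in>I. f i w) \<in> U"
  using assms(2)
proof (induction I rule: infinite_finite_induct)
  case (insert i I)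
  then show ?case using lsub_add[OF assms(1), of "f i" "\<lambda>w. \<Sum>i\<in>I. f i w"] by simp
qed (auto simp: lsub_zero[OF assms(1)])

lemma lspanE:
  assumes "x \<in> lspan S"
  obtains n :: nat and c v where "\<forall>i<n. v i \<in> S" "x = (\<lambda>w. \<Sum>i<n. c i * v i w)"
  using assms unfolding lspan_def mem_Collect_eq by (elim exE conjE) (rule that)

lemma lspan_base: "x \<in> S \<Longrightarrow> x \<in> lspan S"
  unfolding lspan_def by (auto intro!: exI[of _ "1::nat"] exI[of _ "\<lambda>i. 1::rat"] exI[of _ "\<lambda>i. x"])

lemma lsub_lspan: "lsub (lspan S)"
proof (rule lsubI)
  show "(\<lambda>w. 0) \<in> lspan S"
    unfolding lspan_def by (auto intro!: exI[of _ "0::nat"])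
next
  fix x y assume "x \<in> lspan S" "y \<in> lspan S"
  then obtain n m :: nat and c v d u where x: "x = (\<lambda>w. \<Sum>i<n. c i * v i w)" "\<forall>i<n. v i \<in> S"
      and y: "y = (\<lambda>w. \<Sum>i<m. d i * u i w)" "\<forall>i<m. u i \<in> S"
    by (elim lspanE) (rule that, assumption+)
  let ?c = "\<lambda>i. if i < n then c i else d (i - n)" and ?v = "\<lambda>i. if i < n then v i else u (i - n)"
  have "(\<Sum>i<n+m. ?c i * ?v i w) = x w + y w" for w
  proof -
    have "(\<Sum>i<n+m. ?c i * ?v i w) = (\<Sum>i<n. ?c i * ?v i w) + (\<Sum>i=n..<n+m. ?c i * ?v i w)"
      using sum.atLeastLessThan_concat[of 0 n "n + m" "\<lambda>i. ?c i * ?v i w"]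
      by (simp only: lessThan_atLeast0)
    also have "(\<Sum>i=n..<n+m. ?c i * ?v i w) = (\<Sum>i<m. d i * u i w)"
      by (rule sum.reindex_bij_witness[of _ "\<lambda>i. i + n" "\<lambda>i. i - n"]) auto
    finally show ?thesis by (simp add: x y)
  qed
  moreover have "\<forall>i<n+m. ?v i \<in> S" using x y by auto
  ultimately show "(\<lambda>w. x w + y w) \<in> lspan S"
    unfolding lspan_def by (auto intro!: exI[of _ "n+m"] exI[of _ ?c] exI[of _ ?v])
next
  fix a x assume "x \<in> lspan S"
  then obtain n :: nat and c v where x: "x = (\<lambda>w. \<Sum>i<n. c i * v i w)" "\<forall>i<n. v i \<in> S"
    by (elim lspanE) (rule that, assumption+)
  then show "(\<lambda>w. a * x w) \<in> lspan S"
    unfolding lspan_def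
    by (auto intro!: exI[of _ n] exI[of _ "\<lambda>i. a * c i"] exI[of _ v] simp: sum_distrib_left mult.assoc)
qed

lemma lspan_minimal:
  assumes "S \<subseteq> U" "lsub U"
  shows "lspan S \<subseteq> U"
proof
  fix x assume "x \<in> lspan S"
  then obtain n :: nat and c v where x: "x = (\<lambda>w. \<Sum>i<n. c i * v i w)" "\<forall>i<n. v i \<in> S"
    by (elim lspanE) (rule that, assumption+)
  show "x \<in> U"
    unfolding x(1) using assms x(2) by (intro lsub_sum lsub_mult) auto
qed

section \<open>Coordinates of tensors in the basis of words\<close>

lemma lsub_Tens: "lsub (Tens g m)"
  by (rule lsubI) (force simp: Tens_def)+

lemma finite_words [simp]: "finite (words g m)"
proof -
  have "words g m = {u. set u \<subseteq> {..<2*g} \<and> length u = m}"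
    by (auto simp: words_def)
  then show ?thesis by (simp add: finite_lists_length_eq)
qed

lemma Tens_iff: "T \<in> Tens g m \<longleftrightarrow> (\<forall>w. w \<notin> words g m \<longrightarrow> T w = 0)"
  by (auto simp: Tens_def words_def)

lemma words_rotate [simp]: "rotate i w \<in> words g m \<longleftrightarrow> w \<in> words g m"
  by (simp add: words_def)

definition single :: "nat list \<Rightarrow> tensor" where
  "single w = (\<lambda>z. if z = w then 1 else 0)"

definition uvec :: "nat \<Rightarrow> vec" where
  "uvec x = (\<lambda>i. if i = x then 1 else 0)"

lemma uvec_vecs: "x < 2 * g \<Longrightarrow> uvec x \<in> vecs g"
  by (auto simp: uvec_def vecs_def)

lemma Tens_expand:
  assumes "T \<in> Tens g m"
  shows "T z = (\<Sum>w\<in>words g m. T w * single w z)"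
proof -
  have "(\<Sum>w\<in>words g m. T w * single w z) = (\<Sum>w\<in>words g m. if w = z then T w else 0)"
    by (rule sum.cong) (auto simp: single_def)
  then show ?thesis using assms by (auto simp: Tens_iff)
qed

lemma ptensor_Nil: "ptensor [] w = (if w = [] then 1 else 0)"
  by (simp add: ptensor_def)

lemma ptensor_Cons_Nil [simp]: "ptensor (a # vs) [] = 0"
  by (simp add: ptensor_def)

lemma ptensor_Nil_Cons [simp]: "ptensor [] (x # w) = 0"
  by (simp add: ptensor_def)

lemma ptensor_Cons [simp]: "ptensor (a # vs) (x # w) = a x * ptensor vs w"
  by (simp add: ptensor_def prod.lessThan_Suc_shift del: prod.lessThan_Suc)

lemma ptensor_snoc: "ptensor (vs @ [a]) (w @ [x]) = ptensor vs w * a x"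
  by (auto simp: ptensor_def nth_append)

lemma ptensor_uvec: "ptensor (map uvec w) = single w"
proof
  show "ptensor (map uvec w) z = single w z" for z
  proof (induction w arbitrary: z)
    case Nil
    then show ?case by (cases z) (auto simp: ptensor_Nil single_def)
  next
    case (Cons x w)
    then show ?case by (cases z) (auto simp: single_def uvec_def)
  qed
qed

lemma ptensor_rotate1: "ptensor (rotate1 vs) (rotate1 w) = ptensor vs w"
proof (cases "length vs = length w")
  case True
  then show ?thesis by (cases vs; cases w) (simp_all add: ptensor_snoc)
qed (simp add: ptensor_def)

lemma ptensor_Tens:
  assumes "set vs \<subseteq> vecs g"
  shows "ptensor vs \<in> Tens g (length vs)"
  using assms
proof (induction vs)
  case Nil
  then show ?case by (auto simp: Tens_def ptensor_Nil split: if_splits)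
next
  case (Cons a vs)
  have "length w = Suc (length vs) \<and> (\<forall>x\<in>set w. x < 2 * g)" if "ptensor (a # vs) w \<noteq> 0" for w
  proof (cases w)
    case (Cons y w')
    with that Cons.IH Cons.prems show ?thesis
      by (auto simp: Tens_def vecs_def not_less[symmetric])
  qed (use that in auto)
  then show ?case by (auto simp: Tens_def)
qed

lemma tl_hd_rotate1: "vs \<noteq> [] \<Longrightarrow> tl vs @ [hd vs] = rotate1 vs"
  by (cases vs) auto

section \<open>Single cyclic words\<close>

lemma Rel_subset:
  assumes "m > 0"
  shows "Rel g m \<subseteq> {T \<in> Tens g m. \<forall>w. cyc_sum T w = 0}"
  unfolding Rel_def
proof (rule lspan_minimal)
  have "cyc_sum (\<lambda>w. ptensor vs w - ptensor (rotate1 vs) w) w = 0" for vs w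
  proof -
    have "cyc_sum (ptensor (rotate1 vs)) (rotate1 w) = cyc_sum (ptensor vs) w"
      by (simp add: cyc_sum_def rotate1_rotate_swap[symmetric] ptensor_rotate1)
    then have "cyc_sum (ptensor (rotate1 vs)) w = cyc_sum (ptensor vs) w"
      by (simp only: cyc_sum_rotate1)
    then show ?thesis by (simp add: cyc_sum_def sum_subtractf)
  qed
  moreover have "(\<lambda>w. ptensor vs w - ptensor (rotate1 vs) w) \<in> Tens g (length vs)"
    if "set vs \<subseteq> vecs g" for vs
    using ptensor_Tens[of vs g] ptensor_Tens[of "rotate1 vs" g] that
    by (intro lsub_diff lsub_Tens) auto
  moreover have "tl vs @ [hd vs] = rotate1 vs" if "length vs = m" for vs :: "vec list"
    using assms that by (intro tl_hd_rotate1) auto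
  ultimately show "{\<lambda>w. ptensor vs w - ptensor (tl vs @ [hd vs]) w |vs. length vs = m \<and> set vs \<subseteq> vecs g}
    \<subseteq> {T \<in> Tens g m. \<forall>w. cyc_sum T w = 0}"
    by auto
  show "lsub {T \<in> Tens g m. \<forall>w. cyc_sum T w = 0}"
    by (rule lsubI)
      (auto simp: cyc_sum_def sum.distrib lsub_zero[OF lsub_Tens] lsub_add[OF lsub_Tens] lsub_mult[OF lsub_Tens]
         simp flip: sum_distrib_left)
qed

lemma lsub_Rel: "lsub (Rel g m)"
  by (simp add: Rel_def lsub_lspan)

lemma single_rotate_Rel:
  assumes w: "w \<in> words g m" and "m > 0"
  shows "(\<lambda>z. single w z - single (rotate i w) z) \<in> Rel g m"
proof (induction i)
  case 0
  then show ?case by (simp add: Rel_def lsub_zero[OF lsub_lspan])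
next
  case (Suc i)
  let ?vs = "map uvec (rotate i w)"
  have "length ?vs = m" "set ?vs \<subseteq> vecs g"
    using w by (auto simp: words_def intro!: uvec_vecs)
  moreover have "tl ?vs @ [hd ?vs] = map uvec (rotate (Suc i) w)"
    using assms by (subst tl_hd_rotate1) (auto simp: words_def rotate1_map)
  moreover from calculation(1,2) have "(\<lambda>z. ptensor ?vs z - ptensor (tl ?vs @ [hd ?vs]) z) \<in> Rel g m"
    unfolding Rel_def by (intro lspan_base) blast
  ultimately have "(\<lambda>z. ptensor ?vs z - ptensor (map uvec (rotate (Suc i) w)) z) \<in> Rel g m"
    by (simp only:)
  then have "(\<lambda>z. single (rotate i w) z - single (rotate (Suc i) w) z) \<in> Rel g m"
    by (simp only: ptensor_uvec)
  from lsub_add[OF lsub_Rel Suc this] show ?case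
    by simp
qed

text \<open>Moving a basis word by a rotation moves coefficients by the inverse rotation; in the sum
  over all rotations the difference disappears.\<close>

lemma rotate_inverse_sum:
  fixes f :: "nat list \<Rightarrow> rat"
  assumes "z \<in> words g m"
  shows "(\<Sum>w\<in>words g m. \<Sum>i<m. f w * single (rotate i w) z) = cyc_sum f z"
proof -
  have z: "length z = m" using assms by (simp add: words_def)
  have *: "(\<Sum>w\<in>words g m. f w * single (rotate i w) z) = f (rotate (m - i) z)" if "i < m" for i
  proof -
    have eq: "z = rotate i w \<longleftrightarrow> w = rotate (m - i) z" if "length w = m" for w
    proof
      assume "z = rotate i w"
      then have "rotate (m - i) z = rotate m w" using \<open>i < m\<close> by (simp add: rotate_rotate)
      then show "w = rotate (m - i) z" using that by simp
    next
      assume "w = rotate (m - i) z"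
      then have "rotate i w = rotate m z" using \<open>i < m\<close> by (simp add: rotate_rotate)
      then show "z = rotate i w" using z by simp
    qed
    have "(\<Sum>w\<in>words g m. f w * single (rotate i w) z) = 
      (\<Sum>w\<in>words g m. if w = rotate (m - i) z then f w else 0)"
      by (rule sum.cong) (auto simp: single_def eq words_def)
    then show ?thesis using assms by simp
  qed
  have "(\<Sum>w\<in>words g m. \<Sum>i<m. f w * single (rotate i w) z) = (\<Sum>i<m. f (rotate (m - i) z))"
    by (subst sum.swap) (simp add: *)
  also have "\<dots> = (\<Sum>i<m. f (rotate (Suc i) z))"
    by (rule sum.reindex_bij_witness[of _ "\<lambda>i. m - Suc i" "\<lambda>i. m - Suc i"])
      (auto simp: Suc_diff_Suc simp del: rotate_Suc)
  also have "\<dots> = cyc_sum f z"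
    using sum_rotate_shift[of f z] z by (simp add: cyc_sum_def)
  finally show ?thesis .
qed

text \<open>\<open>m\<close> times \<open>T\<close> differs from the sum of its rotations by a
  combination of the differences from \<open>single_rotate_Rel\<close>. If that sum vanishes,
  division by \<open>m\<close> exhibits \<open>T\<close> as a relation.\<close>

lemma Rel_iff:
  assumes "m > 0"
  shows "T \<in> Rel g m \<longleftrightarrow> T \<in> Tens g m \<and> (\<forall>w. cyc_sum T w = 0)"
proof (intro iffI)
  assume T: "T \<in> Tens g m \<and> (\<forall>w. cyc_sum T w = 0)"
  let ?D = "\<lambda>w i z. single w z - single (rotate i w) z"
  have 1: "(\<lambda>z. inverse (of_nat m) * (\<Sum>w\<in>words g m. \<Sum>i<m. T w * ?D w i z)) \<in> Rel g m"
    using assms by (intro lsub_mult lsub_sum lsub_Rel single_rotate_Rel)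
  have "inverse (of_nat m) * (\<Sum>w\<in>words g m. \<Sum>i<m. T w * ?D w i z) = T z" for z
  proof (cases "z \<in> words g m")
    case True
    have "(\<Sum>w\<in>words g m. \<Sum>i<m. T w * ?D w i z) =
       of_nat m * (\<Sum>w\<in>words g m. T w * single w z) - cyc_sum T z"
      by (simp add: right_diff_distrib sum_subtractf rotate_inverse_sum[OF True]
          sum_distrib_left mult.assoc)
    then show ?thesis
      using T Tens_expand[of T g m z] assms by simp
  next
    case False
    have "w \<noteq> z \<and> rotate i w \<noteq> z" if "w \<in> words g m" for i w
      using that False by auto
    then have "(\<Sum>w\<in>words g m. \<Sum>i<m. T w * ?D w i z) = 0"
      by (intro sum.neutral ballI) (auto simp: single_def)
    with False T show ?thesis by (simp add: Tens_iff)
  qed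
  with 1 show "T \<in> Rel g m" by simp
qed (use Rel_subset[OF assms] in auto)

section \<open>Pairs of cyclic words\<close>

lemma tprod_diff_left: "tprod p (\<lambda>w. x w - y w) z w = tprod p x z w - tprod p y z w"
  and tprod_diff_right: "tprod p z (\<lambda>w. x w - y w) w = tprod p z x w - tprod p z y w"
  by (simp_all add: tprod_def algebra_simps)

lemma tprod_single: "tprod (length u) (single u) (single v) = single (u @ v)"
proof
  fix z
  have "z = u @ v \<longleftrightarrow> length u \<le> length z \<and> take (length u) z = u \<and> drop (length u) z = v"
    using append_take_drop_id[of "length u" z] by (auto simp del: append_take_drop_id)
  then show "tprod (length u) (single u) (single v) z = single (u @ v) z"
    by (auto simp: tprod_def single_def)
qed

lemma single_Tens: "w \<in> words g m \<Longrightarrow> single w \<in> Tens g m"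
  by (auto simp: Tens_iff single_def)

lemma words_append: "length u = p \<Longrightarrow> u @ v \<in> words g (p + q) \<longleftrightarrow> u \<in> words g p \<and> v \<in> words g q"
  by (auto simp: words_def)

lemma bij_words_append:
  "bij_betw (\<lambda>(u, v). u @ v) (words g p \<times> words g q) (words g (p + q))"
proof (rule bij_betwI[where g = "\<lambda>w. (take p w, drop p w)"])
  show "(\<lambda>w. (take p w, drop p w)) \<in> words g (p + q) \<rightarrow> words g p \<times> words g q"
    by (auto simp: words_def dest: in_set_takeD in_set_dropD)
qed (auto simp: words_def)

lemma sum_words_append:
  "(\<Sum>w\<in>words g (p + q). f w) = (\<Sum>u\<in>words g p. \<Sum>v\<in>words g q. f (u @ v))"
  using sum.reindex_bij_betw[OF bij_words_append, of f g p q]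
  by (simp add: sum.cartesian_product case_prod_unfold)

lemma lsub_Rel2: "lsub (Rel2 g p q)"
  by (simp add: Rel2_def lsub_lspan)

text \<open>The averaging argument behind \<open>Rel_iff\<close>, run in both factors at once over
  the \<open>p * q\<close> pairs of rotations.\<close>

lemma Rel2I:
  assumes "p > 0" "q > 0" and T: "T \<in> Tens g (p + q)"
    and 0: "\<And>u v. length u = p \<Longrightarrow> length v = q \<Longrightarrow>
      (\<Sum>i<p. \<Sum>j<q. T (rotate i u @ rotate j v)) = 0"
  shows "T \<in> Rel2 g p q"
proof -
  let ?D = "\<lambda>u v i j z. single (u @ v) z - single (rotate i u @ rotate j v) z"
  have D: "?D u v i j \<in> Rel2 g p q" if "u \<in> words g p" "v \<in> words g q" for u v i j
  proof -
    let ?a = "\<lambda>z. single u z - single (rotate i u) z" and ?b = "\<lambda>z. single v z - single (rotate j v) z"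
    have len: "length u = p" using that by (simp add: words_def)
    \<comment> \<open>Rotating one factor at a time: each of the two changes lies in one of the
      generating families of \<open>Rel2\<close>.\<close>
    have *: "?D u v i j z = tprod p ?a (single v) z + tprod p (single (rotate i u)) ?b z" for z
    proof -
      have "?D u v i j z = tprod p (single u) (single v) z - tprod p (single (rotate i u)) (single (rotate j v)) z"
        using tprod_single[of u v] tprod_single[of "rotate i u" "rotate j v"] len by simp
      then show ?thesis by (simp add: tprod_diff_left tprod_diff_right)
    qed
    have "?a \<in> Rel g p" "single v \<in> Tens g q" "single (rotate i u) \<in> Tens g p" "?b \<in> Rel g q"
      using that assms by (simp_all add: single_rotate_Rel single_Tens)
    then have "tprod p ?a (single v) \<in> Rel2 g p q"
      and "tprod p (single (rotate i u)) ?b \<in> Rel2 g p q"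
      unfolding Rel2_def by (blast intro: lspan_base)+
    then have "(\<lambda>z. tprod p ?a (single v) z + tprod p (single (rotate i u)) ?b z) \<in> Rel2 g p q"
      by (intro lsub_add lsub_Rel2)
    then show ?thesis by (simp only: *)
  qed
  have 1: "(\<lambda>z. inverse (of_nat (p * q)) * (\<Sum>u\<in>words g p. \<Sum>v\<in>words g q. \<Sum>i<p. \<Sum>j<q. T (u @ v) * ?D u v i j z)) \<in> Rel2 g p q"
    by (intro lsub_mult lsub_sum lsub_Rel2 D)
  have "inverse (of_nat (p * q)) * (\<Sum>u\<in>words g p. \<Sum>v\<in>words g q. \<Sum>i<p. \<Sum>j<q. T (u @ v) * ?D u v i j z) = T z" for z
  proof (cases "z \<in> words g (p + q)")
    case True
    define a b where "a = take p z" and "b = drop p z"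
    have z: "z = a @ b" and ab: "a \<in> words g p" "b \<in> words g q"
      using True by (auto simp: a_def b_def words_def dest: in_set_takeD in_set_dropD)
    have sp: "single (u @ v) z = single u a * single v b" if "length u = p" for u v
      using that ab by (auto simp: single_def z words_def)
    define F where "F u v i j = T (u @ v) * single (rotate i u) a * single (rotate j v) b" for u v i j
    have F: "(\<Sum>v\<in>words g q. \<Sum>j<q. F u v i j) = cyc_sum (\<lambda>v. T (u @ v)) b * single (rotate i u) a" for u i
      unfolding rotate_inverse_sum[OF ab(2), where f = "\<lambda>v. T (u @ v)", symmetric]
      by (simp add: F_def sum_distrib_left sum_distrib_right mult_ac)
    have "(\<Sum>u\<in>words g p. \<Sum>v\<in>words g q. \<Sum>i<p. \<Sum>j<q. T (u @ v) * single (rotate i u @ rotate j v) z)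
      = (\<Sum>u\<in>words g p. \<Sum>v\<in>words g q. \<Sum>i<p. \<Sum>j<q. F u v i j)"
      by (intro sum.cong refl) (subst sp, auto simp: words_def F_def)
    also have "\<dots> = (\<Sum>u\<in>words g p. \<Sum>i<p. cyc_sum (\<lambda>v. T (u @ v)) b * single (rotate i u) a)"
      unfolding F[symmetric] by (rule sum.cong[OF refl], rule sum.swap)
    also have "\<dots> = cyc_sum (\<lambda>u. cyc_sum (\<lambda>v. T (u @ v)) b) a"
      by (rule rotate_inverse_sum[OF ab(1)])
    also have "\<dots> = 0"
      using 0[of a b] ab by (simp add: cyc_sum_def words_def)
    finally have "(\<Sum>u\<in>words g p. \<Sum>v\<in>words g q. \<Sum>i<p. \<Sum>j<q. T (u @ v) * ?D u v i j z) =
       of_nat (p * q) * (\<Sum>u\<in>words g p. \<Sum>v\<in>words g q. T (u @ v) * single (u @ v) z)"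
      by (simp add: right_diff_distrib sum_subtractf sum_distrib_left mult.assoc)
    also have "\<dots> = of_nat (p * q) * T z"
      using Tens_expand[OF T, of z] sum_words_append[of "\<lambda>w. T w * single w z" g p q] by simp
    finally show ?thesis using assms(1,2) by (simp del: of_nat_mult)
  next
    case False
    have "u @ v \<noteq> z \<and> rotate i u @ rotate j v \<noteq> z" if "u \<in> words g p" "v \<in> words g q" for i j u v
      using that False words_append[of u p v g q] words_append[of "rotate i u" p "rotate j v" g q]
      by (auto simp: words_def)
    then have "(\<Sum>u\<in>words g p. \<Sum>v\<in>words g q. \<Sum>i<p. \<Sum>j<q. T (u @ v) * ?D u v i j z) = 0"
      by (intro sum.neutral ballI) (auto simp: single_def)
    with False T show ?thesis by (simp add: Tens_iff)
  qed
  with 1 show ?thesis by simp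
qed

section \<open>Lie elements and the reduction of \<open>dcomp\<close> to \<open>cmap\<close>\<close>

lemma tprod_add_left: "tprod p (\<lambda>w. x w + y w) z w = tprod p x z w + tprod p y z w"
  and tprod_add_right: "tprod p z (\<lambda>w. x w + y w) w = tprod p z x w + tprod p z y w"
  and tprod_mult_left: "tprod p (\<lambda>w. c * x w) z w = c * tprod p x z w"
  and tprod_mult_right: "tprod p z (\<lambda>w. c * x w) w = c * tprod p z x w"
  and tprod_zero_left [simp]: "tprod p (\<lambda>w. 0) z = (\<lambda>w. 0)"
  and tprod_zero_right [simp]: "tprod p z (\<lambda>w. 0) = (\<lambda>w. 0)"
  by (auto simp: tprod_def algebra_simps)

lemma tprod_assoc: "tprod (p + q) (tprod p x y) z = tprod p x (tprod q y z)"
proof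
  fix w
  show "tprod (p + q) (tprod p x y) z w = tprod p x (tprod q y z) w"
    by (auto simp: tprod_def min_absorb1 min_absorb2 drop_take add.commute le_diff_conv2)
qed

lemma tprod_Tens:
  assumes "x \<in> Tens g p" "y \<in> Tens g q"
  shows "tprod p x y \<in> Tens g (p + q)"
proof -
  have "length w = p + q \<and> (\<forall>i\<in>set w. i < 2 * g)" if "tprod p x y w \<noteq> 0" for w
  proof -
    from that have "p \<le> length w" "x (take p w) \<noteq> 0" "y (drop p w) \<noteq> 0"
      by (auto simp: tprod_def split: if_splits)
    moreover from this assms have "length (drop p w) = q"
      "\<forall>i\<in>set (take p w). i < 2 * g" "\<forall>i\<in>set (drop p w). i < 2 * g"
      unfolding Tens_def by blast+
    moreover have "set w = set (take p w) \<union> set (drop p w)"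
      by (simp flip: set_append)
    ultimately show ?thesis by auto
  qed
  then show ?thesis by (auto simp: Tens_def)
qed

lemma vt_length: "length w \<noteq> 1 \<Longrightarrow> vt a w = 0"
  by (auto simp: vt_def split: list.splits)

lemma vt_Tens: "X \<in> vecs g \<Longrightarrow> vt X \<in> Tens g 1"
  by (auto simp: vt_def vecs_def Tens_def not_less[symmetric] split: list.splits)

lemma tbr_Tens: "x \<in> Tens g p \<Longrightarrow> y \<in> Tens g q \<Longrightarrow> tbr p q x y \<in> Tens g (p + q)"
  unfolding tbr_def using tprod_Tens[of x g p y q] tprod_Tens[of y g q x p]
  by (intro lsub_diff lsub_Tens) (simp_all add: add.commute)

lemma tbr_add_left: "tbr p q (\<lambda>w. x w + y w) z = (\<lambda>w. tbr p q x z w + tbr p q y z w)"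
  and tbr_add_right: "tbr p q z (\<lambda>w. x w + y w) = (\<lambda>w. tbr p q z x w + tbr p q z y w)"
  and tbr_mult_left: "tbr p q (\<lambda>w. c * x w) z = (\<lambda>w. c * tbr p q x z w)"
  and tbr_mult_right: "tbr p q z (\<lambda>w. c * x w) = (\<lambda>w. c * tbr p q z x w)"
  and tbr_zero_left: "tbr p q (\<lambda>w. 0) z = (\<lambda>w. 0)"
  and tbr_zero_right: "tbr p q z (\<lambda>w. 0) = (\<lambda>w. 0)"
  by (auto simp: tbr_def tprod_add_left tprod_add_right tprod_mult_left tprod_mult_right algebra_simps)

text \<open>Commutators satisfy the Jacobi identity; in this form it trades a bracket in the second
  argument for left-normed ones.\<close>

lemma tbr_jacobi:
  "tbr p (q + r) x (tbr q r y z) w =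
     tbr (p + q) r (tbr p q x y) z w - tbr (p + r) q (tbr p r x z) y w"
proof -
  have *: "tprod (p + q) (tprod q y x) z = tprod q y (tprod p x z)" for q p x y z
    by (subst add.commute) (rule tprod_assoc)
  show ?thesis
    by (simp add: tbr_def tprod_diff_left tprod_diff_right tprod_assoc *)
qed

lemma lnb_aux_snoc:
  "lnb_aux acc n (as @ [a]) = tbr (n + length as) 1 (lnb_aux acc n as) (vt a)"
  by (induction as arbitrary: acc n) auto

lemma lnb_snoc: "vs \<noteq> [] \<Longrightarrow> lnb (vs @ [a]) = tbr (length vs) 1 (lnb vs) (vt a)"
  by (cases vs) (auto simp: lnb_aux_snoc)

lemma lnb_single [simp]: "lnb [a] = vt a"
  by simp

lemma lnb_Tens:
  assumes "vs \<noteq> []" "set vs \<subseteq> vecs g"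
  shows "lnb vs \<in> Tens g (length vs)"
  using assms
proof (induction vs rule: rev_nonempty_induct)
  case (single x)
  then show ?case using vt_Tens by simp
next
  case (snoc x xs)
  then show ?case using tbr_Tens[of "lnb xs" g "length xs" "vt x" 1] vt_Tens
    by (simp add: lnb_snoc)
qed

lemma lsub_Lie: "lsub (Lie g m)" and lsub_HL: "lsub (HL g m)"
  by (simp_all add: Lie_def HL_def lsub_lspan)

lemma Lie_induct [consumes 1, case_names zero add mult lnb]:
  assumes "x \<in> Lie g m" and "P (\<lambda>w. 0)" "\<And>x y. P x \<Longrightarrow> P y \<Longrightarrow> P (\<lambda>w. x w + y w)"
    "\<And>c x. P x \<Longrightarrow> P (\<lambda>w. c * x w)"
    "\<And>vs. length vs = m \<Longrightarrow> set vs \<subseteq> vecs g \<Longrightarrow> P (lnb vs)"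
  shows "P x"
proof -
  have "Lie g m \<subseteq> Collect P"
    unfolding Lie_def by (rule lspan_minimal) (auto intro!: lsubI assms)
  with assms(1) show ?thesis by auto
qed

lemma lnb_Lie: "set vs \<subseteq> vecs g \<Longrightarrow> lnb vs \<in> Lie g (length vs)"
  unfolding Lie_def by (rule lspan_base) blast

lemma Lie_Tens:
  assumes "m > 0"
  shows "Lie g m \<subseteq> Tens g m"
proof
  fix x assume "x \<in> Lie g m"
  then show "x \<in> Tens g m"
    using assms
    by (induction rule: Lie_induct)
      (auto intro: lsub_zero lsub_add lsub_mult lsub_Tens lnb_Tens)
qed

lemma Lie_tbr1:
  assumes "u \<in> Lie g n" "n > 0" "a \<in> vecs g"
  shows "tbr n 1 u (vt a) \<in> Lie g (n + 1)"
  using assms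
proof (induction rule: Lie_induct)
  case (lnb vs)
  then have "tbr n 1 (lnb vs) (vt a) = lnb (vs @ [a])"
    by (subst lnb_snoc) auto
  with lnb lnb_Lie[of "vs @ [a]" g] show ?case by simp
qed (simp_all add: tbr_zero_left tbr_add_left tbr_mult_left lsub_zero[OF lsub_Lie]
       lsub_add[OF lsub_Lie] lsub_mult[OF lsub_Lie])

text \<open>The Jacobi identity splits the last letter \<open>a\<close> off the second argument,
  which leaves brackets of the shorter word with \<open>x\<close> and with \<open>[x, a]\<close>.
  The second of these is why \<open>x\<close> and \<open>p\<close> are generalised in the
  induction.\<close>

lemma Lie_tbr_lnb:
  assumes "vs \<noteq> []" "set vs \<subseteq> vecs g" "x \<in> Lie g p" "p > 0"
  shows "tbr p (length vs) x (lnb vs) \<in> Lie g (p + length vs)"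
  using assms
proof (induction vs arbitrary: x p rule: rev_nonempty_induct)
  case (single a)
  then show ?case using Lie_tbr1[of x g p a] by simp
next
  case (snoc a vs)
  let ?q = "length vs"
  have "tbr p (length (vs @ [a])) x (lnb (vs @ [a])) =
      (\<lambda>w. tbr (p + ?q) 1 (tbr p ?q x (lnb vs)) (vt a) w - tbr (p + 1) ?q (tbr p 1 x (vt a)) (lnb vs) w)"
    using snoc.hyps tbr_jacobi[of p ?q 1 x "lnb vs" "vt a"] by (auto simp: lnb_snoc)
  moreover have "tbr (p + ?q) 1 (tbr p ?q x (lnb vs)) (vt a) \<in> Lie g (p + ?q + 1)"
    using snoc by (intro Lie_tbr1) auto
  moreover have "tbr (p + 1) ?q (tbr p 1 x (vt a)) (lnb vs) \<in> Lie g (p + 1 + ?q)"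
    using snoc.prems by (intro snoc.IH Lie_tbr1) auto
  ultimately show ?case
    using lsub_diff[OF lsub_Lie] by (simp add: algebra_simps)
qed

lemma Lie_tbr:
  assumes "y \<in> Lie g q" "x \<in> Lie g p" "p > 0" "q > 0"
  shows "tbr p q x y \<in> Lie g (p + q)"
  using assms
proof (induction rule: Lie_induct)
  case (lnb vs)
  then show ?case using Lie_tbr_lnb[of vs g x p] by force
qed (simp_all add: tbr_zero_right tbr_add_right tbr_mult_right lsub_zero[OF lsub_Lie]
       lsub_add[OF lsub_Lie] lsub_mult[OF lsub_Lie])

text \<open>Holds for Lie elements; it moves the contracted letter \<open>y\<close> to the front, and thereby expresses
  every component of the cobracket through the single contraction \<open>cmap\<close>.\<close>
definition reduces :: "tensor \<Rightarrow> bool" where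
  "reduces f \<longleftrightarrow> (\<forall>u y v. f (u @ y # v) = (-1) ^ length u * shuffle_sum (\<lambda>w. f (y # w)) (rev u) v)"

text \<open>Vanishing on proper shuffles (Ree) follows from the reduction formula: the two summands
  obtained by splitting off the first letter of either argument cancel.\<close>
lemma reduces_shuffle_sum:
  assumes "reduces f"
  shows "shuffle_sum f (c # u) (d # v) = 0"
proof -
  have "f (rev u @ c # (d # v)) = (-1) ^ length u * shuffle_sum (\<lambda>w. f (c # w)) u (d # v)"
    using assms unfolding reduces_def by (metis length_rev rev_rev_ident)
  moreover have "f ((rev (c # u)) @ d # v) = (-1) ^ Suc (length u) * shuffle_sum (\<lambda>w. f (d # w)) (c # u) v"
    using assms unfolding reduces_def by (metis length_rev rev_rev_ident length_Cons)
  ultimately have "(-1) ^ length u * (shuffle_sum (\<lambda>w. f (c # w)) u (d # v) + shuffle_sum (\<lambda>w. f (d # w)) (c # u) v) = 0"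
    by (simp add: algebra_simps)
  then show ?thesis by simp
qed

lemma reduces_zero: "reduces (\<lambda>w. 0)"
  by (simp add: reduces_def)

lemma reduces_add: "reduces f \<Longrightarrow> reduces h \<Longrightarrow> reduces (\<lambda>w. f w + h w)"
  by (simp add: reduces_def shuffle_sum_add algebra_simps)

lemma reduces_mult: "reduces f \<Longrightarrow> reduces (\<lambda>w. c * f w)"
  by (simp add: reduces_def shuffle_sum_mult algebra_simps)

lemma reduces_vt: "reduces (vt a)"
proof -
  have "vt a (u @ y # v) = (-1) ^ length u * shuffle_sum (\<lambda>w. vt a (y # w)) (rev u) v" for u y v
  proof (cases "u = [] \<and> v = []")
    case False
    then have "shuffle_sum (\<lambda>w. vt a (y # w)) (rev u) v = shuffle_sum (\<lambda>w. 0) (rev u) v"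
      by (intro shuffle_sum_cong) (auto simp: vt_def split: list.splits)
    moreover from False have "vt a (u @ y # v) = 0"
      by (cases u) (auto simp: vt_def split: list.splits)
    ultimately show ?thesis by simp
  qed simp
  then show ?thesis by (simp add: reduces_def)
qed

lemma tprod_vt_snoc:
  assumes "L \<in> Tens g n"
  shows "tprod n L (vt a) (w @ [x]) = L w * a x"
proof (cases "length w = n")
  case False
  then have "L w = 0" and "n \<le> Suc (length w) \<Longrightarrow> length (drop n (w @ [x])) \<noteq> 1"
    using assms by (auto simp: Tens_def)
  then show ?thesis by (auto simp: tprod_def vt_length)
qed (simp add: tprod_def vt_def)

lemma tbr1_Cons:
  assumes L: "L \<in> Tens g n"
  shows "tbr n 1 L (vt a) (x # w) = L (butlast (x # w)) * a (last (x # w)) - a x * L w"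
proof -
  have "tprod n L (vt a) (x # w) = L (butlast (x # w)) * a (last (x # w))"
    using tprod_vt_snoc[OF L, of a "butlast (x # w)" "last (x # w)"]
    by (simp only: append_butlast_last_id list.distinct not_False_eq_True)
  then show ?thesis by (simp add: tbr_def tprod_def vt_def)
qed

text \<open>The value of \<open>[L, a]\<close> at a word has one term dropping the last letter and
  one dropping the first. Sorting the shuffles of \<open>rev u\<close> and \<open>v\<close> by their
  last letter produces the two terms wanted, together with two terms carrying \<open>a y\<close>;
  these cancel because \<open>L\<close> kills proper shuffles.\<close>

lemma reduces_tbr1:
  assumes L: "L \<in> Tens g n" and red: "reduces L"
  shows "reduces (tbr n 1 L (vt a))"
proof -
  let ?B = "tbr n 1 L (vt a)"
  note B = tbr1_Cons[OF L, of a]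
  have "?B (u @ y # v) = (-1) ^ length u * shuffle_sum (\<lambda>w. ?B (y # w)) (rev u) v" for u y v
  proof (cases u)
    case (Cons c u')
    have s: "(\<lambda>w. ?B (y # w @ [z])) = (\<lambda>w. a z * L (y # w) - a y * L (w @ [z]))" for z
      by (auto simp: B[unfolded One_nat_def] butlast_append)
    have r: "L (u @ y # v) = (-1) ^ length u * shuffle_sum (\<lambda>w. L (y # w)) (rev u) v" for u y v
      using red by (simp add: reduces_def)
    show ?thesis
    proof (cases v rule: rev_cases)
      case Nil
      have "?B (u @ y # v) = L (c # u') * a y - a c * L (u' @ [y])"
        using B[unfolded One_nat_def, of c "u' @ [y]"] by (simp add: Cons Nil butlast_append)
      also have "L (u' @ [y]) = (-1) ^ length u' * L (y # rev u')"
        using r[of u' y "[]"] by simp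
      also have "L (c # u') = (-1) ^ length u' * L (rev u' @ [c])"
        using r[of "rev u'" c "[]"] by (simp flip: mult.assoc power_mult_distrib)
      also have "(-1) ^ length u' * L (rev u' @ [c]) * a y - a c * ((-1) ^ length u' * L (y # rev u'))
         = (-1) ^ length u * ?B (y # rev u' @ [c])"
        unfolding fun_cong[OF s[of c], of "rev u'"] by (simp add: Cons algebra_simps)
      finally show ?thesis by (simp add: Cons Nil)
    next
      case (snoc v' b)
      have "shuffle_sum (\<lambda>w. ?B (y # w)) (rev u) v
         = (a c * shuffle_sum (\<lambda>w. L (y # w)) (rev u') v - a y * shuffle_sum (\<lambda>w. L (w @ [c])) (rev u') v)
         + (a b * shuffle_sum (\<lambda>w. L (y # w)) (rev u) v' - a y * shuffle_sum (\<lambda>w. L (w @ [b])) (rev u) v')"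
        unfolding Cons snoc rev.simps shuffle_sum_snoc s shuffle_sum_diff shuffle_sum_mult ..
      also have "shuffle_sum (\<lambda>w. L (w @ [c])) (rev u') v = - shuffle_sum (\<lambda>w. L (w @ [b])) (rev u) v'"
      proof -
        have "shuffle_sum L (rev u) v = 0"
          using reduces_shuffle_sum[OF red] by (cases "rev u"; cases v) (auto simp: Cons snoc)
        then show ?thesis unfolding Cons snoc rev.simps shuffle_sum_snoc by simp
      qed
      finally have "(-1) ^ length u * shuffle_sum (\<lambda>w. ?B (y # w)) (rev u) v
         = a b * L (u @ y # v') - a c * L (u' @ y # v)"
        unfolding r by (simp add: Cons algebra_simps)
      also have "\<dots> = ?B (u @ y # v)"
        using B[unfolded One_nat_def, of c "u' @ y # v"] by (simp add: Cons snoc butlast_append)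
      finally show ?thesis by simp
    qed
  qed simp
  then show ?thesis by (simp add: reduces_def)
qed

lemma reduces_Lie:
  assumes "x \<in> Lie g m" "m > 0"
  shows "reduces x"
  using assms
proof (induction rule: Lie_induct)
  case (lnb vs)
  then have "vs \<noteq> []" by auto
  then show ?case using lnb(2)
  proof (induction vs rule: rev_nonempty_induct)
    case (single x)
    then show ?case by (simp add: reduces_vt)
  next
    case (snoc x xs)
    then show ?case using reduces_tbr1[of "lnb xs" g "length xs" x] lnb_Tens[of xs g]
      by (simp add: lnb_snoc)
  qed
qed (auto intro: reduces_zero reduces_add reduces_mult)

section \<open>Contractions of tensors in the kernel of the bracket\<close>

lemma HL_induct [consumes 1, case_names zero add mult tprod]:
  assumes "x \<in> HL g m" and "P (\<lambda>w. 0)" "\<And>x y. P x \<Longrightarrow> P y \<Longrightarrow> P (\<lambda>w. x w + y w)"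
    "\<And>c x. P x \<Longrightarrow> P (\<lambda>w. c * x w)"
    "\<And>X u. X \<in> vecs g \<Longrightarrow> u \<in> Lie g m \<Longrightarrow> P (tprod 1 (vt X) u)"
  shows "P x"
proof -
  have "HL g m \<subseteq> Collect P"
    unfolding HL_def by (rule lspan_minimal) (auto intro!: lsubI assms simp del: One_nat_def)
  with assms(1) show ?thesis by auto
qed

lemma tprod_vt_Cons [simp]: "tprod (Suc 0) (vt X) u (x # w) = X x * u w"
  by (simp add: tprod_def vt_def)

lemma HL_reduces:
  assumes "T \<in> HL g m" "m > 0"
  shows "reduces (\<lambda>w. T (x # w))"
  using assms
proof (induction rule: HL_induct)
  case (tprod X u)
  then show ?case using reduces_mult[OF reduces_Lie[of u g m]] by simp
qed (auto intro: reduces_zero reduces_add reduces_mult)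

lemma HL_Tens:
  assumes "m > 0"
  shows "HL g m \<subseteq> Tens g (m + 1)"
proof
  fix T assume "T \<in> HL g m"
  then show "T \<in> Tens g (m + 1)"
  proof (induction rule: HL_induct)
    case (tprod X u)
    then show ?case using tprod_Tens[OF vt_Tens[of X g], of u m] Lie_Tens[OF assms, of g] by auto
  qed (auto intro: lsub_zero lsub_add lsub_mult lsub_Tens)
qed

lemma hk_Tens: "T \<in> hk g k \<Longrightarrow> T \<in> Tens g (k + 2)"
  using HL_Tens[of "k + 1" g] by (auto simp: hk_def)

text \<open>On tensors the bracket map is the identity minus a cyclic shift of the letters, so its
  kernel is invariant under rotation.\<close>

lemma hk_cyclic:
  assumes "T \<in> hk g k"
  shows "T (u @ v) = T (v @ u)"
proof (induction v arbitrary: u)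
  case (Cons x v)
  have "br_map T (v @ u @ [x]) = 0"
    using assms by (simp add: hk_def)
  then have "T (v @ u @ [x]) = T (x # v @ u)"
    by (simp add: br_map_def butlast_append)
  with Cons[of "u @ [x]"] show ?case by simp
qed simp

lemma Jf_swap: "Jf g x y = - Jf g y x"
  by (auto simp: Jf_def)

text \<open>Cyclic invariance brings the first contracted slot to the front, after which the value
  depends on the inner and outer words alone and no longer on \<open>i\<close> and
  \<open>j\<close>.\<close>

lemma contr_hk:
  assumes "T \<in> hk g k"
  shows "contr g k i j T u v = (\<Sum>x<2*g. \<Sum>y<2*g. Jf g x y * T (x # u @ y # v))"
  unfolding contr_def
proof (intro sum.cong refl)
  fix x y
  let ?t = "take (k + 1 - j) v" and ?d = "drop (k + 1 - j) v"
  have "T (?d @ [x] @ u @ [y] @ ?t) = T (([x] @ u @ [y] @ ?t) @ ?d)"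
    by (rule hk_cyclic[OF assms])
  also have "([x] @ u @ [y] @ ?t) @ ?d = x # u @ y # v" by simp
  finally show "Jf g x y * T (?d @ [x] @ u @ [y] @ ?t) = Jf g x y * T (x # u @ y # v)"
    by simp
qed

text \<open>This counts the pairs of slots with exactly \<open>p\<close> slots between them. The
  bounds on \<open>p\<close> exclude adjacent slots and the pair of outermost slots.\<close>

lemma sum_pairs_const:
  fixes F :: rat
  assumes "1 \<le> p" "p \<le> k - 1"
  shows "(\<Sum>i\<le>k+1. \<Sum>j\<le>k+1. if i < j \<and> 1 < j - i \<and> j - i < k + 1 \<and> j - i - 1 = p then F else 0)
     = of_nat (k + 1 - p) * F"
proof -
  have "(\<Sum>j\<le>k+1. if i < j \<and> 1 < j - i \<and> j - i < k + 1 \<and> j - i - 1 = p then F else 0) =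
     (if i < k + 1 - p then F else 0)" for i
  proof -
    have "(i < j \<and> 1 < j - i \<and> j - i < k + 1 \<and> j - i - 1 = p) \<longleftrightarrow> j = i + p + 1" for j
      using assms by auto
    then have "(\<Sum>j\<le>k+1. if i < j \<and> 1 < j - i \<and> j - i < k + 1 \<and> j - i - 1 = p then F else 0) =
      (\<Sum>j\<le>k+1. if j = i + p + 1 then F else 0)" by simp
    then show ?thesis using assms by auto
  qed
  then have "(\<Sum>i\<le>k+1. \<Sum>j\<le>k+1. if i < j \<and> 1 < j - i \<and> j - i < k + 1 \<and> j - i - 1 = p then F else 0)
    = (\<Sum>i\<in>{..k+1}. if i < k + 1 - p then F else 0)" by simp
  also have "\<dots> = (\<Sum>i\<in>{i\<in>{..k+1}. i < k + 1 - p}. F)"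
    by (rule sum.inter_filter[symmetric]) simp
  also have "{i\<in>{..k+1}. i < k + 1 - p} = {..<k + 1 - p}" by auto
  finally show ?thesis by simp
qed

text \<open>All pairs of slots contribute the same contraction: \<open>k + 1 - p\<close> times in
  the first sum and \<open>p + 1\<close> times in the second, where skewness undoes the minus sign.
  This is the factor \<open>k + 2\<close>; the reduction formula for Lie elements then rewrites the
  common value through \<open>cmap\<close>.\<close>

lemma dcomp_hk:
  assumes T: "T \<in> hk g k" and p: "1 \<le> p" "p \<le> k - 1" and uv: "length u = p" "length v = k - p"
  shows "dcomp g k p T (u @ v) = of_nat (k + 2) * (-1) ^ p * shuffle_sum (cmap g k T) (rev u) v"
proof -
  define F where "F = (\<Sum>x<2*g. \<Sum>y<2*g. Jf g x y * T (x # u @ y # v))"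
  have 1: "contr g k i j T u v = F" for i j
    using contr_hk[OF T] by (simp add: F_def)
  \<comment> \<open>Exchanging the inner and the outer word is a rotation that swaps the two
    contracted letters, and the form is skew.\<close>
  have 2: "contr g k i j T v u = - F" for i j
  proof -
    have "contr g k i j T v u = (\<Sum>x<2*g. \<Sum>y<2*g. Jf g x y * T (x # v @ y # u))"
      by (rule contr_hk[OF T])
    also have "\<dots> = (\<Sum>x<2*g. \<Sum>y<2*g. - (Jf g y x * T (y # u @ x # v)))"
    proof (intro sum.cong refl)
      fix x y
      show "Jf g x y * T (x # v @ y # u) = - (Jf g y x * T (y # u @ x # v))"
        using hk_cyclic[OF T, of "x # v" "y # u"] Jf_swap[of g x y] by simp
    qed
    also have "\<dots> = - F"
      unfolding F_def by (subst sum.swap) (simp add: sum_negf)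
    finally show ?thesis .
  qed
  have "dcomp g k p T (u @ v) = of_nat (k + 1 - p) * F - of_nat (k + 1 - (k - p)) * (- F)"
    unfolding dcomp_def
    using p uv sum_pairs_const[of p k F] sum_pairs_const[of "k - p" k "- F"]
    by (simp add: 1 2 cong: if_cong)
  also have "\<dots> = of_nat ((k + 1 - p) + (k + 1 - (k - p))) * F"
    by (simp only: of_nat_add) (simp add: algebra_simps)
  also have "(k + 1 - p) + (k + 1 - (k - p)) = k + 2"
    using p by simp
  also have "F = (-1) ^ p * shuffle_sum (cmap g k T) (rev u) v"
  proof -
    have "F = (\<Sum>x<2*g. \<Sum>y<2*g. Jf g x y * ((-1) ^ p * shuffle_sum (\<lambda>w. T (x # y # w)) (rev u) v))"
    proof -
      have "T (x # u @ y # v) = (-1) ^ p * shuffle_sum (\<lambda>w. T (x # y # w)) (rev u) v" for x y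
        using HL_reduces[of T g "k + 1" x] T uv by (simp add: hk_def reduces_def)
      then show ?thesis by (simp add: F_def)
    qed
    also have "\<dots> = (-1) ^ p * (\<Sum>x<2*g. \<Sum>y<2*g. shuffle_sum (\<lambda>w. Jf g x y * T (x # y # w)) (rev u) v)"
      by (simp add: shuffle_sum_mult sum_distrib_left algebra_simps)
    also have "\<dots> = (-1) ^ p * shuffle_sum (\<lambda>w. \<Sum>x<2*g. \<Sum>y<2*g. Jf g x y * T (x # y # w)) (rev u) v"
      by (simp add: shuffle_sum_sum)
    also have "shuffle_sum (\<lambda>w. \<Sum>x<2*g. \<Sum>y<2*g. Jf g x y * T (x # y # w)) (rev u) v = shuffle_sum (cmap g k T) (rev u) v"
      using uv p by (intro shuffle_sum_cong) (simp add: cmap_def)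
    finally show ?thesis .
  qed
  finally show ?thesis by (simp add: algebra_simps)
qed

lemma cmap_Tens:
  assumes "T \<in> Tens g (k + 2)"
  shows "cmap g k T \<in> Tens g k"
proof -
  have "cmap g k T w = 0" if "w \<notin> words g k" for w
  proof (cases "length w = k")
    case True
    have "T (x # y # w) = 0" for x y
      using assms that True by (auto simp: Tens_iff words_def)
    then show ?thesis by (simp add: cmap_def)
  qed (simp add: cmap_def)
  then show ?thesis by (simp add: Tens_iff)
qed

text \<open>By \<open>dcomp_hk\<close> the rotation sums of each component are scalar multiples of
  \<open>bicyc_sum\<close> of the contraction; the reversal of \<open>u\<close> is absorbed because
  the hypothesis ranges over all words.\<close>

lemma KerDI:
  assumes T: "T \<in> hk g k"
    and 0: "\<And>u v. u \<noteq> [] \<Longrightarrow> v \<noteq> [] \<Longrightarrow> length u + length v = k \<Longrightarrow> bicyc_sum (cmap g k T) u v = 0"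
  shows "T \<in> KerD g k"
proof -
  have "dcomp g k p T \<in> Rel2 g p (k - p)" if p: "1 \<le> p" "p \<le> k - 1" for p
  proof (rule Rel2I)
    have "dcomp g k p T w = 0" if w: "w \<notin> words g (p + (k - p))" for w
    proof (cases "length w = k")
      case True
      let ?u = "take p w" and ?v = "drop p w"
      have "shuffle_sum (cmap g k T) (rev ?u) ?v = shuffle_sum (\<lambda>w. 0) (rev ?u) ?v"
      proof (rule shuffle_sum_cong)
        fix z assume z: "length z = length (rev ?u) + length ?v" "set z = set (rev ?u) \<union> set ?v"
        then have "set z = set w" by (simp flip: set_append)
        with z True p w have "z \<notin> words g k" by (auto simp: words_def)
        then show "cmap g k T z = 0"
          using cmap_Tens[OF hk_Tens[OF T]] by (simp add: Tens_iff)
      qed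
      then show ?thesis
        using dcomp_hk[OF T p, of ?u ?v] True p by simp
    qed (simp add: dcomp_def)
    then show "dcomp g k p T \<in> Tens g (p + (k - p))" by (simp add: Tens_iff)
    fix u v :: "nat list" assume uv: "length u = p" "length v = k - p"
    have "(\<Sum>i<p. \<Sum>j<k - p. dcomp g k p T (rotate i u @ rotate j v)) =
       of_nat (k + 2) * (-1) ^ p * (\<Sum>i<p. \<Sum>j<k - p. shuffle_sum (cmap g k T) (rev (rotate i u)) (rotate j v))"
      using uv by (simp add: dcomp_hk[OF T p] sum_distrib_left)
    also have "(\<Sum>i<p. \<Sum>j<k - p. shuffle_sum (cmap g k T) (rev (rotate i u)) (rotate j v)) = bicyc_sum (cmap g k T) (rev u) v"
      using bicyc_sum_rev1[where f = "cmap g k T" and u = u and v = v] uv by simp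
    also have "\<dots> = 0"
      using uv p by (intro 0) auto
    finally show "(\<Sum>i<p. \<Sum>j<k - p. dcomp g k p T (rotate i u @ rotate j v)) = 0" by simp
  qed (use p in auto)
  with T show ?thesis by (auto simp: KerD_def)
qed

section \<open>Equivariance under the symplectic group\<close>

lemma words_Suc: "words g (Suc m) = (\<lambda>(x, w). x # w) ` ({..<2*g} \<times> words g m)"
  by (auto simp: words_def length_Suc_conv image_iff)

lemma sum_words_Suc: "(\<Sum>w\<in>words g (Suc m). f w) = (\<Sum>x<2*g. \<Sum>w\<in>words g m. f (x # w))"
  unfolding words_Suc
  by (subst sum.reindex) (auto simp: inj_on_def sum.cartesian_product case_prod_unfold)

lemma words_0 [simp]: "words g 0 = {[]}"
  by (auto simp: words_def)

lemma act_cong: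
  assumes "\<And>u. u \<in> words g m \<Longrightarrow> T u = T' u"
  shows "act g m A T = act g m A T'"
  using assms by (auto simp: act_def intro!: sum.cong)

lemma act_add: "act g m A (\<lambda>w. x w + y w) = (\<lambda>w. act g m A x w + act g m A y w)"
  and act_mult: "act g m A (\<lambda>w. c * x w) = (\<lambda>w. c * act g m A x w)"
  and act_diff: "act g m A (\<lambda>w. x w - y w) = (\<lambda>w. act g m A x w - act g m A y w)"
  and act_zero [simp]: "act g m A (\<lambda>w. 0) = (\<lambda>w. 0)"
  by (auto simp: act_def sum.distrib sum_subtractf sum_distrib_left algebra_simps)

lemma act_sum: "act g m A (\<lambda>w. \<Sum>i\<in>I. f i w) = (\<lambda>w. \<Sum>i\<in>I. act g m A (f i) w)"
  by (induction I rule: infinite_finite_induct) (auto simp: act_add)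

lemma act_length: "length w \<noteq> m \<Longrightarrow> act g m A T w = 0"
  by (simp add: act_def)

lemma act_Cons:
  "act g (Suc m) A T (x # w) = (\<Sum>y<2*g. A x y * act g m A (\<lambda>z. T (y # z)) w)"
  by (auto simp: act_def sum_words_Suc prod.lessThan_Suc_shift sum_distrib_left mult_ac
      simp del: prod.lessThan_Suc)

lemma Spg_zero: "A \<in> Spg g \<Longrightarrow> 2 * g \<le> p \<or> 2 * g \<le> q \<Longrightarrow> A p q = 0"
  by (auto simp: Spg_def)

lemma Spg_sum:
  "A \<in> Spg g \<Longrightarrow> p < 2 * g \<Longrightarrow> q < 2 * g \<Longrightarrow> (\<Sum>r<2*g. \<Sum>s<2*g. A r p * Jf g r s * A s q) = Jf g p q"
  by (auto simp: Spg_def)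

lemma act_Tens:
  assumes "A \<in> Spg g"
  shows "act g m A T \<in> Tens g m"
proof -
  have "act g m A T w = 0" if w: "w \<notin> words g m" for w
  proof (cases "length w = m")
    case True
    with w obtain i where "i < m" "2 * g \<le> w ! i"
      by (auto simp: words_def in_set_conv_nth subset_iff not_less)
    then have "(\<Prod>i<m. A (w ! i) (u ! i)) = 0" for u
      using Spg_zero[OF assms] by (intro prod_zero) auto
    then show ?thesis by (simp only: act_def mult_zero_left sum.neutral_const if_cancel)
  qed (simp add: act_length)
  then show ?thesis by (simp add: Tens_iff)
qed

text \<open>Permutations of tensor slots in one-line notation, acting on words by
  \<open>map ((!) w) s\<close>. Rotation, reversal, adjacent transpositions and the four terms of
  \<open>hook_op\<close> are all treated in this form.\<close>

definition place_perm :: "nat \<Rightarrow> nat list \<Rightarrow> bool" where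
  "place_perm m s \<longleftrightarrow> length s = m \<and> distinct s \<and> set s = {..<m}"

lemma map_nth_words:
  "place_perm m s \<Longrightarrow> u \<in> words g m \<Longrightarrow> map ((!) u) s \<in> words g m"
proof -
  assume s: "place_perm m s" and u: "u \<in> words g m"
  have "\<forall>i\<in>set s. u ! i \<in> set u"
    using s u unfolding place_perm_def words_def by simp
  then have "set (map ((!) u) s) \<subseteq> set u" by auto
  with s u show "map ((!) u) s \<in> words g m"
    by (auto simp: place_perm_def words_def)
qed

text \<open>The diagonal action applies the same matrix in every slot, so permuting the slots only
  reorders the product of matrix entries.\<close>

lemma act_place_perm:
  assumes s: "place_perm m s" and w: "length w = m"
  shows "act g m A (\<lambda>z. T (map ((!) z) s)) w = act g m A T (map ((!) w) s)"
proof -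
  let ?f = "\<lambda>u. map ((!) u) s"
  have "inj_on ?f (words g m)"
  proof (rule inj_onI)
    fix u v assume uv: "u \<in> words g m" "v \<in> words g m" "?f u = ?f v"
    then have "\<forall>i\<in>set s. u ! i = v ! i" by simp
    with s uv(1,2) show "u = v"
      by (intro nth_equalityI) (auto simp: place_perm_def words_def)
  qed
  moreover have sub: "?f ` words g m \<subseteq> words g m"
    using map_nth_words[OF s] by auto
  ultimately have bij: "bij_betw ?f (words g m) (words g m)"
    by (auto simp: bij_betw_def endo_inj_surj)
  have "bij_betw ((!) s) {..<m} {..<m}"
    using s by (auto simp: place_perm_def intro!: bij_betw_nth)
  then have peq: "(\<Prod>i<m. A (w ! i) (u ! i)) = (\<Prod>i<m. A (w ! (s ! i)) (u ! (s ! i)))" for u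
    by (rule prod.reindex_bij_betw[symmetric])
  have "(\<Sum>u\<in>words g m. (\<Prod>i<m. A (w ! i) (u ! i)) * T (?f u))
     = (\<Sum>u\<in>words g m. (\<Prod>i<m. A (?f w ! i) (?f u ! i)) * T (?f u))"
    unfolding peq by (intro sum.cong refl arg_cong2[where f = "(*)"] prod.cong)
      (use s in \<open>auto simp: place_perm_def\<close>)
  also have "\<dots> = (\<Sum>u\<in>words g m. (\<Prod>i<m. A (?f w ! i) (u ! i)) * T u)"
    by (rule sum.reindex_bij_betw[OF bij])
  finally show ?thesis using s w by (simp add: act_def place_perm_def)
qed

lemma act_rotate: "length w = m \<Longrightarrow> act g m A (\<lambda>z. T (rotate i z)) w = act g m A T (rotate i w)"
proof -
  assume w: "length w = m"
  have eq: "map ((!) z) (rotate i [0..<m]) = rotate i z" if "length z = m" for z :: "nat list"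
    using that map_nth[of z] by (simp flip: rotate_map)
  have "act g m A (\<lambda>z. T (rotate i z)) w = act g m A (\<lambda>z. T (map ((!) z) (rotate i [0..<m]))) w"
    by (intro fun_cong[OF act_cong]) (simp add: eq words_def)
  also have "\<dots> = act g m A T (rotate i w)"
    using w by (subst act_place_perm) (auto simp: place_perm_def eq)
  finally show ?thesis .
qed

lemma act_rev: "length w = m \<Longrightarrow> act g m A (\<lambda>z. T (rev z)) w = act g m A T (rev w)"
proof -
  assume w: "length w = m"
  have eq: "map ((!) z) (rev [0..<m]) = rev z" if "length z = m" for z :: "nat list"
    using that map_nth[of z] by (simp flip: rev_map)
  have "act g m A (\<lambda>z. T (rev z)) w = act g m A (\<lambda>z. T (map ((!) z) (rev [0..<m]))) w"
    by (intro fun_cong[OF act_cong]) (simp add: eq words_def)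
  also have "\<dots> = act g m A T (rev w)"
    using w by (subst act_place_perm) (auto simp: place_perm_def eq)
  finally show ?thesis .
qed

lemma prod_nth_append:
  assumes "length w = p" "length u = p"
  shows "(\<Prod>i<p + q. A ((w @ w') ! i) ((u @ u') ! i)) =
    (\<Prod>i<p. A (w ! i) (u ! i)) * (\<Prod>i<q. A (w' ! i) (u' ! i) :: rat)"
proof -
  have "length u = length w" using assms by simp
  then show ?thesis
    unfolding assms(1)[symmetric]
    by (induction u w rule: list_induct2)
      (simp_all add: prod.lessThan_Suc_shift del: prod.lessThan_Suc)
qed

lemma act_tprod: "act g (p + q) A (tprod p x y) = tprod p (act g p A x) (act g q A y)"
proof
  fix w
  show "act g (p + q) A (tprod p x y) w = tprod p (act g p A x) (act g q A y) w"
  proof (cases "length w = p + q")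
    case True
    let ?a = "take p w" and ?b = "drop p w"
    have len: "length ?a = p" "length ?b = q" using True by auto
    have "act g (p + q) A (tprod p x y) w =
      (\<Sum>u\<in>words g p. \<Sum>v\<in>words g q. (\<Prod>i<p + q. A ((?a @ ?b) ! i) ((u @ v) ! i)) * tprod p x y (u @ v))"
      using True by (simp add: act_def sum_words_append)
    also have "\<dots> = (\<Sum>u\<in>words g p. \<Sum>v\<in>words g q.
        ((\<Prod>i<p. A (?a ! i) (u ! i)) * x u) * ((\<Prod>i<q. A (?b ! i) (v ! i)) * y v))"
    proof (intro sum.cong refl)
      fix u v assume "u \<in> words g p" "v \<in> words g q"
      then have u: "length u = p" by (simp add: words_def)
      show "(\<Prod>i<p + q. A ((?a @ ?b) ! i) ((u @ v) ! i)) * tprod p x y (u @ v) =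
        ((\<Prod>i<p. A (?a ! i) (u ! i)) * x u) * ((\<Prod>i<q. A (?b ! i) (v ! i)) * y v)"
        unfolding prod_nth_append[OF len(1) u] using u by (simp add: tprod_def)
    qed
    also have "\<dots> = act g p A x ?a * act g q A y ?b"
      using len by (simp add: act_def sum_product)
    finally show ?thesis using True by (simp add: tprod_def)
  qed (auto simp: act_length tprod_def)
qed

definition mat_vec :: "nat \<Rightarrow> (nat \<Rightarrow> nat \<Rightarrow> rat) \<Rightarrow> (nat \<Rightarrow> rat) \<Rightarrow> nat \<Rightarrow> rat" where
  "mat_vec g A X = (\<lambda>x. \<Sum>y<2*g. A x y * X y)"

lemma mat_vec_vecs: "A \<in> Spg g \<Longrightarrow> mat_vec g A X \<in> vecs g"
  by (auto simp: mat_vec_def vecs_def Spg_zero)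

lemma act_vt: "act g 1 A (vt X) = vt (mat_vec g A X)"
proof
  fix w
  show "act g 1 A (vt X) w = vt (mat_vec g A X) w"
  proof (cases "length w = 1")
    case True
    then obtain x where "w = [x]" by (auto simp: length_Suc_conv)
    then show ?thesis
      using act_Cons[of g 0 A "vt X" x "[]"]
      by (simp add: mat_vec_def vt_def act_def[of g 0])
  qed (simp add: act_length vt_length)
qed

lemma act_tbr: "act g (p + q) A (tbr p q x y) = tbr p q (act g p A x) (act g q A y)"
  using act_tprod[of g p q A x y] act_tprod[of g q p A y x]
  by (simp add: tbr_def act_diff add.commute)

lemma act_lnb:
  assumes "vs \<noteq> []"
  shows "act g (length vs) A (lnb vs) = lnb (map (mat_vec g A) vs)"
  using assms
proof (induction vs rule: rev_nonempty_induct)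
  case (single x)
  then show ?case using act_vt by simp
next
  case (snoc x xs)
  then show ?case
    using act_tbr[of g "length xs" 1 A "lnb xs" "vt x"] act_vt[of g A x]
    by (simp add: lnb_snoc)
qed

lemma act_Lie:
  assumes "A \<in> Spg g" "m > 0" "x \<in> Lie g m"
  shows "act g m A x \<in> Lie g m"
  using assms(3)
proof (induction rule: Lie_induct)
  case (lnb vs)
  then show ?case
    using act_lnb[of vs g A] lnb_Lie[of "map (mat_vec g A) vs" g] mat_vec_vecs[OF assms(1)] assms(2)
    by (force simp: image_subset_iff)
qed (simp_all add: act_add act_mult lsub_zero[OF lsub_Lie] lsub_add[OF lsub_Lie] lsub_mult[OF lsub_Lie])

lemma act_HL:
  assumes "A \<in> Spg g" "m > 0" "x \<in> HL g m"
  shows "act g (m + 1) A x \<in> HL g m"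
  using assms(3)
proof (induction rule: HL_induct)
  case (tprod X u)
  have "act g (1 + m) A (tprod 1 (vt X) u) = tprod 1 (vt (mat_vec g A X)) (act g m A u)"
    by (simp only: act_tprod act_vt)
  moreover have "tprod 1 (vt (mat_vec g A X)) (act g m A u) \<in> HL g m"
    unfolding HL_def using mat_vec_vecs[OF assms(1)] act_Lie[OF assms(1,2)] tprod(2)
    by (intro lspan_base) blast
  ultimately show ?case by (simp add: add.commute)
qed (simp_all add: act_add act_mult lsub_zero[OF lsub_HL] lsub_add[OF lsub_HL] lsub_mult[OF lsub_HL])

lemma act_hk:
  assumes A: "A \<in> Spg g" and T: "T \<in> hk g k"
  shows "act g (k + 2) A T \<in> hk g k"
proof -
  have "act g (k + 2) A T \<in> HL g (k + 1)"
    using act_HL[OF A, of "k + 1" T] T by (simp add: hk_def)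
  moreover have "br_map (act g (k + 2) A T) w = 0" for w
  proof (cases "length w = k + 2")
    case True
    have "T (rotate (k + 1) z) = T z" for z
      using hk_cyclic[OF T] unfolding rotate_drop_take by (metis append_take_drop_id)
    then have "act g (k + 2) A T (rotate (k + 1) w) = act g (k + 2) A T w"
      using act_rotate[OF True, of g A T "k + 1"] by simp
    moreover have "rotate (k + 1) w = last w # butlast w"
    proof -
      have "w = butlast w @ [last w]" using True by (intro append_butlast_last_id[symmetric]) auto
      moreover have "length (butlast w) = k + 1" using True by simp
      ultimately show ?thesis by (metis rotate_append append_Cons append_Nil)
    qed
    ultimately show ?thesis by (simp add: br_map_def)
  qed (auto simp: br_map_def act_length)
  ultimately show ?thesis by (auto simp: hk_def)
qed

text \<open>Once the sums over the two contracted letters are moved inside, the matrix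
  \<open>A^T J A\<close> appears, which equals \<open>J\<close>.\<close>

lemma cmap_act:
  assumes A: "A \<in> Spg g"
  shows "cmap g k (act g (k + 2) A T) = act g k A (cmap g k T)"
proof
  fix w
  show "cmap g k (act g (k + 2) A T) w = act g k A (cmap g k T) w"
  proof (cases "length w = k")
    case True
    let ?c = "\<lambda>a b. act g k A (\<lambda>z. T (a # b # z)) w"
    have "cmap g k (act g (k + 2) A T) w = (\<Sum>x<2*g. \<Sum>y<2*g. \<Sum>a<2*g. \<Sum>b<2*g. A x a * Jf g x y * A y b * ?c a b)"
      using True by (simp add: cmap_def act_Cons sum_distrib_left mult_ac)
    also have "\<dots> = (\<Sum>a<2*g. \<Sum>b<2*g. \<Sum>x<2*g. \<Sum>y<2*g. A x a * Jf g x y * A y b * ?c a b)"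
    proof -
      have "(\<Sum>x<2*g. \<Sum>y<2*g. \<Sum>a<2*g. \<Sum>b<2*g. F x y a b) = (\<Sum>a<2*g. \<Sum>b<2*g. \<Sum>x<2*g. \<Sum>y<2*g. F x y a b)"
        for F :: "nat \<Rightarrow> nat \<Rightarrow> nat \<Rightarrow> nat \<Rightarrow> rat"
      proof -
        have "(\<Sum>x<2*g. \<Sum>y<2*g. \<Sum>a<2*g. \<Sum>b<2*g. F x y a b) = (\<Sum>x<2*g. \<Sum>a<2*g. \<Sum>b<2*g. \<Sum>y<2*g. F x y a b)"
          by (rule sum.cong[OF refl], subst sum.swap, rule sum.cong[OF refl], rule sum.swap)
        also have "\<dots> = (\<Sum>a<2*g. \<Sum>b<2*g. \<Sum>x<2*g. \<Sum>y<2*g. F x y a b)"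
          by (subst sum.swap, rule sum.cong[OF refl], rule sum.swap)
        finally show ?thesis .
      qed
      then show ?thesis .
    qed
    also have "\<dots> = (\<Sum>a<2*g. \<Sum>b<2*g. Jf g a b * ?c a b)"
      by (intro sum.cong refl) (simp add: Spg_sum[OF A, symmetric] sum_distrib_right)
    also have "\<dots> = act g k A (\<lambda>z. \<Sum>a<2*g. \<Sum>b<2*g. Jf g a b * T (a # b # z)) w"
      by (simp add: act_sum act_mult)
    also have "\<dots> = act g k A (cmap g k T) w"
      by (intro fun_cong[OF act_cong]) (simp add: cmap_def words_def)
    finally show ?thesis .
  qed (simp add: cmap_def act_length)
qed

lemma act_Rel:
  assumes A: "A \<in> Spg g" and "m > 0" and T: "T \<in> Rel g m"
  shows "act g m A T \<in> Rel g m"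
proof -
  have T: "T \<in> Tens g m" "\<And>w. cyc_sum T w = 0"
    using T Rel_iff[OF assms(2)] by auto
  have "cyc_sum (act g m A T) w = 0" for w
  proof (cases "length w = m")
    case True
    have "cyc_sum (act g m A T) w = act g m A (\<lambda>z. \<Sum>i<m. T (rotate i z)) w"
      using True by (simp add: cyc_sum_def act_sum act_rotate)
    also have "\<dots> = act g m A (\<lambda>z. 0) w"
      using T(2) by (intro fun_cong[OF act_cong]) (auto simp: cyc_sum_def words_def)
    finally show ?thesis by simp
  qed (simp add: cyc_sum_def act_length)
  with act_Tens[OF A] show ?thesis using Rel_iff[OF assms(2)] by auto
qed

section \<open>Closure of the symplectic group under transposition\<close>

lemma Jf_square: "p < 2 * g \<Longrightarrow> q < 2 * g \<Longrightarrow> (\<Sum>r<2*g. Jf g p r * Jf g r q) = (if p = q then - 1 else 0)"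
proof -
  assume pq: "p < 2 * g" "q < 2 * g"
  let ?r = "if p < g then p + g else p - g"
  have "(\<Sum>r<2*g. Jf g p r * Jf g r q) = (\<Sum>r<2*g. if r = ?r then Jf g p ?r * Jf g ?r q else 0)"
    using pq by (intro sum.cong refl) (auto simp: Jf_def)
  also have "\<dots> = Jf g p ?r * Jf g ?r q"
    using pq by (subst sum.delta) auto
  also have "\<dots> = (if p = q then - 1 else 0)"
    using pq by (auto simp: Jf_def)
  finally show ?thesis .
qed

text \<open>From \<open>A^T J A = J\<close> and \<open>J^2 = -1\<close>, the matrix
  \<open>- J A^T J\<close> is a left inverse of \<open>A\<close>. For square matrices it is then a
  right inverse too, and multiplying \<open>A J A^T J = -1\<close> by \<open>J\<close> gives
  \<open>A J A^T = J\<close>.\<close>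

lemma Spg_transpose:
  assumes A: "A \<in> Spg g"
  shows "(\<lambda>p q. A q p) \<in> Spg g"
proof -
  define n where "n = 2 * g"
  define a where "a = mat n n (\<lambda>(i, j). A i j)"
  define J where "J = mat n n (\<lambda>(i, j). Jf g i j)"
  have [simp]: "a \<in> carrier_mat n n" "J \<in> carrier_mat n n"
    by (simp_all add: a_def J_def)
  have [simp]: "dim_row a = n" "dim_col a = n" "dim_row J = n" "dim_col J = n"
    by (simp_all add: a_def J_def)
  have JJ: "J * J = - 1\<^sub>m n"
    by (rule eq_matI)
      (auto simp: J_def scalar_prod_def atLeast0LessThan n_def Jf_square)
  have AJA: "a\<^sup>T * (J * a) = J"
  proof (rule eq_matI)
    fix p q assume "p < dim_row J" "q < dim_col J"
    then have pq: "p < n" "q < n" by (auto simp: J_def)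
    then have "(a\<^sup>T * (J * a)) $$ (p, q) = (\<Sum>r<n. \<Sum>s<n. A r p * Jf g r s * A s q)"
      by (simp add: a_def J_def scalar_prod_def atLeast0LessThan sum_distrib_left mult_ac)
    also have "\<dots> = J $$ (p, q)"
      using Spg_sum[OF A, of p q] pq by (simp add: J_def n_def)
    finally show "(a\<^sup>T * (J * a)) $$ (p, q) = J $$ (p, q)" .
  qed (auto simp: J_def a_def)
  define b where "b = - (J * a\<^sup>T * J)"
  have b: "b \<in> carrier_mat n n" unfolding b_def by (intro uminus_carrier_mat mult_carrier_mat[of _ n n _ n]) auto
  have "b * a = - (J * (a\<^sup>T * (J * a)))"
    unfolding b_def
    by (simp add: assoc_mult_mat[of _ n n _ n _ n] mult_carrier_mat[of _ n n _ n] uminus_mult_left_mat)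
  also have "\<dots> = 1\<^sub>m n"
    unfolding AJA JJ by simp
  finally have "a * b = 1\<^sub>m n"
    using b by (intro mat_mult_left_right_inverse[of b n a]) auto
  then have "- (a * (J * a\<^sup>T * J)) = 1\<^sub>m n"
    by (simp add: b_def)
  then have "a * (J * a\<^sup>T * J) = - 1\<^sub>m n"
    by (metis uminus_uminus_mat)
  then have "a * (J * a\<^sup>T * J) * J = - J"
    by simp
  moreover have "a * (J * a\<^sup>T * J) * J = a * (J * a\<^sup>T) * (J * J)"
    by (simp add: assoc_mult_mat[of _ n n _ n _ n] mult_carrier_mat[of _ n n _ n])
  moreover have "\<dots> = - (a * (J * a\<^sup>T))"
    unfolding JJ by simp
  ultimately have AJ: "a * (J * a\<^sup>T) = J"
    by (metis uminus_uminus_mat)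
  have "(\<Sum>r<n. \<Sum>s<n. A p r * Jf g r s * A q s) = Jf g p q" if "p < n" "q < n" for p q
  proof -
    have "(a * (J * a\<^sup>T)) $$ (p, q) = (\<Sum>r<n. \<Sum>s<n. A p r * Jf g r s * A q s)"
      using that by (simp add: a_def J_def scalar_prod_def atLeast0LessThan sum_distrib_left mult_ac)
    moreover have "J $$ (p, q) = Jf g p q" using that by (simp add: J_def)
    ultimately show ?thesis unfolding AJ by simp
  qed
  then show ?thesis using Spg_zero[OF A] by (auto simp: Spg_def n_def)
qed

section \<open>Weights and irreducibility of the module of a highest weight vector\<close>

text \<open>Powers of 2 separate integer exponents, so a torus element with one entry 2 and all
  others 1 reads off a single coordinate of a weight.\<close>

lemma two_powi_inject: "(2::rat) powi a = 2 powi b \<longleftrightarrow> a = b"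
  using power_int_strict_increasing[of a b "2::rat"] power_int_strict_increasing[of b a "2::rat"]
  by (cases a b rule: linorder_cases) auto

definition tau :: "nat \<Rightarrow> (nat \<Rightarrow> rat) \<Rightarrow> nat \<Rightarrow> rat" where
  "tau g t x = (if x < g then t x else inverse (t (x - g)))"

definition weight :: "nat \<Rightarrow> nat list \<Rightarrow> nat \<Rightarrow> int" where
  "weight g w i = int (count_list w i) - int (count_list w (i + g))"

lemma sum_tor:
  fixes F :: "nat \<Rightarrow> rat"
  assumes "x < 2 * g"
  shows "(\<Sum>y<2*g. tor g t x y * F y) = tau g t x * F x"
    and "(\<Sum>y<2*g. tor g t y x * F y) = tau g t x * F x"
proof -
  have "tor g t x y * F y = (if y = x then tau g t x * F x else 0)"
    and "tor g t y x * F y = (if y = x then tau g t x * F x else 0)" for y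
    using assms by (auto simp: tor_def tau_def)
  then show "(\<Sum>y<2*g. tor g t x y * F y) = tau g t x * F x"
    and "(\<Sum>y<2*g. tor g t y x * F y) = tau g t x * F x"
    using assms by simp_all
qed

lemma tor_Spg:
  assumes t: "\<forall>i<g. t i \<noteq> 0"
  shows "tor g t \<in> Spg g"
proof -
  have "(\<Sum>r<2*g. \<Sum>s<2*g. tor g t r p * Jf g r s * tor g t s q) = Jf g p q"
    if pq: "p < 2 * g" "q < 2 * g" for p q
  proof -
    have "(\<Sum>r<2*g. \<Sum>s<2*g. tor g t r p * Jf g r s * tor g t s q)
       = (\<Sum>r<2*g. tor g t r p * (\<Sum>s<2*g. tor g t s q * Jf g r s))"
      by (simp add: sum_distrib_left mult_ac)
    also have "\<dots> = tau g t p * (tau g t q * Jf g p q)"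
      using pq by (simp add: sum_tor)
    also have "\<dots> = Jf g p q"
      using t pq by (auto simp: tau_def Jf_def)
    finally show ?thesis .
  qed
  then show ?thesis by (auto simp: Spg_def tor_def)
qed

lemma act_tor:
  "act g (length w) (tor g t) T w = (if w \<in> words g (length w) then prod_list (map (tau g t) w) * T w else 0)"
proof (induction w arbitrary: T)
  case Nil
  then show ?case by (simp add: act_def)
next
  case (Cons x w)
  show ?case
  proof (cases "x < 2 * g")
    case True
    then show ?thesis
      by (simp add: act_Cons sum_tor Cons) (simp add: words_def)
  next
    case False
    then have "tor g t x y = 0" for y by (simp add: tor_def)
    with False show ?thesis by (simp add: act_Cons) (simp add: words_def)
  qed
qed

lemma prod_tau:
  assumes t: "\<forall>i<g. t i \<noteq> 0" and w: "set w \<subseteq> {..<2*g}"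
  shows "prod_list (map (tau g t) w) = (\<Prod>i<g. t i powi weight g w i)"
  using w
proof (induction w)
  case Nil
  then show ?case by (simp add: weight_def)
next
  case (Cons x w)
  define e where "e i = (if x = i then 1 else if x = i + g then - 1 else (0::int))" for i
  have "t i powi weight g (x # w) i = t i powi e i * t i powi weight g w i" if "i < g" for i
  proof -
    have "weight g (x # w) i = e i + weight g w i"
      using that by (auto simp: weight_def e_def)
    then show ?thesis using t that by (simp add: power_int_add)
  qed
  then have "(\<Prod>i<g. t i powi weight g (x # w) i) = (\<Prod>i<g. t i powi e i) * (\<Prod>i<g. t i powi weight g w i)"
    by (simp add: prod.distrib)
  also have "(\<Prod>i<g. t i powi e i) = tau g t x"
  proof -
    let ?j = "if x < g then x else x - g"
    have "(\<Prod>i<g. t i powi e i) = (\<Prod>i<g. if i = ?j then tau g t x else 1)"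
      by (intro prod.cong refl) (use Cons.prems in \<open>auto simp: e_def tau_def power_int_minus\<close>)
    then show ?thesis using Cons.prems by (auto split: if_splits)
  qed
  finally show ?case using Cons by simp
qed

lemma act_tor_Tens:
  assumes T: "T \<in> Tens g m" and t: "\<forall>i<g. t i \<noteq> 0"
  shows "act g m (tor g t) T w = (\<Prod>i<g. t i powi weight g w i) * T w"
proof (cases "w \<in> words g m")
  case True
  then show ?thesis
    using act_tor[of g w t T] prod_tau[OF t, of w] by (simp add: words_def)
next
  case False
  then show ?thesis using T act_Tens[OF tor_Spg[OF t], of m T] by (simp add: Tens_iff)
qed

text \<open>Adjacent transpositions generate the symmetric group: this is alternation in all slots
  from position \<open>a\<close> on, phrased without permutations.\<close>

definition alt_from :: "nat \<Rightarrow> tensor \<Rightarrow> bool" where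
  "alt_from a f \<longleftrightarrow> (\<forall>p x y r. a \<le> length p \<longrightarrow> f (p @ x # y # r) = - f (p @ y # x # r))"

lemma alt_fromD: "alt_from a f \<Longrightarrow> a \<le> length p \<Longrightarrow> f (p @ x # y # r) = - f (p @ y # x # r)"
  unfolding alt_from_def by blast

lemma alt_fromI:
  "(\<And>p x y r. a \<le> length p \<Longrightarrow> f (p @ x # y # r) = - f (p @ y # x # r)) \<Longrightarrow> alt_from a f"
  unfolding alt_from_def by blast

lemma alt_from_mono: "alt_from a f \<Longrightarrow> a \<le> b \<Longrightarrow> alt_from b f"
  by (rule alt_fromI) (erule alt_fromD, rule order_trans)

lemma alt_from_zero: "alt_from a (\<lambda>w. 0)"
  by (simp add: alt_from_def)

lemma alt_from_add:
  assumes "alt_from a f" "alt_from a h"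
  shows "alt_from a (\<lambda>w. f w + h w)"
proof (rule alt_fromI)
  fix p :: "nat list" and x y r
  assume p: "a \<le> length p"
  show "f (p @ x # y # r) + h (p @ x # y # r) = - (f (p @ y # x # r) + h (p @ y # x # r))"
    using alt_fromD[OF assms(1) p, of x y r] alt_fromD[OF assms(2) p, of x y r] by simp
qed

lemma alt_from_mult:
  assumes "alt_from a f"
  shows "alt_from a (\<lambda>w. c * f w)"
proof (rule alt_fromI)
  fix p :: "nat list" and x y r
  assume p: "a \<le> length p"
  show "c * f (p @ x # y # r) = - (c * f (p @ y # x # r))"
    using alt_fromD[OF assms(1) p, of x y r] by simp
qed

lemma alt_from_append:
  assumes "alt_from (length p) f"
  shows "alt_from 0 (\<lambda>w. f (p @ w))"
proof (rule alt_fromI)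
  fix q x y r
  show "f (p @ q @ x # y # r) = - f (p @ q @ y # x # r)"
    using alt_fromD[OF assms, of "p @ q" x y r] by simp
qed

lemma alt_from_Cons: "alt_from 0 f \<Longrightarrow> alt_from 0 (\<lambda>w. f (x # w))"
  using alt_from_append[of "[x]" f] alt_from_mono[of 0 f "length [x]"] by simp

lemma alt_from_Cons2: "alt_from 0 f \<Longrightarrow> f (x # y # r) = - f (y # x # r)"
  using alt_fromD[of 0 f "[]" x y r] by simp

lemma count_list_distinct: "distinct xs \<Longrightarrow> count_list xs x = (if x \<in> set xs then 1 else 0)"
  by (induction xs) auto

fun word_sign :: "nat list \<Rightarrow> rat" where
  "word_sign [] = 1"
| "word_sign (x # xs) = prod_list (map (\<lambda>y. if x < y then 1 else if x = y then 0 else - 1) xs) * word_sign xs"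

lemma word_sign_swap: "word_sign (p @ x # y # r) = - word_sign (p @ y # x # r)"
  by (induction p) (auto simp: algebra_simps)

text \<open>On its way to its place \<open>x\<close> passes exactly the smaller letters, each at the
  cost of a sign; meeting an equal letter forces the value 0.\<close>

lemma alt_insort:
  assumes "alt_from 0 f" "sorted zs"
  shows "f (x # zs) = prod_list (map (\<lambda>y. if x < y then 1 else if x = y then 0 else - 1) zs) * f (insort x zs)"
  using assms
proof (induction zs arbitrary: f)
  case (Cons y ys)
  consider "x < y" | "x = y" | "y < x" by linarith
  then show ?case
  proof cases
    case 1
    then have "map (\<lambda>y. if x < y then 1 else if x = y then 0 else - 1) ys = map (\<lambda>y. 1::rat) ys"
      using Cons.prems by auto
    with 1 show ?thesis by (simp add: map_replicate_const)
  next
    case 2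
    have "f (x # x # ys) = - f (x # x # ys)" by (rule alt_from_Cons2[OF Cons.prems(1)])
    then have "f (x # x # ys) = 0" by linarith
    with 2 show ?thesis by simp
  next
    case 3
    have "f (x # y # ys) = - f (y # x # ys)" by (rule alt_from_Cons2[OF Cons.prems(1)])
    with 3 Cons.IH[OF alt_from_Cons[OF Cons.prems(1)], of y] Cons.prems show ?thesis by simp
  qed
qed simp

text \<open>Insertion sort collects precisely the factors of \<open>word_sign\<close>. An
  alternating function is thus determined by its values on sorted words.\<close>

lemma alt_sort:
  assumes "alt_from 0 f"
  shows "f z = word_sign z * f (sort z)"
  using assms
proof (induction z arbitrary: f)
  case (Cons x zs)
  let ?c = "\<lambda>y. if x < y then 1 else if x = y then 0 else - 1 :: rat"
  have "f (x # zs) = word_sign zs * f (x # sort zs)"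
    using Cons.IH[OF alt_from_Cons[OF Cons.prems]] .
  also have "f (x # sort zs) = prod_list (map ?c (sort zs)) * f (insort x (sort zs))"
    using Cons.prems by (intro alt_insort) auto
  also have "prod_list (map ?c (sort zs)) = prod_list (map ?c zs)"
    unfolding prod_mset_prod_list[symmetric] mset_map mset_sort ..
  finally show ?case by (simp only: word_sign.simps sort_key_simps mult_ac)
qed simp

lemma word_sign_nonzero_iff: "word_sign z \<noteq> 0 \<longleftrightarrow> distinct z"
  by (induction z) (auto simp: prod_list_zero_iff split: if_splits)

lemma alt_from_act:
  assumes T: "T \<in> Tens g m" "alt_from a T"
  shows "alt_from a (act g m A T)"
proof -
  have "act g m A T (p @ x # y # r) = - act g m A T (p @ y # x # r)" if p: "a \<le> length p" for p x y r
  proof (cases "length (p @ x # y # r) = m")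
    case m: True
    let ?i = "length p"
    \<comment> \<open>One-line notation of the transposition of the slots \<open>?i\<close> and
      \<open>?i + 1\<close>.\<close>
    define s where "s = [0..<?i] @ [?i + 1, ?i] @ [?i + 2..<m]"
    have s: "place_perm m s"
      using m by (auto simp: place_perm_def s_def)
    have eq: "map ((!) (p' @ x' # y' # r')) s = p' @ y' # x' # r'"
      if "length p' = ?i" "length (p' @ x' # y' # r') = m" for p' r' :: "nat list" and x' y'
    proof -
      have "map ((!) (p' @ x' # y' # r')) [0..<?i] = p'"
        using that by (auto intro!: nth_equalityI simp: nth_append)
      moreover have "map ((!) (p' @ x' # y' # r')) [?i + 2..<m] = r'"
      proof (rule nth_equalityI)
        fix j assume "j < length (map ((!) (p' @ x' # y' # r')) [?i + 2..<m])"
        then have "map ((!) (p' @ x' # y' # r')) [?i + 2..<m] ! j = (p' @ x' # y' # r') ! (length p' + (2 + j))"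
          using that(1) by (simp add: add.assoc)
        also have "\<dots> = r' ! j" unfolding nth_append_length_plus by simp
        finally show "map ((!) (p' @ x' # y' # r')) [?i + 2..<m] ! j = r' ! j" .
      qed (use that in simp)
      ultimately show ?thesis using that by (simp add: s_def nth_append)
    qed
    have "T (map ((!) u) s) = - T u" if u: "u \<in> words g m" for u
    proof -
      have "?i + 1 < length u" using u m by (simp add: words_def)
      then have "u = take ?i u @ u ! ?i # u ! (?i + 1) # drop (?i + 2) u"
        by (metis (no_types, lifting) Cons_nth_drop_Suc Suc_eq_plus1 Suc_lessD add_2_eq_Suc' append_take_drop_id)
      then obtain p' x' y' r' where u': "u = p' @ x' # y' # r'" "length p' = ?i"
        using \<open>?i + 1 < length u\<close>
        by (metis (no_types, lifting) add_lessD1 length_take less_imp_le_nat min.absorb2)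
      then show ?thesis
        using eq[of p' x' y' r'] u alt_fromD[OF T(2), of p' x' y' r'] p by (simp add: words_def)
    qed
    then have "act g m A (\<lambda>z. T (map ((!) z) s)) = act g m A (\<lambda>z. - 1 * T z)"
      by (intro act_cong) simp
    then have "act g m A T (map ((!) (p @ x # y # r)) s) = - act g m A T (p @ x # y # r)"
      using act_place_perm[OF s m, of g A T] by (simp add: act_mult[of g m A "-1", simplified])
    then show ?thesis using eq[of p x y r] m by simp
  qed (auto simp: act_length)
  then show ?thesis by (rule alt_fromI)
qed

definition alt_tensors :: "nat \<Rightarrow> nat \<Rightarrow> nat \<Rightarrow> tensor set" where
  "alt_tensors g a b = {T \<in> Tens g (a + b). alt_from a T}"

text \<open>In coordinates, \<open>e_0 \<otimes> ... \<otimes> e_0 \<otimes> (e_0 \<and> ... \<and>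
  e_(b-1))\<close> with \<open>a\<close> leading factors.\<close>

definition hw_vector :: "nat \<Rightarrow> nat \<Rightarrow> tensor" where
  "hw_vector a b w = (if length w = a + b \<and> take a w = replicate a 0 \<and> set (drop a w) = {..<b} then word_sign (drop a w) else 0)"

definition hw_weight :: "nat \<Rightarrow> nat \<Rightarrow> nat \<Rightarrow> int" where
  "hw_weight a b i = (if i = 0 then int a + 1 else if i < b then 1 else 0)"

definition hw_word :: "nat \<Rightarrow> nat \<Rightarrow> nat list" where
  "hw_word a b = replicate a 0 @ [0..<b]"

lemma lsub_alt_tensors: "lsub (alt_tensors g a b)"
  by (rule lsubI)
    (auto simp: alt_tensors_def alt_from_zero alt_from_add alt_from_mult lsub_zero[OF lsub_Tens] lsub_add[OF lsub_Tens] lsub_mult[OF lsub_Tens])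

lemma invariant_alt_tensors: "invariant g (a + b) (alt_tensors g a b)"
  by (auto simp: invariant_def alt_tensors_def intro: act_Tens alt_from_act)

lemma hw_vector_word:
  assumes "hw_vector a b w \<noteq> 0" "0 < b"
  shows "set w = {..<b}" "length w = a + b" "count_list w i = nat (hw_weight a b i)"
proof -
  have w: "length w = a + b" "take a w = replicate a 0" "set (drop a w) = {..<b}" "distinct (drop a w)"
    using assms by (auto simp: hw_vector_def word_sign_nonzero_iff split: if_splits)
  have eq: "w = replicate a 0 @ drop a w"
    using w(2) by (metis append_take_drop_id)
  then have "set w = set (replicate a 0) \<union> {..<b}"
    using w(3) by (metis set_append)
  then show "set w = {..<b}" using assms(2) by auto
  have "count_list w i = count_list (replicate a 0) i + count_list (drop a w) i"
    by (subst eq) simp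
  also have "count_list (replicate a (0::nat)) i = (if i = 0 then a else 0)"
    by (induction a) auto
  also have "count_list (drop a w) i = (if i < b then 1 else 0)"
    using w(3,4) by (auto simp: count_list_distinct count_list_0_iff)
  finally show "count_list w i = nat (hw_weight a b i)"
    using assms(2) by (auto simp: hw_weight_def)
qed (use assms in \<open>auto simp: hw_vector_def split: if_splits\<close>)

lemma hw_vector_weight:
  assumes "hw_vector a b w \<noteq> 0" "0 < b" "b \<le> g"
  shows "weight g w i = hw_weight a b i"
  using hw_vector_word[OF assms(1,2)] assms(2,3) by (auto simp: weight_def hw_weight_def)

lemma hw_vector_alt_tensors: assumes "0 < b" "b \<le> g" shows "hw_vector a b \<in> alt_tensors g a b"
proof -
  have "length w = a + b \<and> (\<forall>x\<in>set w. x < 2 * g)" if "hw_vector a b w \<noteq> 0" for w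
    using hw_vector_word(1,2)[OF that assms(1)] assms(2) by auto
  then have "hw_vector a b \<in> Tens g (a + b)"
    by (simp add: Tens_def)
  moreover have "alt_from a (hw_vector a b)"
  proof (rule alt_fromI)
    fix p r :: "nat list" and x y assume that: "a \<le> length p"
    show "hw_vector a b (p @ x # y # r) = - hw_vector a b (p @ y # x # r)"
  proof -
    have "take a (p @ x # y # r) = take a (p @ y # x # r)"
      "drop a (p @ x # y # r) = drop a p @ x # y # r" "drop a (p @ y # x # r) = drop a p @ y # x # r"
      using that by simp_all
    moreover have "set (drop a p @ x # y # r) = set (drop a p @ y # x # r)" by auto
    moreover have "length (p @ x # y # r) = length (p @ y # x # r)" by simp
    ultimately show ?thesis
      using word_sign_swap[of "drop a p" x y r] unfolding hw_vector_def by (simp only: if_distrib[of uminus] minus_zero)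
  qed
  qed
  ultimately show ?thesis by (simp add: alt_tensors_def)
qed

lemma alt_nonzero_distinct:
  assumes "alt_from a T" "T w \<noteq> 0" "a \<le> length w"
  shows "distinct (drop a w)"
proof -
  have "alt_from 0 (\<lambda>z. T (take a w @ z))"
    using assms alt_from_append[of "take a w" T] by simp
  from alt_sort[OF this, of "drop a w"] assms(2) have "word_sign (drop a w) \<noteq> 0"
    by auto
  then show ?thesis by (simp add: word_sign_nonzero_iff)
qed

lemma sum_weight:
  assumes "w \<in> words g m"
  shows "(\<Sum>i<g. weight g w i) = int m - 2 * (\<Sum>i<g. int (count_list w (i + g)))"
proof -
  have "m = (\<Sum>i<2*g. count_list w i)"
    using assms sum_count_set[of w "{..<2*g}"] by (simp add: words_def)
  also have "\<dots> = (\<Sum>i=0..<g. count_list w i) + (\<Sum>i=g..<g+g. count_list w i)"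
    using sum.atLeastLessThan_concat[of 0 g "g + g" "count_list w"]
    by (simp add: lessThan_atLeast0 mult_2)
  also have "(\<Sum>i=g..<g+g. count_list w i) = (\<Sum>i<g. count_list w (i + g))"
    by (rule sum.reindex_bij_witness[of _ "\<lambda>i. i + g" "\<lambda>i. i - g"]) auto
  finally have "int m = (\<Sum>i<g. int (count_list w i)) + (\<Sum>i<g. int (count_list w (i + g)))"
    by (simp add: lessThan_atLeast0)
  then show ?thesis by (simp add: weight_def sum_subtractf)
qed

lemma sum_hw_weight:
  assumes "0 < b"
  shows "(\<Sum>i<j. hw_weight a b i) = (if j = 0 then 0 else int (a + min j b))"
  using assms by (induction j) (auto simp: hw_weight_def min_def)

text \<open>The weight has total \<open>a + b\<close>, the length of the word, so by
  \<open>sum_weight\<close> no letter from the dual half occurs. The weight then confines the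
  letters to those below \<open>b\<close>, and alternation makes the last \<open>b\<close> of them
  distinct, hence each occurs there once. Nonzero letters have multiplicity one, so only 0 is left
  for the first \<open>a\<close> slots.\<close>

lemma highest_words:
  assumes T: "T \<in> alt_tensors g a b" and "0 < b" "b \<le> g"
    and w: "w \<in> words g (a + b)" and weight: "\<forall>i<g. weight g w i = hw_weight a b i" and nz: "T w \<noteq> 0"
  shows "take a w = replicate a 0 \<and> set (drop a w) = {..<b}"
proof -
  have len: "length w = a + b" using w by (simp add: words_def)
  have "(\<Sum>i<g. weight g w i) = int (a + b)"
    using weight sum_hw_weight[of b a g] assms(2,3) by simp
  with sum_weight[OF w] have "(\<Sum>i<g. int (count_list w (i + g))) = 0" by simp
  then have c0: "\<forall>i<g. count_list w (i + g) = 0"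
    by (subst (asm) sum_nonneg_eq_0_iff) auto
  have small: "x < g" if "x \<in> set w" for x
  proof (rule ccontr)
    assume "\<not> x < g"
    moreover have "x < 2 * g" using w that by (auto simp: words_def)
    ultimately have "count_list w (x - g + g) = 0" using c0[rule_format, of "x - g"] by simp
    with that \<open>\<not> x < g\<close> show False by (simp add: count_list_0_iff)
  qed
  have cnt: "int (count_list w i) = hw_weight a b i" if "i < g" for i
    using weight c0 that by (simp add: weight_def)
  have sub: "set w \<subseteq> {..<b}"
  proof
    fix x assume x: "x \<in> set w"
    then have "count_list w x \<noteq> 0" by (simp add: count_list_0_iff)
    with cnt[OF small[OF x]] show "x \<in> {..<b}"
      using assms(2) by (auto simp: hw_weight_def split: if_splits)
  qed
  have dist: "distinct (drop a w)"
    using T nz len by (intro alt_nonzero_distinct) (auto simp: alt_tensors_def)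
  have "set (drop a w) \<subseteq> {..<b}" using sub by (auto dest: in_set_dropD)
  moreover have "card (set (drop a w)) = card {..<b}"
    using dist len by (simp add: distinct_card)
  ultimately have set: "set (drop a w) = {..<b}"
    by (intro card_subset_eq) auto
  have "x = 0" if x: "x \<in> set (take a w)" for x
  proof (rule ccontr)
    assume "x \<noteq> 0"
    from x have xw: "x \<in> set w" by (rule in_set_takeD)
    have "count_list w x = count_list (take a w) x + count_list (drop a w) x"
      by (metis append_take_drop_id count_list_append)
    moreover have "count_list (take a w) x \<noteq> 0" "count_list (drop a w) x \<noteq> 0"
      using x xw sub set by (auto simp: count_list_0_iff)
    moreover have "int (count_list w x) \<le> 1"
      using cnt[OF small[OF xw]] \<open>x \<noteq> 0\<close> by (simp add: hw_weight_def)
    ultimately show False by simp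
  qed
  then have "take a w = replicate a 0"
    using len by (intro replicate_eqI) auto
  with set show ?thesis by simp
qed

definition is_hw_word :: "nat \<Rightarrow> nat \<Rightarrow> nat \<Rightarrow> nat list \<Rightarrow> bool" where
  "is_hw_word g a b w \<longleftrightarrow> w \<in> words g (a + b) \<and> (\<forall>i<g. weight g w i = hw_weight a b i)"

text \<open>Multiplicity one: on words of the top weight the shape is forced by
  \<open>highest_words\<close>, and sorting the alternating part relates every value to the one at
  \<open>hw_word a b\<close>.\<close>

lemma weight_space:
  assumes T: "T \<in> alt_tensors g a b" and b: "0 < b" "b \<le> g"
  shows "(if is_hw_word g a b w then T w else 0) = T (hw_word a b) * hw_vector a b w"
proof (cases "is_hw_word g a b w")
  case True
  show ?thesis
  proof (cases "take a w = replicate a 0 \<and> set (drop a w) = {..<b}")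
    case hw: True
    have len: "length w = a + b" using True by (simp add: is_hw_word_def words_def)
    have "alt_from 0 (\<lambda>z. T (replicate a 0 @ z))"
      using T by (intro alt_from_append) (simp add: alt_tensors_def)
    from alt_sort[OF this, of "drop a w"]
    have "T w = word_sign (drop a w) * T (replicate a 0 @ sort (drop a w))"
      using hw by (metis append_take_drop_id)
    also have "sort (drop a w) = [0..<b]"
    proof (rule sorted_distinct_set_unique)
      show "distinct (sort (drop a w))"
        using hw len by (simp add: card_distinct)
    qed (use conjunct2[OF hw] in \<open>simp_all add: lessThan_atLeast0\<close>)
    finally show ?thesis using True hw len by (simp add: hw_vector_def hw_word_def)
  next
    case False
    then have "T w = 0" using highest_words[OF T b] True by (auto simp: is_hw_word_def)
    moreover have "hw_vector a b w = 0" using False by (auto simp: hw_vector_def)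
    ultimately show ?thesis by simp
  qed
next
  case False
  then have "hw_vector a b w = 0"
    using hw_vector_word[OF _ b(1), of a w] hw_vector_weight[OF _ b, of a w] b(2)
    by (fastforce simp: is_hw_word_def words_def)
  with False show ?thesis by simp
qed

text \<open>Lagrange interpolation with torus elements: there are finitely many words of other
  weights, and for each of them some operator stabilising \<open>U\<close> kills it while fixing all
  words of the top weight. Their product is the projection.\<close>

lemma hw_weight_projection:
  assumes U: "lsub U" "invariant g (a + b) U" "U \<subseteq> Tens g (a + b)" and T: "T \<in> U"
  shows "(\<lambda>w. if is_hw_word g a b w then T w else 0) \<in> U"
proof -
  let ?X = "{w \<in> words g (a + b). \<not> is_hw_word g a b w}"
  have "\<exists>f. (\<forall>T\<in>U. (\<lambda>w. f w * T w) \<in> U) \<and> (\<forall>w\<in>Y. f w = 0) \<and> (\<forall>w. is_hw_word g a b w \<longrightarrow> f w = (1::rat))"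
    if "Y \<subseteq> ?X" "finite Y" for Y
    using that(2,1)
  proof (induction Y rule: finite_induct)
    case empty
    show ?case by (rule exI[of _ "\<lambda>w. 1"]) simp
  next
    case (insert y Y)
    then obtain f where f: "\<forall>T\<in>U. (\<lambda>w. f w * T w) \<in> U" "\<forall>w\<in>Y. f w = 0"
      "\<forall>w. is_hw_word g a b w \<longrightarrow> f w = 1" by auto
    from insert obtain i where i: "i < g" "weight g y i \<noteq> hw_weight a b i"
      by (auto simp: is_hw_word_def)
    define t where "t j = (if j = i then 2 else 1 :: rat)" for j
    have t: "\<forall>j<g. t j \<noteq> 0" by (simp add: t_def)
    have prod: "(\<Prod>j<g. t j powi weight g w j) = 2 powi weight g w i" for w
    proof -
      have "(\<Prod>j<g. t j powi weight g w j) = (\<Prod>j<g. if j = i then 2 powi weight g w i else 1)"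
        by (intro prod.cong) (auto simp: t_def)
      then show ?thesis using i by simp
    qed
    define c d where "c = (2::rat) powi weight g y i" and "d = (2::rat) powi hw_weight a b i"
    have cd: "d - c \<noteq> 0" using i(2) by (simp add: c_def d_def two_powi_inject)
    \<comment> \<open>The new factor vanishes at \<open>y\<close>, where the torus eigenvalue is
      \<open>c\<close>, and is 1 on words of the top weight, where it is \<open>d\<close>.\<close>
    define h where "h w = f w * ((2 powi weight g w i - c) / (d - c))" for w
    have "(\<lambda>w. h w * S w) \<in> U" if S: "S \<in> U" for S
    proof -
      let ?R = "\<lambda>w. inverse (d - c) * (act g (a + b) (tor g t) S w - c * S w)"
      have "act g (a + b) (tor g t) S \<in> U"
        using U(2) tor_Spg[OF t] S by (auto simp: invariant_def)
      then have "?R \<in> U"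
        by (intro lsub_mult[OF U(1)] lsub_diff[OF U(1)] S)
      then have "(\<lambda>w. f w * ?R w) \<in> U" by (rule f(1)[rule_format])
      moreover have "S \<in> Tens g (a + b)" using S U(3) by auto
      ultimately show ?thesis
        by (simp add: act_tor_Tens[OF _ t] prod h_def field_simps)
    qed
    moreover have "\<forall>w\<in>insert y Y. h w = 0" using f(2) by (auto simp: h_def c_def)
    moreover have "\<forall>w. is_hw_word g a b w \<longrightarrow> h w = 1"
      using f(3) cd i(1) by (auto simp: h_def is_hw_word_def d_def)
    ultimately show ?case by blast
  qed
  from this[of ?X] obtain f where f: "\<forall>T\<in>U. (\<lambda>w. f w * T w) \<in> U" "\<forall>w\<in>?X. f w = 0"
    "\<forall>w. is_hw_word g a b w \<longrightarrow> f w = (1::rat)" by auto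
  have "(if is_hw_word g a b w then T w else 0) = f w * T w" for w
    using f(2,3) T U(3) by (cases "w \<in> words g (a + b)") (auto simp: Tens_iff is_hw_word_def)
  then show ?thesis using f(1) T by simp
qed

section \<open>The standard inner product and the generated module\<close>

definition std_inner :: "nat \<Rightarrow> nat \<Rightarrow> tensor \<Rightarrow> tensor \<Rightarrow> rat" where
  "std_inner g m x y = (\<Sum>w\<in>words g m. x w * y w)"

lemma std_inner_act: "std_inner g m x (act g m A y) = std_inner g m (act g m (\<lambda>p q. A q p) x) y"
proof -
  have len: "length w = m" if "w \<in> words g m" for w using that by (simp add: words_def)
  have "std_inner g m x (act g m A y) = (\<Sum>w\<in>words g m. \<Sum>u\<in>words g m. (\<Prod>i<m. A (w ! i) (u ! i)) * x w * y u)"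
    by (simp add: std_inner_def act_def len sum_distrib_left mult_ac cong: sum.cong)
  also have "\<dots> = (\<Sum>u\<in>words g m. \<Sum>w\<in>words g m. (\<Prod>i<m. A (w ! i) (u ! i)) * x w * y u)"
    by (rule sum.swap)
  also have "\<dots> = std_inner g m (act g m (\<lambda>p q. A q p) x) y"
    by (simp add: std_inner_def act_def len sum_distrib_left sum_distrib_right mult_ac cong: sum.cong)
  finally show ?thesis .
qed

definition hw_module :: "nat \<Rightarrow> nat \<Rightarrow> nat \<Rightarrow> tensor set" where
  "hw_module g a b = \<Inter> {S. lsub S \<and> invariant g (a + b) S \<and> hw_vector a b \<in> S}"

lemma hw_module_minimal: "lsub S \<Longrightarrow> invariant g (a + b) S \<Longrightarrow> hw_vector a b \<in> S \<Longrightarrow> hw_module g a b \<subseteq> S"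
  by (auto simp: hw_module_def)

lemma lsub_hw_module: "lsub (hw_module g a b)"
  unfolding hw_module_def lsub_def by blast

lemma invariant_hw_module: "invariant g (a + b) (hw_module g a b)"
  unfolding hw_module_def invariant_def by blast

lemma hw_vector_hw_module: "hw_vector a b \<in> hw_module g a b"
  by (simp add: hw_module_def)

lemma hw_module_alt_tensors: "0 < b \<Longrightarrow> b \<le> g \<Longrightarrow> hw_module g a b \<subseteq> alt_tensors g a b"
  by (intro hw_module_minimal lsub_alt_tensors invariant_alt_tensors hw_vector_alt_tensors)

text \<open>If no element of \<open>U\<close> has a component along the highest weight vector, then that vector is
  orthogonal to \<open>U\<close> for the standard inner product. Since \<open>Sp\<close> is closed under transposition, the
  orthogonal complement of \<open>U\<close> is invariant, so it contains the whole module and in particular \<open>U\<close>.\<close>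
lemma hw_module_irreducible:
  assumes b: "0 < b" "b \<le> g"
    and U: "lsub U" "invariant g (a + b) U" "U \<subseteq> hw_module g a b" "T \<in> U" "T w \<noteq> 0"
  shows "U = hw_module g a b"
proof -
  have UN: "U \<subseteq> alt_tensors g a b" using U(3) hw_module_alt_tensors[OF b] by auto
  then have UT: "U \<subseteq> Tens g (a + b)" by (auto simp: alt_tensors_def)
  have proj: "(\<lambda>w. S (hw_word a b) * hw_vector a b w) \<in> U" if "S \<in> U" for S
    using hw_weight_projection[OF U(1,2) UT that] weight_space[of S g a b] UN b that by auto
  have "hw_vector a b \<in> U"
  proof (rule ccontr)
    assume nU: "hw_vector a b \<notin> U"
    have zero: "S (hw_word a b) = 0" if "S \<in> U" for S
    proof (rule ccontr)
      assume "S (hw_word a b) \<noteq> 0"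
      moreover have "(\<lambda>w. inverse (S (hw_word a b)) * (S (hw_word a b) * hw_vector a b w)) \<in> U"
        using proj[OF that] by (rule lsub_mult[OF U(1)])
      ultimately have "hw_vector a b \<in> U" by (simp flip: mult.assoc)
      with nU show False ..
    qed
    define P where "P = {x \<in> Tens g (a + b). \<forall>u\<in>U. std_inner g (a + b) u x = 0}"
    have "lsub P"
      by (rule lsubI)
        (auto simp: P_def std_inner_def lsub_zero[OF lsub_Tens] lsub_add[OF lsub_Tens] lsub_mult[OF lsub_Tens]
          sum.distrib distrib_left mult.left_commute simp flip: sum_distrib_left)
    moreover have "invariant g (a + b) P"
      using act_Tens Spg_transpose U(2) by (auto simp: invariant_def P_def std_inner_act)
    moreover have "hw_vector a b \<in> P"
    proof -
      \<comment> \<open>\<open>hw_vector\<close> is supported on words of the top weight, and there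
        \<open>S\<close> is a multiple of \<open>S (hw_word a b)\<close>, which is 0.\<close>
      have "S w * hw_vector a b w = 0" if "S \<in> U" for S w
        using weight_space[of S g a b w] zero[OF that] UN b that hw_vector_weight[of a b w g]
          hw_vector_word(1,2)[of a b w]
        by (cases "hw_vector a b w = 0") (force simp: is_hw_word_def words_def split: if_splits)+
      then have "std_inner g (a + b) S (hw_vector a b) = 0" if "S \<in> U" for S
        unfolding std_inner_def using that by (intro sum.neutral ballI)
      moreover have "hw_vector a b \<in> Tens g (a + b)" using hw_vector_alt_tensors[OF b] by (simp add: alt_tensors_def)
      ultimately show ?thesis by (simp add: P_def)
    qed
    ultimately have "hw_module g a b \<subseteq> P" by (rule hw_module_minimal)
    \<comment> \<open>\<open>T\<close> lies in \<open>U\<close> and, through the generated module,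
      in its orthogonal complement; the form is positive definite over the rationals.\<close>
    then have "std_inner g (a + b) T T = 0" using U(3,4) by (auto simp: P_def)
    then have "\<forall>w\<in>words g (a + b). T w * T w = 0"
      unfolding std_inner_def by (subst (asm) sum_nonneg_eq_0_iff) auto
    then have "T w = 0" using UT U(4) by (cases "w \<in> words g (a + b)") (auto simp: Tens_iff)
    with U(5) show False by simp
  qed
  then have "hw_module g a b \<subseteq> U" using U by (intro hw_module_minimal)
  with U(3) show ?thesis by auto
qed

text \<open>Among the letters below \<open>j\<close>, the first \<open>a\<close> slots hold at most
  \<open>a\<close>, and the last \<open>b\<close> slots, being distinct, hold at most
  \<open>min j b\<close>; this is the partial sum of the top weight. Parity holds because each
  letter of the dual half lowers the total weight by 2.\<close>

lemma weight_bound: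
  assumes T: "T \<in> alt_tensors g a b" "T w \<noteq> 0" and b: "0 < b" "b \<le> g"
  shows "wle g (weight g w) (hw_weight a b)"
proof -
  have w: "w \<in> words g (a + b)" using T by (auto simp: alt_tensors_def Tens_iff)
  then have len: "length w = a + b" by (simp add: words_def)
  have dist: "distinct (drop a w)"
    using T len by (intro alt_nonzero_distinct) (auto simp: alt_tensors_def)
  have "(\<Sum>i<j. weight g w i) \<le> (\<Sum>i<j. hw_weight a b i)" if "j \<le> g" for j
  proof (cases "j = 0")
    case False
    have "(\<Sum>i<j. weight g w i) \<le> (\<Sum>i<j. int (count_list w i))"
      by (intro sum_mono) (simp add: weight_def)
    also have "\<dots> = (\<Sum>i<j. int (count_list (take a w) i)) + (\<Sum>i<j. int (count_list (drop a w) i))"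
      unfolding sum.distrib[symmetric]
      by (intro sum.cong refl) (metis append_take_drop_id count_list_append of_nat_add)
    also have "(\<Sum>i<j. int (count_list (take a w) i)) \<le> int a"
    proof -
      have "(\<Sum>i<j. count_list (take a w) i) \<le> (\<Sum>i\<in>{..<j} \<union> set w. count_list (take a w) i)"
        by (intro sum_mono2) auto
      also have "\<dots> = length (take a w)"
        by (intro sum_count_set) (auto dest: in_set_takeD)
      finally show ?thesis using len by (simp flip: of_nat_sum)
    qed
    also have "(\<Sum>i<j. int (count_list (drop a w) i)) \<le> int (min j b)"
    proof -
      have "(\<Sum>i<j. count_list (drop a w) i) \<le> (\<Sum>i\<in>{..<j} \<union> set w. count_list (drop a w) i)"
        by (intro sum_mono2) auto
      also have "\<dots> = length (drop a w)"
        by (intro sum_count_set) (auto dest: in_set_dropD)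
      finally have "(\<Sum>i<j. count_list (drop a w) i) \<le> b" using len by simp
      moreover have "(\<Sum>i<j. count_list (drop a w) i) \<le> (\<Sum>i<j. 1)"
        using dist by (intro sum_mono) (simp add: count_list_distinct)
      ultimately show ?thesis by (simp flip: of_nat_sum)
    qed
    finally show ?thesis using False b by (simp add: sum_hw_weight)
  qed simp
  moreover have "even (\<Sum>i<g. hw_weight a b i - weight g w i)"
    using sum_weight[OF w] sum_hw_weight[OF b(1), of a g] b by (auto simp: sum_subtractf)
  ultimately show ?thesis by (simp add: wle_def sum_subtractf)
qed

section \<open>Transport of an irreducible module through \<open>cmap\<close>\<close>

lemma cmap_add: "cmap g k (\<lambda>w. x w + y w) = (\<lambda>w. cmap g k x w + cmap g k y w)"
  and cmap_diff: "cmap g k (\<lambda>w. x w - y w) = (\<lambda>w. cmap g k x w - cmap g k y w)"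
  and cmap_mult: "cmap g k (\<lambda>w. c * x w) = (\<lambda>w. c * cmap g k x w)"
  and cmap_zero: "cmap g k (\<lambda>w. 0) = (\<lambda>w. 0)"
  by (auto simp: cmap_def distrib_left right_diff_distrib sum.distrib sum_subtractf sum_distrib_left
      mult.left_commute)

lemma cmap_sum: "cmap g k (\<lambda>w. \<Sum>i\<in>I. f i w) = (\<lambda>w. \<Sum>i\<in>I. cmap g k (f i) w)"
  by (induction I rule: infinite_finite_induct) (auto simp: cmap_add cmap_zero)

lemma br_map_add: "br_map (\<lambda>w. x w + y w) = (\<lambda>w. br_map x w + br_map y w)"
  and br_map_diff: "br_map (\<lambda>w. x w - y w) = (\<lambda>w. br_map x w - br_map y w)"
  and br_map_mult: "br_map (\<lambda>w. c * x w) = (\<lambda>w. c * br_map x w)"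
  and br_map_zero: "br_map (\<lambda>w. 0) = (\<lambda>w. 0)"
  by (auto simp: br_map_def algebra_simps)

lemma br_map_sum: "br_map (\<lambda>w. \<Sum>i\<in>I. f i w) = (\<lambda>w. \<Sum>i\<in>I. br_map (f i) w)"
  by (induction I rule: infinite_finite_induct) (auto simp: br_map_add br_map_zero)

lemma lsub_hk: "lsub (hk g k)"
  by (rule lsubI)
    (auto simp: hk_def br_map_add br_map_mult br_map_zero lsub_zero[OF lsub_HL] lsub_add[OF lsub_HL]
       lsub_mult[OF lsub_HL])

lemma invariant_zero: "invariant g m {\<lambda>w. 0}"
  by (simp add: invariant_def)

text \<open>\<open>rel T m\<close> says that the contraction of \<open>T\<close> and
  \<open>\<theta> m\<close> agree as cyclic words. It behaves like the graph of a linear map from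
  \<open>W\<close> to the irreducible module \<open>M\<close> with kernel \<open>KerC g k\<close>,
  so irreducibility and weights pass from \<open>M\<close> to \<open>W\<close> modulo
  \<open>KerC g k\<close>. The element \<open>\<xi>\<close> shows that the quotient is
  nonzero.\<close>

lemma contains_irrepI:
  assumes b: "0 < b" "b \<le> g" and k: "k = a + b"
    and th_add: "\<And>x y. \<theta> (\<lambda>w. x w + y w) = (\<lambda>w. \<theta> x w + \<theta> y w)"
    and th_mult: "\<And>c x. \<theta> (\<lambda>w. c * x w) = (\<lambda>w. c * \<theta> x w)"
    and th_act: "\<And>A m. A \<in> Spg g \<Longrightarrow> m \<in> Tens g k \<Longrightarrow> \<theta> (act g k A m) = act g k A (\<theta> m)"
    and th_bicyc_sum: "\<And>m u v. m \<in> alt_tensors g a b \<Longrightarrow> u \<noteq> [] \<Longrightarrow> v \<noteq> [] \<Longrightarrow>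
      length u + length v = k \<Longrightarrow> bicyc_sum (\<theta> m) u v = 0"
    and nz: "cyc_sum (\<theta> (hw_vector a b)) w0 \<noteq> 0"
    and \<xi>: "\<xi> \<in> hk g k" "cmap g k \<xi> = \<theta> (hw_vector a b)"
      "\<And>w i. \<xi> w \<noteq> 0 \<Longrightarrow> i < g \<Longrightarrow> weight g w i = hw_weight a b i"
  shows "KerC g k \<subset> KerD g k \<and> contains_irrep g (k + 2) (KerD g k) (KerC g k) (hw_weight a b)"
proof -
  have k0: "k > 0" using b k by simp
  note Rel_iff = Rel_iff[OF k0, of _ g]
  define M where "M = hw_module g a b"
  define rel where "rel T m \<longleftrightarrow> (\<lambda>w. cmap g k T w - \<theta> m w) \<in> Rel g k" for T m
  have th0: "\<theta> (\<lambda>w. 0) = (\<lambda>w. 0)" using th_mult[of 0 "\<lambda>w. 0"] by simp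
  have rel0: "rel (\<lambda>w. 0) (\<lambda>w. 0)"
    by (simp add: rel_def cmap_zero th0 lsub_zero[OF lsub_Rel])
  have rel_add: "rel (\<lambda>w. T w + T' w) (\<lambda>w. m w + m' w)" if "rel T m" "rel T' m'" for T T' m m'
    using lsub_add[OF lsub_Rel that[unfolded rel_def]]
    by (simp add: rel_def cmap_add th_add algebra_simps)
  have rel_mult: "rel (\<lambda>w. c * T w) (\<lambda>w. c * m w)" if "rel T m" for c T m
    using lsub_mult[OF lsub_Rel that[unfolded rel_def], of c]
    by (simp add: rel_def cmap_mult th_mult algebra_simps)
  have rel_diff: "rel (\<lambda>w. T w - T' w) (\<lambda>w. m w - m' w)" if "rel T m" "rel T' m'" for T T' m m'
    using rel_add[OF that(1) rel_mult[OF that(2), of "-1"]] by simp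
  have MN: "M \<subseteq> alt_tensors g a b" unfolding M_def by (rule hw_module_alt_tensors[OF b])
  then have MT: "M \<subseteq> Tens g k" by (auto simp: alt_tensors_def k)
  have rel_act: "rel (act g (k + 2) A T) (act g k A m)" if "A \<in> Spg g" "rel T m" "m \<in> M" for A T m
    using act_Rel[OF that(1) k0 that(2)[unfolded rel_def]] that MT
    by (simp add: rel_def cmap_act th_act act_diff subset_iff del: add_2_eq_Suc')
  have lM: "lsub M" and iM: "invariant g k M"
    by (simp_all add: M_def lsub_hw_module invariant_hw_module k)
  \<comment> \<open>The elements of \<open>M\<close> related to an invariant subspace
    \<open>U\<close> form a submodule, which is all of \<open>M\<close> as soon as it is
    nonzero.\<close>
  have all: "M = {m \<in> M. \<exists>T\<in>U. rel T m}"
    if U: "lsub U" "invariant g (k + 2) U" and m: "m \<in> M" "T \<in> U" "rel T m" "m w \<noteq> 0" for U m T w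
  proof -
    let ?MU = "{m \<in> M. \<exists>T\<in>U. rel T m}"
    have "lsub ?MU"
    proof (rule lsubI)
      show "(\<lambda>w. 0) \<in> ?MU" using lsub_zero[OF lM] lsub_zero[OF U(1)] rel0 by blast
    next
      fix x y assume "x \<in> ?MU" "y \<in> ?MU"
      then obtain T T' where "x \<in> M" "y \<in> M" "T \<in> U" "T' \<in> U" "rel T x" "rel T' y" by blast
      then show "(\<lambda>w. x w + y w) \<in> ?MU"
        using lsub_add[OF lM, of x y] lsub_add[OF U(1), of T T'] rel_add by blast
    next
      fix c x assume "x \<in> ?MU"
      then obtain T where "x \<in> M" "T \<in> U" "rel T x" by blast
      then show "(\<lambda>w. c * x w) \<in> ?MU"
        using lsub_mult[OF lM, of x c] lsub_mult[OF U(1), of T c] rel_mult by blast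
    qed
    moreover have "invariant g k ?MU"
      using U(2) iM rel_act unfolding invariant_def by blast
    moreover have "m \<in> ?MU" using m by blast
    ultimately show ?thesis
      using hw_module_irreducible[OF b, where a = a and U = ?MU and T = m and w = w] m(4) by (auto simp: M_def k)
  qed
  have hw_nrel: "\<not> rel (\<lambda>w. 0) (hw_vector a b)"
  proof
    assume "rel (\<lambda>w. 0) (hw_vector a b)"
    then have "cyc_sum (\<lambda>w. - \<theta> (hw_vector a b) w) w0 = 0"
      by (simp add: rel_def cmap_zero Rel_iff)
    with nz show False by (simp add: cyc_sum_def sum_negf)
  qed
  \<comment> \<open>Apply \<open>all\<close> to the zero subspace: a nonzero \<open>m\<close> would
    make the highest weight vector related to 0, against \<open>nz\<close>.\<close>
  have inj: "m = (\<lambda>w. 0)" if m: "m \<in> M" "rel (\<lambda>w. 0) m" for m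
  proof (rule ccontr)
    assume "m \<noteq> (\<lambda>w. 0)"
    then obtain w where "m w \<noteq> 0" by auto
    moreover have "lsub {\<lambda>w. 0}" by (simp add: lsub_def)
    ultimately have "M = {m \<in> M. \<exists>T\<in>{\<lambda>w. 0}. rel T m}"
      using m by (intro all[OF _ invariant_zero]) auto
    then have "rel (\<lambda>w. 0) (hw_vector a b)" using hw_vector_hw_module[of a b g] by (auto simp: M_def)
    with hw_nrel show False ..
  qed
  define W where "W = {T \<in> hk g k. \<exists>m\<in>M. rel T m}"
  have lW: "lsub W"
  proof (rule lsubI)
    show "(\<lambda>w. 0) \<in> W" using lsub_zero[OF lM] lsub_zero[OF lsub_hk] rel0 by (auto simp: W_def)
  next
    fix x y assume "x \<in> W" "y \<in> W"
    then show "(\<lambda>w. x w + y w) \<in> W"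
      using lsub_add[OF lM] lsub_add[OF lsub_hk] rel_add unfolding W_def by blast
  next
    fix c x assume "x \<in> W"
    then show "(\<lambda>w. c * x w) \<in> W"
      using lsub_mult[OF lM] lsub_mult[OF lsub_hk] rel_mult unfolding W_def by blast
  qed
  have iW: "invariant g (k + 2) W"
    using act_hk iM rel_act unfolding invariant_def W_def by blast
  have KerC_iff: "T \<in> KerC g k \<longleftrightarrow> T \<in> hk g k \<and> rel T (\<lambda>w. 0)" for T
    by (simp add: KerC_def rel_def th0)
  have KW: "KerC g k \<subseteq> W"
    using lsub_zero[OF lM] by (auto simp: W_def KerC_iff)
  have WD: "W \<subseteq> KerD g k"
  proof
    fix T assume "T \<in> W"
    then obtain m where T: "T \<in> hk g k" and m: "m \<in> M" "rel T m" by (auto simp: W_def)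
    \<comment> \<open>The contraction is \<open>\<theta> m\<close>, killed by hypothesis, plus a
      cyclic relation, killed by \<open>bicyc_sum_eq_0\<close>.\<close>
    have "bicyc_sum (cmap g k T) u v = 0" if uv: "u \<noteq> []" "v \<noteq> []" "length u + length v = k" for u v
    proof -
      have "bicyc_sum (\<lambda>w. cmap g k T w - \<theta> m w) u v = 0"
        using m(2) uv by (intro bicyc_sum_eq_0) (auto simp: rel_def Rel_iff)
      moreover have "bicyc_sum (\<theta> m) u v = 0"
        using m(1) MN uv by (intro th_bicyc_sum) auto
      ultimately show ?thesis by (simp add: bicyc_sum_diff)
    qed
    with T show "T \<in> KerD g k" by (rule KerDI)
  qed
  have \<xi>W: "\<xi> \<in> W"
  proof -
    have "rel \<xi> (hw_vector a b)" using \<xi>(2) by (simp add: rel_def lsub_zero[OF lsub_Rel])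
    then show ?thesis using \<xi>(1) hw_vector_hw_module[of a b g] unfolding W_def M_def by blast
  qed
  have \<xi>K: "\<xi> \<notin> KerC g k"
    using \<xi>(2) nz by (auto simp: KerC_def Rel_iff)
  have KW': "KerC g k \<subset> W" using KW \<xi>W \<xi>K by blast
  \<comment> \<open>If \<open>U\<close> meets a nonzero \<open>m\<close>, it meets all of
    \<open>M\<close>, and two tensors related to the same \<open>m\<close> differ by an element of
    \<open>KerC g k\<close>. Otherwise every element of \<open>U\<close> is related only to
    0.\<close>
  have irr: "U = KerC g k \<or> U = W" if U: "subrep g (k + 2) (KerC g k) U" "U \<subseteq> W" for U
  proof (cases "\<exists>m\<in>M. \<exists>T\<in>U. rel T m \<and> m \<noteq> (\<lambda>w. 0)")
    case True
    then obtain m T where mT: "m \<in> M" "T \<in> U" "rel T m" "m \<noteq> (\<lambda>w. 0)" by blast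
    then obtain w where "m w \<noteq> 0" by auto
    then have M: "M = {m \<in> M. \<exists>T\<in>U. rel T m}"
      using U mT by (intro all[of U m T w]) (auto simp: subrep_def)
    have "W \<subseteq> U"
    proof
      fix T assume "T \<in> W"
      then obtain m where T: "T \<in> hk g k" "m \<in> M" "rel T m" by (auto simp: W_def)
      with M obtain T' where T': "T' \<in> U" "rel T' m" by blast
      have "T' \<in> hk g k" using T' U by (auto simp: W_def)
      with T have "(\<lambda>w. T w - T' w) \<in> hk g k" by (intro lsub_diff[OF lsub_hk])
      then have "(\<lambda>w. T w - T' w) \<in> KerC g k"
        using rel_diff[OF T(3) T'(2)] by (simp add: KerC_iff)
      then have "(\<lambda>w. T w - T' w) \<in> U" "lsub U" using U by (auto simp: subrep_def)
      from lsub_add[OF this(2,1) T'(1)] show "T \<in> U" by simp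
    qed
    with U show ?thesis by blast
  next
    case False
    have "U \<subseteq> KerC g k"
    proof
      fix T assume T: "T \<in> U"
      then obtain m where "T \<in> hk g k" "m \<in> M" "rel T m" using U by (auto simp: W_def)
      with False T show "T \<in> KerC g k" by (auto simp: KerC_iff)
    qed
    with U show ?thesis by (auto simp: subrep_def)
  qed
  have hw: "has_hw g (k + 2) (KerC g k) W (hw_weight a b)"
  proof -
    have KC0: "(\<lambda>w. 0) \<in> KerC g k"
      using rel0 lsub_zero[OF lsub_hk] by (simp add: KerC_iff)
    have "weight_vec g (k + 2) (KerC g k) W (hw_weight a b) \<xi>"
    proof -
      have "act g (k + 2) (tor g t) \<xi> w - (\<Prod>i<g. t i powi hw_weight a b i) * \<xi> w = 0"
        if t: "\<forall>i<g. t i \<noteq> 0" for t :: "nat \<Rightarrow> rat" and w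
        using act_tor_Tens[OF hk_Tens[OF \<xi>(1)] t, of w] \<xi>(3)[of w]
        by (cases "\<xi> w = 0") simp_all
      with KC0 show ?thesis using \<xi>W \<xi>K by (simp add: weight_vec_def)
    qed
    moreover have "wle g mu (hw_weight a b)" if T: "weight_vec g (k + 2) (KerC g k) W mu T" for mu T
    proof -
      from T have "T \<in> W" "T \<notin> KerC g k" by (auto simp: weight_vec_def)
      then obtain m where m: "T \<in> hk g k" "m \<in> M" "rel T m" by (auto simp: W_def)
      have mT: "m \<in> Tens g k" using m MT by auto
      have "m \<noteq> (\<lambda>w. 0)" using m \<open>T \<notin> KerC g k\<close> by (auto simp: KerC_iff)
      then obtain w where w: "m w \<noteq> 0" by auto
      \<comment> \<open>The eigenvector equation holds only modulo \<open>KerC g k\<close>. Passing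
        to \<open>m\<close> makes it exact by \<open>inj\<close>, and comparing coefficients at
        \<open>w\<close> identifies \<open>mu\<close>.\<close>
      have eq: "(\<Prod>i<g. t i powi weight g w i) = (\<Prod>i<g. t i powi mu i)" if t: "\<forall>i<g. t i \<noteq> 0" for t :: "nat \<Rightarrow> rat"
      proof -
        let ?c = "\<Prod>i<g. t i powi mu i"
        let ?T = "\<lambda>w. act g (k + 2) (tor g t) T w - ?c * T w"
        let ?m = "\<lambda>w. act g k (tor g t) m w - ?c * m w"
        note tS = tor_Spg[OF t]
        have "?T \<in> KerC g k" using T t by (auto simp: weight_vec_def)
        then have 1: "rel ?T (\<lambda>w. 0)" by (simp add: KerC_iff)
        have 2: "rel ?T ?m"
          using rel_diff[OF rel_act[OF tS m(3,2)] rel_mult[OF m(3), of ?c]] .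
        from rel_diff[OF 2 1] have "rel (\<lambda>w. 0) ?m" by simp
        moreover have "?m \<in> M"
          using iM tS m(2) by (intro lsub_diff[OF lM] lsub_mult[OF lM]) (auto simp: invariant_def)
        ultimately have "?m = (\<lambda>w. 0)" by (intro inj)
        from fun_cong[OF this, of w] show ?thesis
          using w by (simp add: act_tor_Tens[OF mT t])
      qed
      have "mu i = weight g w i" if i: "i < g" for i
      proof -
        have *: "(\<Prod>j<g. (if j = i then 2 else 1) powi f j) = (2::rat) powi f i" for f :: "nat \<Rightarrow> int"
        proof -
          have "(\<Prod>j<g. (if j = i then 2 else 1) powi f j) = (\<Prod>j<g. if j = i then (2::rat) powi f i else 1)"
            by (intro prod.cong) auto
          then show ?thesis using i by simp
        qed
        show ?thesis using eq[of "\<lambda>j. if j = i then 2 else 1"] by (simp add: * two_powi_inject)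
      qed
      moreover have "wle g (weight g w) (hw_weight a b)"
        using m MN w b by (intro weight_bound) auto
      ultimately show ?thesis by (simp add: wle_def)
    qed
    ultimately show ?thesis by (auto simp: has_hw_def)
  qed
  have "subrep g (k + 2) (KerC g k) W"
    using lW iW KW by (simp add: subrep_def)
  with WD KW' irr hw show ?thesis
    unfolding contains_irrep_def irred_quot_def by blast
qed

section \<open>Caterpillar trees\<close>

text \<open>Homogeneity for the multigrading of the tensor algebra by multisets of letters.\<close>

definition content :: "nat multiset \<Rightarrow> tensor \<Rightarrow> bool" where
  "content A T \<longleftrightarrow> (\<forall>w. T w \<noteq> 0 \<longrightarrow> mset w = A)"

lemma content_vt: "content {#x#} (vt (uvec x))"
  by (auto simp: content_def vt_def uvec_def split: list.splits if_splits)

lemma content_tprod: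
  assumes "content A x" "content B y"
  shows "content (A + B) (tprod p x y)"
  unfolding content_def
proof (intro allI impI)
  fix w assume "tprod p x y w \<noteq> 0"
  then have "mset (take p w) = A" "mset (drop p w) = B"
    using assms by (auto simp: content_def tprod_def split: if_splits)
  then show "mset w = A + B" by (metis append_take_drop_id mset_append)
qed

lemma content_tbr: "content A x \<Longrightarrow> content B y \<Longrightarrow> content (A + B) (tbr p q x y)"
  using content_tprod[of A x B y p] content_tprod[of B y A x q]
  unfolding content_def tbr_def by (metis add.commute diff_self)

lemma content_lnb: "l \<noteq> [] \<Longrightarrow> content (mset l) (lnb (map uvec l))"
proof (induction l rule: rev_nonempty_induct)
  case (single x)
  then show ?case using content_vt[of x] by simp
next
  case (snoc x xs)
  then show ?case
    using content_tbr[OF snoc.IH content_vt[of x], of "length xs" 1] by (simp add: lnb_snoc)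
qed

lemma uvec_apply: "uvec x i = (if i = x then 1 else 0)"
  by (simp add: uvec_def)

text \<open>In the expansion of \<open>[L, y]\<close> the subtracted term begins with
  \<open>y\<close>, which differs from \<open>a\<close>; so at every stage the only word starting
  with \<open>a\<close> is the one extended on the right.\<close>

lemma lnb_uvec_first:
  assumes "a \<notin> set xs" "a < 2 * g" "set xs \<subseteq> {..<2*g}"
  shows "lnb (map uvec (a # xs)) (a # w) = single xs w"
  using assms
proof (induction xs arbitrary: w rule: rev_induct)
  case Nil
  then show ?case by (cases w) (auto simp: vt_def uvec_apply single_def)
next
  case S: (snoc y xs)
  let ?L = "lnb (map uvec (a # xs))"
  have "set (map uvec (a # xs)) \<subseteq> vecs g"
    using S.prems by (auto intro!: uvec_vecs)
  then have L: "?L \<in> Tens g (length (map uvec (a # xs)))"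
    by (intro lnb_Tens) auto
  have "lnb (map uvec (a # xs @ [y])) (a # w) = ?L (butlast (a # w)) * uvec y (last (a # w))"
    using tbr1_Cons[OF L, of "uvec y" a w] lnb_snoc[of "map uvec (a # xs)" "uvec y"] S.prems
    by (simp add: uvec_apply)
  also have "\<dots> = single (xs @ [y]) w"
  proof (cases w rule: rev_cases)
    case Nil
    then show ?thesis using L by (auto simp: Tens_def single_def)
  next
    case (snoc w' z)
    then have eq: "butlast (a # w) = a # w'" "last (a # w) = z"
      by (simp_all add: butlast_append)
    have IH: "?L (a # w') = single xs w'" using S.prems by (intro S.IH) auto
    show ?thesis
      unfolding eq IH using snoc by (auto simp: single_def uvec_apply)
  qed
  finally show ?case by simp
qed

definition left_arm :: "nat \<Rightarrow> nat list \<Rightarrow> tensor" where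
  "left_arm k x = lnb (map uvec (k # x))"

text \<open>The legs appear reversed because the tree is read from its other end leaf.\<close>

definition right_arm :: "nat \<Rightarrow> nat \<Rightarrow> nat list \<Rightarrow> tensor" where
  "right_arm g k x = lnb (map uvec ((k + g) # rev x))"

text \<open>The expansion of the caterpillar tree with end leaves \<open>k\<close> and \<open>k + g\<close> (a symplectic pair)
  and legs \<open>x\<close>: one summand for each leaf, paired with the bracketing of the tree rooted there.\<close>
definition caterpillar :: "nat \<Rightarrow> nat \<Rightarrow> nat list \<Rightarrow> tensor" where
  "caterpillar g k x = (\<lambda>w. ((-1) ^ Suc k * tprod 1 (vt (uvec (k + g))) (left_arm k x) w
      - tprod 1 (vt (uvec k)) (right_arm g k x) w)
    + (\<Sum>i<k. (-1) ^ Suc i * tprod 1 (vt (uvec (x ! i)))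
        (tbr (i + 1) (k - i) (left_arm k (take i x)) (right_arm g k (drop (i + 1) x))) w))"

lemma br_map_tprod:
  assumes "u \<in> Tens g n"
  shows "br_map (tprod 1 (vt X) u) = tbr 1 n (vt X) u"
proof
  fix w
  show "br_map (tprod 1 (vt X) u) w = tbr 1 n (vt X) u w"
  proof (cases w rule: rev_cases)
    case Nil
    then show ?thesis using assms by (auto simp: br_map_def tbr_def tprod_def vt_def)
  next
    case (snoc w' z)
    then show ?thesis
      using tprod_vt_snoc[OF assms, of X w' z] by (simp add: br_map_def tbr_def)
  qed
qed

context
  fixes g k :: nat and x :: "nat list"
  assumes kg: "k < g" and x: "length x = k" "set x \<subseteq> {..<k}"
begin

lemma leg_less: "i < k \<Longrightarrow> x ! i < k"
proof -
  assume "i < k"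
  then have "x ! i \<in> set x" using x(1) by simp
  then show "x ! i < k" using x(2) by auto
qed

lemma left_arm_Lie: "left_arm k (take i x) \<in> Lie g (min k i + 1)"
  and right_arm_Lie: "right_arm g k (drop i x) \<in> Lie g (k - i + 1)"
proof -
  have "set (map uvec (k # take i x)) \<subseteq> vecs g" "set (map uvec ((k + g) # rev (drop i x))) \<subseteq> vecs g"
    using kg x by (auto intro!: uvec_vecs dest!: in_set_takeD in_set_dropD)
  from this[THEN lnb_Lie] show "left_arm k (take i x) \<in> Lie g (min k i + 1)"
    "right_arm g k (drop i x) \<in> Lie g (k - i + 1)"
    using x by (simp_all add: left_arm_def right_arm_def min.commute)
qed

lemma left_arm_Lie': "left_arm k x \<in> Lie g (k + 1)" and right_arm_Lie': "right_arm g k x \<in> Lie g (k + 1)"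
  using left_arm_Lie[of k] right_arm_Lie[of 0] x by simp_all

lemma arms_Lie:
  assumes "i < k"
  shows "tbr (i + 1) (k - i) (left_arm k (take i x)) (right_arm g k (drop (i + 1) x)) \<in> Lie g (k + 1)"
  using Lie_tbr[of "right_arm g k (drop (i + 1) x)" g "k - i" "left_arm k (take i x)" "i + 1"]
    left_arm_Lie[of i] right_arm_Lie[of "i + 1"] assms by (simp add: min_def Suc_diff_Suc)

lemma content_caterpillar: "content (mset x + {#k, k + g#}) (caterpillar g k x)"
proof -
  have "content (mset x + {#k, k + g#}) (tprod 1 (vt (uvec (k + g))) (left_arm k x))"
    using content_tprod[OF content_vt content_lnb[of "k # x"], of "k + g" 1]
    by (simp add: left_arm_def add_mset_commute)
  moreover have "content (mset x + {#k, k + g#}) (tprod 1 (vt (uvec k)) (right_arm g k x))"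
    using content_tprod[OF content_vt content_lnb[of "(k + g) # rev x"], of k 1]
    by (simp add: right_arm_def add_mset_commute)
  moreover have "content (mset x + {#k, k + g#}) (tprod 1 (vt (uvec (x ! i)))
        (tbr (i + 1) (k - i) (left_arm k (take i x)) (right_arm g k (drop (i + 1) x))))" if "i < k" for i
  proof -
    have "mset x = mset (take i x) + add_mset (x ! i) (mset (drop (i + 1) x))"
      using that x id_take_nth_drop[of i x] by (metis Suc_eq_plus1 mset.simps(2) mset_append)
    then show ?thesis
      using content_tprod[OF content_vt content_tbr[OF content_lnb[of "k # take i x"]
          content_lnb[of "(k + g) # rev (drop (i + 1) x)"]], of "x ! i" 1 "i + 1" "k - i"]
      by (simp add: right_arm_def left_arm_def add_mset_commute)
  qed
  ultimately have z: "tprod 1 (vt (uvec (k + g))) (left_arm k x) w = 0" "tprod 1 (vt (uvec k)) (right_arm g k x) w = 0"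
    "i < k \<Longrightarrow> tprod 1 (vt (uvec (x ! i)))
        (tbr (i + 1) (k - i) (left_arm k (take i x)) (right_arm g k (drop (i + 1) x))) w = 0"
    if "mset w \<noteq> mset x + {#k, k + g#}" for w i
    using that unfolding content_def by blast+
  have "caterpillar g k x w = 0" if "mset w \<noteq> mset x + {#k, k + g#}" for w
    unfolding caterpillar_def z(1,2)[OF that] by (simp add: z(3)[OF that] del: One_nat_def)
  then show ?thesis unfolding content_def by blast
qed

lemma caterpillar_HL: "caterpillar g k x \<in> HL g (k + 1)"
proof -
  have "tprod 1 (vt (uvec y)) u \<in> HL g (k + 1)" if "y < 2 * g" "u \<in> Lie g (k + 1)" for y u
    unfolding HL_def using that uvec_vecs by (intro lspan_base) blast
  moreover have "x ! i < 2 * g" if "i < k" for i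
    using leg_less[OF that] kg by simp
  ultimately show ?thesis
    unfolding caterpillar_def using kg left_arm_Lie' right_arm_Lie' arms_Lie
    by (intro lsub_add[OF lsub_HL] lsub_diff[OF lsub_HL] lsub_sum[OF lsub_HL] lsub_mult[OF lsub_HL]) auto
qed

text \<open>Rooting the tree at the inner edges gives the brackets \<open>E i\<close>; by the Jacobi identity the legs
  contribute the differences of consecutive signed \<open>E i\<close>.\<close>
lemma br_map_caterpillar: "br_map (caterpillar g k x) = (\<lambda>w. 0)"
proof
  fix w
  define E where "E i = tbr (i + 1) (k - i + 1) (left_arm k (take i x)) (right_arm g k (drop i x))" for i
  define D where "D i = tbr (i + 1) (k - i) (left_arm k (take i x)) (right_arm g k (drop (i + 1) x))" for i
  \<comment> \<open>The leg \<open>x ! i\<close> can be attached to either arm; the Jacobi identity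
    relates the resulting brackets at the two neighbouring edges.\<close>
  have leg: "tbr 1 (k + 1) (vt (uvec (x ! i))) (D i) w = - (E i w + E (Suc i) w)" if i: "i < k" for i
  proof -
    have P: "left_arm k (take (Suc i) x) = tbr (i + 1) 1 (left_arm k (take i x)) (vt (uvec (x ! i)))"
      using i x lnb_snoc[of "map uvec (k # take i x)" "uvec (x ! i)"]
      by (simp add: left_arm_def take_Suc_conv_app_nth)
    have Q: "right_arm g k (drop i x) = tbr (k - i) 1 (right_arm g k (drop (i + 1) x)) (vt (uvec (x ! i)))"
      using i x lnb_snoc[of "map uvec ((k + g) # rev (drop (i + 1) x))" "uvec (x ! i)"]
        Cons_nth_drop_Suc[of i x]
      by (simp add: right_arm_def Suc_diff_Suc flip: Cons_nth_drop_Suc)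
    have "E i w = tbr (k + 1) 1 (D i) (vt (uvec (x ! i))) w - E (Suc i) w"
      using tbr_jacobi[of "i + 1" "k - i" 1 "left_arm k (take i x)" "right_arm g k (drop (i + 1) x)" "vt (uvec (x ! i))" w] i
      by (simp add: E_def D_def P Q Suc_diff_Suc)
    moreover have "tbr 1 (k + 1) (vt (uvec (x ! i))) (D i) w = - tbr (k + 1) 1 (D i) (vt (uvec (x ! i))) w"
      by (simp add: tbr_def)
    ultimately show ?thesis by simp
  qed
  have uT: "br_map (tprod 1 (vt X) u) = tbr 1 (k + 1) (vt X) u" if "u \<in> Lie g (k + 1)" for X u
    using that Lie_Tens[of "k + 1" g] by (intro br_map_tprod) auto
  have "br_map (caterpillar g k x) w = (-1) ^ Suc k * tbr 1 (k + 1) (vt (uvec (k + g))) (left_arm k x) w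
      - tbr 1 (k + 1) (vt (uvec k)) (right_arm g k x) w
      + (\<Sum>i<k. (-1) ^ Suc i * tbr 1 (k + 1) (vt (uvec (x ! i))) (D i) w)"
  proof -
    have "br_map (tprod 1 (vt (uvec (k + g))) (left_arm k x)) = tbr 1 (k + 1) (vt (uvec (k + g))) (left_arm k x)"
      and "br_map (tprod 1 (vt (uvec k)) (right_arm g k x)) = tbr 1 (k + 1) (vt (uvec k)) (right_arm g k x)"
      and "i < k \<Longrightarrow> br_map (tprod 1 (vt (uvec (x ! i))) (D i)) = tbr 1 (k + 1) (vt (uvec (x ! i))) (D i)" for i
      using uT[OF left_arm_Lie'] uT[OF right_arm_Lie'] uT[OF arms_Lie] unfolding D_def by blast+
    then show ?thesis
      unfolding caterpillar_def br_map_add br_map_diff br_map_mult br_map_sum D_def[symmetric] by simp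
  qed
  also have "(\<Sum>i<k. (-1) ^ Suc i * tbr 1 (k + 1) (vt (uvec (x ! i))) (D i) w)
     = (\<Sum>i<k. (-1) ^ i * E i w - (-1) ^ Suc i * E (Suc i) w)"
    by (intro sum.cong refl) (simp only: lessThan_iff leg, simp add: algebra_simps)
  \<comment> \<open>The alternating signs of the legs make the sum telescope; the two remaining end
    edges cancel against the summands rooted at the end leaves.\<close>
  also have "\<dots> = E 0 w - (-1) ^ k * E k w"
    using sum_lessThan_telescope'[of "\<lambda>i. (-1) ^ i * E i w" k] by simp
  also have "E 0 w = tbr 1 (k + 1) (vt (uvec k)) (right_arm g k x) w"
    by (simp add: E_def left_arm_def)
  also have "E k w = - tbr 1 (k + 1) (vt (uvec (k + g))) (left_arm k x) w"
    using x by (simp add: E_def right_arm_def tbr_def)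
  finally show "br_map (caterpillar g k x) w = 0" by simp
qed

lemma caterpillar_hk: "caterpillar g k x \<in> hk g k"
  using caterpillar_HL br_map_caterpillar by (simp add: hk_def)

text \<open>A nonzero contraction needs a root letter and a following letter forming a symplectic
  pair, and the only such pair is \<open>k\<close>, \<open>k + g\<close>. Rooted at
  \<open>k + g\<close> the left arm contributes only \<open>k # x\<close>, rooted at
  \<open>k\<close> the right arm only \<open>(k + g) # rev x\<close>; a leg finds no
  partner.\<close>

lemma cmap_caterpillar: "cmap g k (caterpillar g k x) = (\<lambda>w. (-1) ^ k * single x w - single (rev x) w)"
proof
  fix w
  have J: "(\<Sum>y<2*g. \<Sum>z<2*g. Jf g y z * tprod 1 (vt (uvec c)) u (y # z # w)) = (\<Sum>z<2*g. Jf g c z * u (z # w))"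
    if "c < 2 * g" for c u
  proof -
    have "(\<Sum>y<2*g. \<Sum>z<2*g. Jf g y z * tprod 1 (vt (uvec c)) u (y # z # w)) =
      (\<Sum>y<2*g. if y = c then \<Sum>z<2*g. Jf g c z * u (z # w) else 0)"
      by (intro sum.cong refl) (auto simp: uvec_def)
    then show ?thesis using that by simp
  qed
  have J1: "(\<Sum>z<2*g. Jf g (c + g) z * u (z # w)) = - u (c # w)" if "c < g" for c and u :: tensor
  proof -
    have "(\<Sum>z<2*g. Jf g (c + g) z * u (z # w)) = (\<Sum>z<2*g. if z = c then - u (c # w) else 0)"
      using that by (intro sum.cong refl) (auto simp: Jf_def)
    then show ?thesis using that by simp
  qed
  have J2: "(\<Sum>z<2*g. Jf g c z * u (z # w)) = u ((c + g) # w)" if "c < g" for c and u :: tensor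
  proof -
    have "(\<Sum>z<2*g. Jf g c z * u (z # w)) = (\<Sum>z<2*g. if z = c + g then u ((c + g) # w) else 0)"
      using that by (intro sum.cong refl) (auto simp: Jf_def)
    then show ?thesis using that by simp
  qed
  show "cmap g k (caterpillar g k x) w = (-1) ^ k * single x w - single (rev x) w"
  proof (cases "length w = k")
    case True
    have c1: "cmap g k (tprod 1 (vt (uvec c)) u) w = (\<Sum>z<2*g. Jf g c z * u (z # w))" if "c < 2 * g" for c u
      using J[OF that] True by (simp add: cmap_def)
    have 1: "cmap g k (tprod 1 (vt (uvec (k + g))) (left_arm k x)) w = - single x w"
    proof -
      have "k \<notin> set x" "set x \<subseteq> {..<2*g}" using x kg by auto
      then show ?thesis using kg lnb_uvec_first[of k x g w]
        by (simp add: c1 J1 left_arm_def del: One_nat_def)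
    qed
    have 2: "cmap g k (tprod 1 (vt (uvec k)) (right_arm g k x)) w = single (rev x) w"
    proof -
      have "k + g \<notin> set (rev x)" "set (rev x) \<subseteq> {..<2*g}" using x kg by auto
      then show ?thesis using kg lnb_uvec_first[of "k + g" "rev x" g w]
        by (simp add: c1 J2 right_arm_def del: One_nat_def)
    qed
    have 3: "cmap g k (tprod 1 (vt (uvec (x ! i))) (tbr (i + 1) (k - i) (left_arm k (take i x)) (right_arm g k (drop (i + 1) x)))) w = 0"
      if i: "i < k" for i
    proof -
      let ?u = "tbr (i + 1) (k - i) (left_arm k (take i x)) (right_arm g k (drop (i + 1) x))"
      have "content (mset (k # take i x) + mset ((k + g) # rev (drop (i + 1) x))) ?u"
        unfolding left_arm_def right_arm_def by (intro content_tbr content_lnb) simp_all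
      then have "?u ((x ! i + g) # w) = 0 \<or>
         set_mset (mset ((x ! i + g) # w)) = set_mset (mset (k # take i x) + mset ((k + g) # rev (drop (i + 1) x)))"
        unfolding content_def by metis
      moreover have "x ! i + g \<notin> set_mset (mset (k # take i x) + mset ((k + g) # rev (drop (i + 1) x)))"
        using leg_less[OF i] x(2) kg by (auto dest!: in_set_takeD in_set_dropD)
      ultimately have "?u ((x ! i + g) # w) = 0" by auto
      then show ?thesis using leg_less[OF i] kg by (simp add: c1 J2 del: One_nat_def)
    qed
    show ?thesis
      unfolding caterpillar_def cmap_add cmap_diff cmap_mult cmap_sum 1 2
      using 3 by (simp del: One_nat_def)
  qed (use x in \<open>auto simp: cmap_def single_def\<close>)
qed

end

definition caterpillar_sum :: "nat \<Rightarrow> nat \<Rightarrow> tensor \<Rightarrow> tensor" where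
  "caterpillar_sum g k y = (\<lambda>w. \<Sum>x\<in>{x. set x \<subseteq> {..<k} \<and> length x = k}. y x * caterpillar g k x w)"

lemma finite_kwords: "finite {x. set x \<subseteq> {..<k} \<and> length x = (k::nat)}"
  by (rule finite_lists_length_eq) simp

lemma caterpillar_sum_hk: "k < g \<Longrightarrow> caterpillar_sum g k y \<in> hk g k"
  unfolding caterpillar_sum_def by (intro lsub_sum[OF lsub_hk] lsub_mult[OF lsub_hk] caterpillar_hk) auto

lemma cmap_caterpillar_sum:
  assumes "k < g" and y: "\<And>w. y w \<noteq> 0 \<Longrightarrow> set w \<subseteq> {..<k} \<and> length w = k"
  shows "cmap g k (caterpillar_sum g k y) = (\<lambda>w. (-1) ^ k * y w - y (rev w))"
proof
  fix w
  let ?X = "{x. set x \<subseteq> {..<k} \<and> length x = k}"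
  have s: "(\<Sum>x\<in>?X. y x * single x w) = y w" for w
  proof -
    have "(\<Sum>x\<in>?X. y x * single x w) = (\<Sum>x\<in>?X. if x = w then y w else 0)"
      by (intro sum.cong) (auto simp: single_def)
    then show ?thesis using y[of w] finite_kwords[of k] by auto
  qed
  have "single (rev x) w = single x (rev w)" for x
    by (auto simp: single_def)
  then have "cmap g k (caterpillar_sum g k y) w = (\<Sum>x\<in>?X. y x * ((-1) ^ k * single x w - single x (rev w)))"
    using assms(1) by (simp add: caterpillar_sum_def cmap_sum cmap_mult cmap_caterpillar)
  also have "\<dots> = (-1) ^ k * (\<Sum>x\<in>?X. y x * single x w) - (\<Sum>x\<in>?X. y x * single x (rev w))"
    by (simp add: right_diff_distrib sum_subtractf sum_distrib_left mult_ac)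
  finally show "cmap g k (caterpillar_sum g k y) w = (-1) ^ k * y w - y (rev w)"
    by (simp only: s)
qed

text \<open>The end leaves \<open>k\<close> and \<open>k + g\<close> have opposite weights, so a
  tree has the weight of its legs.\<close>

lemma weight_caterpillar_sum:
  assumes "k < g" "caterpillar_sum g k y w \<noteq> 0" "i < g"
  obtains x where "y x \<noteq> 0" "weight g w i = weight g x i"
proof -
  from assms(2) obtain x where x: "set x \<subseteq> {..<k}" "length x = k" "y x * caterpillar g k x w \<noteq> 0"
    unfolding caterpillar_sum_def by (metis (mono_tags, lifting) mem_Collect_eq sum.neutral)
  then have "mset w = mset x + {#k, k + g#}"
    using content_caterpillar[OF assms(1) x(2,1)] unfolding content_def by auto
  then have "count_list w j = count_list x j + (if j = k then 1 else 0) + (if j = k + g then 1 else 0)" for j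
    by (simp flip: count_mset_0_iff add: count_mset[symmetric])
  then have "weight g w i = weight g x i"
    using assms by (auto simp: weight_def)
  with x show ?thesis by (intro that[of x]) auto
qed

text \<open>Trees with legs \<open>\<theta> m\<close> realise \<open>(-1)^k \<theta> m\<close> minus
  its reversal. Unshuffling commutes with reversal, so it suffices that \<open>\<theta> m\<close>
  itself is killed. The condition on multisets keeps the legs among the letters below
  \<open>k\<close> and preserves weights.\<close>

lemma contains_irrep_caterpillar_sum:
  assumes b: "0 < b" and k: "k = a + b" "k < g"
    and th_add: "\<And>x y. \<theta> (\<lambda>w. x w + y w) = (\<lambda>w. \<theta> x w + \<theta> y w)"
    and th_mult: "\<And>c x. \<theta> (\<lambda>w. c * x w) = (\<lambda>w. c * \<theta> x w)"
    and th_act: "\<And>A m. A \<in> Spg g \<Longrightarrow> m \<in> Tens g k \<Longrightarrow> \<theta> (act g k A m) = act g k A (\<theta> m)"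
    and th_bicyc_sum: "\<And>m u v. m \<in> alt_tensors g a b \<Longrightarrow> u \<noteq> [] \<Longrightarrow> v \<noteq> [] \<Longrightarrow>
      length u + length v = k \<Longrightarrow> bicyc_sum (\<theta> m) u v = 0"
    and th_mset: "\<And>m w. \<theta> m w \<noteq> 0 \<Longrightarrow> \<exists>w'. m w' \<noteq> 0 \<and> mset w' = mset w"
    and nz: "cyc_sum (\<lambda>w. (-1) ^ k * \<theta> (hw_vector a b) w - \<theta> (hw_vector a b) (rev w)) w0 \<noteq> 0"
  shows "KerC g k \<subset> KerD g k \<and> contains_irrep g (k + 2) (KerD g k) (KerC g k) (hw_weight a b)"
proof (rule contains_irrepI[where a = a and b = b and \<theta> = "\<lambda>m w. (-1) ^ k * \<theta> m w - \<theta> m (rev w)"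
      and \<xi> = "caterpillar_sum g k (\<theta> (hw_vector a b))"])
  fix A m assume A: "A \<in> Spg g" "m \<in> Tens g k"
  show "(\<lambda>w. (-1) ^ k * \<theta> (act g k A m) w - \<theta> (act g k A m) (rev w)) =
    act g k A (\<lambda>w. (-1) ^ k * \<theta> m w - \<theta> m (rev w))"
  proof
    fix w
    show "(-1) ^ k * \<theta> (act g k A m) w - \<theta> (act g k A m) (rev w) =
      act g k A (\<lambda>w. (-1) ^ k * \<theta> m w - \<theta> m (rev w)) w"
    proof (cases "length w = k")
      case True
      then show ?thesis
        using act_rev[OF True, of g A "\<theta> m"] by (simp add: th_act[OF A] act_diff act_mult)
    qed (simp add: th_act[OF A] act_length)
  qed
next
  fix m and u v :: "nat list"
  assume m: "m \<in> alt_tensors g a b" and uv: "u \<noteq> []" "v \<noteq> []" "length u + length v = k"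
  then show "bicyc_sum (\<lambda>w. (-1) ^ k * \<theta> m w - \<theta> m (rev w)) u v = 0"
    using th_bicyc_sum[OF m, of u v] th_bicyc_sum[OF m, of "rev u" "rev v"]
    by (simp add: bicyc_sum_diff bicyc_sum_mult bicyc_sum_rev)
next
  show "caterpillar_sum g k (\<theta> (hw_vector a b)) \<in> hk g k" by (rule caterpillar_sum_hk[OF k(2)])
next
  have "set w \<subseteq> {..<k} \<and> length w = k" if nz: "\<theta> (hw_vector a b) w \<noteq> 0" for w
  proof -
    from th_mset[OF nz] obtain w' where w': "hw_vector a b w' \<noteq> 0" "mset w' = mset w" by auto
    then have "set w = set w'" "length w = length w'"
      by (metis set_mset_mset, metis size_mset)
    with hw_vector_word(1,2)[OF w'(1) b] k show ?thesis by auto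
  qed
  then show "cmap g k (caterpillar_sum g k (\<theta> (hw_vector a b))) = (\<lambda>w. (-1) ^ k * \<theta> (hw_vector a b) w - \<theta> (hw_vector a b) (rev w))"
    by (intro cmap_caterpillar_sum[OF k(2)])
next
  fix w i assume "caterpillar_sum g k (\<theta> (hw_vector a b)) w \<noteq> 0" "i < g"
  then obtain x where x: "\<theta> (hw_vector a b) x \<noteq> 0" "weight g w i = weight g x i"
    using weight_caterpillar_sum[OF k(2)] by metis
  from th_mset[OF x(1)] obtain w' where w': "hw_vector a b w' \<noteq> 0" "mset w' = mset x" by auto
  have "weight g x i = weight g w' i"
    unfolding weight_def count_mset[symmetric] w'(2) ..
  also have "\<dots> = hw_weight a b i"
    using hw_vector_weight[OF w'(1) b, of g i] k by simp
  finally show "weight g w i = hw_weight a b i" using x(2) by simp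
qed (use assms in \<open>auto simp: algebra_simps\<close>)

section \<open>Exterior powers\<close>

text \<open>The signed number of shuffles of words of lengths \<open>p\<close> and \<open>q\<close>:
  the Gaussian binomial coefficient of \<open>p + q\<close> over \<open>p\<close> at -1.\<close>

fun shuffle_sign :: "nat \<Rightarrow> nat \<Rightarrow> rat" where
  "shuffle_sign 0 q = 1"
| "shuffle_sign (Suc p) 0 = 1"
| "shuffle_sign (Suc p) (Suc q) = shuffle_sign p (Suc q) + (-1) ^ Suc p * shuffle_sign (Suc p) q"

lemma alt_move: "alt_from 0 f \<Longrightarrow> f (u @ y # v) = (-1) ^ length u * f (y # u @ v)"
proof (induction u arbitrary: f)
  case (Cons x u)
  have "f (x # u @ y # v) = (-1) ^ length u * f (x # y # u @ v)"
    by (rule Cons.IH[OF alt_from_Cons[OF Cons.prems]])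
  also have "f (x # y # u @ v) = - f (y # x # u @ v)"
    by (rule alt_from_Cons2[OF Cons.prems])
  finally show ?case by simp
qed simp

lemma shuffle_sum_alt: "alt_from 0 f \<Longrightarrow> shuffle_sum f u v = shuffle_sign (length u) (length v) * f (u @ v)"
proof (induction f u v rule: shuffle_sum.induct)
  case (3 f x u y v)
  have "shuffle_sum (\<lambda>w. f (x # w)) u (y # v) = shuffle_sign (length u) (Suc (length v)) * f (x # u @ y # v)"
    using "3.IH"(1)[OF alt_from_Cons[OF "3.prems"]] by simp
  moreover have "shuffle_sum (\<lambda>w. f (y # w)) (x # u) v = shuffle_sign (Suc (length u)) (length v) * f (y # (x # u) @ v)"
    using "3.IH"(2)[OF alt_from_Cons[OF "3.prems"]] by simp
  moreover have "f (y # (x # u) @ v) = (-1) ^ Suc (length u) * f (x # u @ y # v)"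
    using alt_move[OF "3.prems", of "x # u" y v] by (simp flip: mult.assoc power_mult_distrib)
  ultimately show ?case by (simp add: algebra_simps)
qed simp_all

lemma alt_rotate1: "alt_from 0 f \<Longrightarrow> f (rotate1 v @ r) = (-1) ^ (length v - 1) * f (v @ r)"
proof (cases v)
  case (Cons y v')
  assume "alt_from 0 f"
  with Cons show ?thesis using alt_move[of f v' y r] by simp
qed simp

lemma alt_rotate:
  assumes "alt_from 0 f"
  shows "f (rotate i v @ r) = (-1) ^ (i * (length v - 1)) * f (v @ r)"
proof (induction i)
  case (Suc i)
  then show ?case
    using alt_rotate1[OF assms, of "rotate i v" r] by (simp add: power_add)
qed simp

lemma sum_alternating: "even n \<Longrightarrow> (\<Sum>i<n. (-1) ^ i * c) = (0::rat)"
proof -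
  assume "even n"
  then obtain m where "n = 2 * m" by (auto elim: evenE)
  moreover have "(\<Sum>i<2 * m. (-1) ^ i * c) = (0::rat)"
    by (induction m) simp_all
  ultimately show ?thesis by simp
qed

text \<open>Rotating an even number of letters by one place is an odd permutation, so consecutive
  rotations cancel.\<close>

lemma sum_alt_rotate:
  assumes "alt_from 0 f" "even (length v)"
  shows "(\<Sum>i<length v. f (rotate i v @ r)) = 0"
proof (cases "v = []")
  case False
  then have "odd (length v - 1)" using assms(2) by (simp add: even_diff_nat)
  then have "f (rotate i v @ r) = (-1) ^ i * f (v @ r)" for i
    using alt_rotate[OF assms(1), of i v r] by (simp add: power_mult mult.commute[of i])
  then show ?thesis using assms(2) by (simp add: sum_alternating)
qed simp

lemma bicyc_sum_alt:
  assumes f: "alt_from 0 f" and odd: "odd (length u + length v)"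
  shows "bicyc_sum f u v = 0"
proof -
  have eq: "bicyc_sum f u v = (\<Sum>i<length u. \<Sum>j<length v.
      shuffle_sign (length u) (length v) * f (rotate i u @ rotate j v))"
    by (simp add: bicyc_sum_def shuffle_sum_alt[OF f])
  show ?thesis
  proof (cases "even (length v)")
    case True
    have "(\<Sum>j<length v. f (rotate i u @ rotate j v)) = 0" for i
    proof -
      have "alt_from 0 (\<lambda>w. f (rotate i u @ w))"
        using alt_from_mono[OF f] by (intro alt_from_append) auto
      from sum_alt_rotate[OF this True, of "[]"] show ?thesis by simp
    qed
    then show ?thesis by (simp add: eq flip: sum_distrib_left)
  next
    case False
    then have "even (length u)" using odd by simp
    then have "(\<Sum>i<length u. f (rotate i u @ rotate j v)) = 0" for j
      using sum_alt_rotate[OF f] by simp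
    then show ?thesis by (subst eq, subst sum.swap) (simp flip: sum_distrib_left)
  qed
qed

text \<open>Reversal of \<open>n\<close> letters is a product of \<open>n choose 2\<close> adjacent
  transpositions.\<close>

lemma alt_rev: "alt_from 0 f \<Longrightarrow> f (rev w) = (-1) ^ (length w choose 2) * f w"
proof (induction w arbitrary: f)
  case (Cons x w)
  have "f (rev w @ [x]) = (-1) ^ length w * f (x # rev w)"
    using alt_move[OF Cons.prems, of "rev w" x "[]"] by simp
  also have "f (x # rev w) = (-1) ^ (length w choose 2) * f (x # w)"
    by (rule Cons.IH[OF alt_from_Cons[OF Cons.prems]])
  finally show ?case by (simp add: power_add numeral_2_eq_2)
qed (simp add: numeral_2_eq_2)

lemma exterior_power_case:
  assumes k: "5 \<le> k" "k + 1 \<le> g" "k mod 4 = 1"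
  shows "KerC g k \<subset> KerD g k \<and> contains_irrep g (k + 2) (KerD g k) (KerC g k) (hw_weight 0 k)"
proof -
  let ?f = "hw_vector 0 k"
  have odd: "odd k" using k(3) by presburger
  have alt: "alt_from 0 ?f" using hw_vector_alt_tensors[of k g 0] k by (simp add: alt_tensors_def)
  have "even (k choose 2)"
  proof -
    obtain l where "k = 4 * l + 1" using k(3) by (metis mod_div_decomp mult.commute)
    then have "k choose 2 = 2 * (l * (4 * l + 1))" by (simp add: choose_two algebra_simps)
    then show ?thesis by simp
  qed
  then have rev: "?f (rev w) = ?f w" if "length w = k" for w
    using alt_rev[OF alt, of w] that by simp
  have rot: "?f (rotate i w) = ?f w" if "length w = k" for i w
  proof -
    have "even (i * (k - 1))" using odd by simp
    then show ?thesis using alt_rotate[OF alt, of i w "[]"] that by simp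
  qed
  have "?f [0..<k] \<noteq> 0"
    using word_sign_nonzero_iff[of "[0..<k]"] by (simp add: hw_vector_def lessThan_atLeast0)
  \<comment> \<open>Rotation and reversal both act trivially and \<open>k\<close> is odd, so the sum
    is \<open>- 2 * k\<close> times the value at \<open>[0..<k]\<close>.\<close>
  then have "cyc_sum (\<lambda>w. (-1) ^ k * ?f w - ?f (rev w)) [0..<k] \<noteq> 0"
    using odd k(1) by (simp add: cyc_sum_def rev rot)
  then show ?thesis
    using k odd
    by (intro contains_irrep_caterpillar_sum[where a = 0 and b = k and \<theta> = "\<lambda>m. m" and ?w0.0 = "[0..<k]"])
      (auto intro!: bicyc_sum_alt simp: alt_tensors_def)
qed

section \<open>The hook of size eight\<close>

lemma shuffle_sum_sym: "shuffle_sum f u v = shuffle_sum f v u"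
  by (induction f u v rule: shuffle_sum.induct) (simp_all add: add.commute)

lemma bicyc_sum_sym: "bicyc_sum f u v = bicyc_sum f v u"
  unfolding bicyc_sum_def by (subst sum.swap) (simp add: shuffle_sum_sym)

lemma shuffle_sum_swap: "shuffle_sum (\<lambda>a. shuffle_sum (f a) u v) x y = shuffle_sum (\<lambda>b. shuffle_sum (\<lambda>a. f a b) x y) u v"
proof (induction "\<lambda>a. shuffle_sum (f a) u v" x y arbitrary: f rule: shuffle_sum.induct)
  case (3 a x b y)
  then show ?case by (simp add: shuffle_sum_add)
qed simp_all

text \<open>The shuffles whose prefix of length \<open>i + j\<close> uses up \<open>i\<close>
  letters of \<open>u\<close> and \<open>j\<close> of \<open>v\<close>. The default 0 beyond the
  lengths lets the sum over prefixes run over all \<open>i \<le> n\<close>.\<close>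

definition cut :: "('a list \<Rightarrow> rat) \<Rightarrow> 'a list \<Rightarrow> 'a list \<Rightarrow> nat \<Rightarrow> nat \<Rightarrow> rat" where
  "cut f u v i j = (if i \<le> length u \<and> j \<le> length v
     then shuffle_sum (\<lambda>a. shuffle_sum (\<lambda>b. f (a @ b)) (drop i u) (drop j v)) (take i u) (take j v) else 0)"

lemma shuffle_sum_cut:
  assumes "n \<le> length u + length v"
  shows "shuffle_sum f u v = (\<Sum>i\<le>n. cut f u v i (n - i))"
  using assms
proof (induction n arbitrary: f u v)
  case 0
  then show ?case by (simp add: cut_def)
next
  case (Suc n)
  show ?case
  proof (cases u)
    case Nil
    then have "cut f u v i (Suc n - i) = (if i = 0 then f v else 0)" for i
      using Suc.prems by (auto simp: cut_def)
    then show ?thesis by (simp add: Nil)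
  next
    case u: (Cons x u')
    show ?thesis
    proof (cases v)
      case Nil
      then have "cut f u v i (Suc n - i) = (if i = Suc n then f u else 0)" if "i \<le> Suc n" for i
        using Suc.prems that by (auto simp: cut_def)
      then show ?thesis by (simp add: Nil)
    next
      case v: (Cons y v')
      let ?fx = "\<lambda>w. f (x # w)" and ?fy = "\<lambda>w. f (y # w)"
      have c0: "cut f u v 0 (Suc j) = cut ?fy u v' 0 j" for j
        by (simp add: cut_def v)
      have c1: "cut f u v (Suc i) (n - i) = cut ?fx u' v i (n - i) + (if i < n then cut ?fy u v' (Suc i) (n - Suc i) else 0)"
        if "i \<le> n" for i
      proof (cases "n - i")
        case 0
        with that show ?thesis by (simp add: cut_def u)
      next
        case (Suc j)
        then have "n - Suc i = j" "i < n" by auto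
        with Suc show ?thesis by (simp add: cut_def u v)
      qed
      have "shuffle_sum f u v = (\<Sum>i\<le>n. cut ?fx u' v i (n - i)) + (\<Sum>i\<le>n. cut ?fy u v' i (n - i))"
        using Suc.IH[of u' v ?fx] Suc.IH[of u v' ?fy] Suc.prems by (simp add: u v)
      also have "(\<Sum>i\<le>n. cut ?fy u v' i (n - i)) = cut ?fy u v' 0 n + (\<Sum>i<n. cut ?fy u v' (Suc i) (n - Suc i))"
        by (simp add: sum.atMost_shift)
      also have "(\<Sum>i<n. cut ?fy u v' (Suc i) (n - Suc i)) = (\<Sum>i\<le>n. if i < n then cut ?fy u v' (Suc i) (n - Suc i) else 0)"
        by (simp add: lessThan_Suc_atMost[symmetric])
      also have "(\<Sum>i\<le>n. cut ?fx u' v i (n - i)) + (cut ?fy u v' 0 n + \<dots>) = cut f u v 0 (Suc n) + (\<Sum>i\<le>n. cut f u v (Suc i) (n - i))"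
        by (simp add: c0 c1 sum.distrib)
      also have "\<dots> = (\<Sum>i\<le>Suc n. cut f u v i (Suc n - i))"
        by (simp only: sum.atMost_Suc_shift diff_Suc_Suc diff_zero)
      finally show ?thesis .
    qed
  qed
qed

text \<open>A first block of length \<open>n\<close> on which \<open>f\<close> kills proper shuffles is taken entirely from one argument.\<close>
lemma shuffle_sum_Lie_block:
  assumes n: "n > 0" "n \<le> length u + length v"
    and Lie: "\<And>x y r. x \<noteq> [] \<Longrightarrow> y \<noteq> [] \<Longrightarrow> length x + length y = n \<Longrightarrow>
      length r = length u + length v - n \<Longrightarrow> shuffle_sum (\<lambda>a. f (a @ r)) x y = 0"
  shows "shuffle_sum f u v = (if n \<le> length u then shuffle_sum (\<lambda>b. f (take n u @ b)) (drop n u) v else 0) +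
    (if n \<le> length v then shuffle_sum (\<lambda>b. f (take n v @ b)) u (drop n v) else 0)"
proof -
  have mid: "cut f u v i (n - i) = 0" if i: "0 < i" "i < n" for i
  proof (cases "i \<le> length u \<and> n - i \<le> length v")
    case True
    have "shuffle_sum (\<lambda>b. shuffle_sum (\<lambda>a. f (a @ b)) (take i u) (take (n - i) v)) (drop i u) (drop (n - i) v) =
      shuffle_sum (\<lambda>b. 0) (drop i u) (drop (n - i) v)"
    proof (rule shuffle_sum_cong)
      fix w :: "'a list"
      assume "length w = length (drop i u) + length (drop (n - i) v)"
      then show "shuffle_sum (\<lambda>a. f (a @ w)) (take i u) (take (n - i) v) = 0"
        using i True n by (intro Lie) auto
    qed
    then show ?thesis by (simp add: cut_def shuffle_sum_swap[of "\<lambda>a b. f (a @ b)" "drop i u" "drop (n - i) v"])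
  qed (auto simp: cut_def)
  have "{..n} = insert 0 (insert n {0<..<n})" using n by auto
  then have "(\<Sum>i\<le>n. cut f u v i (n - i)) = cut f u v 0 n + cut f u v n 0 + (\<Sum>i\<in>{0<..<n}. cut f u v i (n - i))"
    using n by (simp add: add.assoc)
  also have "(\<Sum>i\<in>{0<..<n}. cut f u v i (n - i)) = 0"
    using mid by (intro sum.neutral) auto
  finally show ?thesis
    using shuffle_sum_cut[OF n(2), of f] by (simp add: cut_def)
qed

text \<open>Feeding the last six arguments of \<open>m\<close> an odd letter \<open>x\<close> and the first two an even letter \<open>z\<close>,
  this is the product of Lie elements \<open>x x \<cdot> [x x, z] \<cdot> [x x, z]\<close> of degrees 2, 3 and 3.\<close>
definition hook_op :: "tensor \<Rightarrow> tensor" where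
  "hook_op m w = (if length w = 8 then
      m (map ((!) w) [4, 7, 0, 1, 2, 3, 5, 6]) - m (map ((!) w) [2, 7, 0, 1, 3, 4, 5, 6])
    - m (map ((!) w) [4, 5, 0, 1, 2, 3, 6, 7]) + m (map ((!) w) [2, 5, 0, 1, 3, 4, 6, 7]) else 0)"

section \<open>The hook operator on explicit words\<close>

lemma length_6D: "length w = 6 \<Longrightarrow> (\<exists>a b c d e f. w = [a, b, c, d, e, f])"
  by (auto simp: numeral_eq_Suc length_Suc_conv)

lemma length_5D: "length w = 5 \<Longrightarrow> (\<exists>a b c d e. w = [a, b, c, d, e])"
  by (auto simp: numeral_eq_Suc length_Suc_conv)

lemma length_3D: "length w = 3 \<Longrightarrow> (\<exists>a b c. w = [a, b, c])"
  by (auto simp: numeral_eq_Suc length_Suc_conv)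

lemma length_2D: "length w = 2 \<Longrightarrow> (\<exists>a b. w = [a, b])"
  by (auto simp: numeral_eq_Suc length_Suc_conv)

lemma hook_op_list: "hook_op m [a, b, c, d, e, f, g, h] =
    m [e, h, a, b, c, d, f, g] - m [c, h, a, b, d, e, f, g]
  - m [e, f, a, b, c, d, g, h] + m [c, f, a, b, d, e, g, h]"
  by (simp add: hook_op_def)

lemma lessThan_8: "{..<8::nat} = {0, 1, 2, 3, 4, 5, 6, 7}"
  by (rule Set.set_eqI) (simp only: lessThan_iff insert_iff empty_iff, presburger)

lemma place_perms_hook_op:
  "place_perm 8 [4, 7, 0, 1, 2, 3, 5, 6]" "place_perm 8 [2, 7, 0, 1, 3, 4, 5, 6]"
  "place_perm 8 [4, 5, 0, 1, 2, 3, 6, 7]" "place_perm 8 [2, 5, 0, 1, 3, 4, 6, 7]"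
  by (auto simp: place_perm_def lessThan_8)

lemma act_hook_op: "hook_op (act g 8 A m) = act g 8 A (hook_op m)"
proof
  fix w
  show "hook_op (act g 8 A m) w = act g 8 A (hook_op m) w"
  proof (cases "length w = 8")
    case True
    let ?p = "\<lambda>s w. m (map ((!) w) s)"
    have "act g 8 A (hook_op m) w = act g 8 A (\<lambda>w. ((?p [4, 7, 0, 1, 2, 3, 5, 6] w - ?p [2, 7, 0, 1, 3, 4, 5, 6] w)
        - ?p [4, 5, 0, 1, 2, 3, 6, 7] w) + ?p [2, 5, 0, 1, 3, 4, 6, 7] w) w"
      by (intro fun_cong[OF act_cong]) (simp add: hook_op_def words_def)
    also have "\<dots> = hook_op (act g 8 A m) w"
      unfolding act_add act_diff place_perms_hook_op[THEN act_place_perm, OF True]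
      using True by (simp add: hook_op_def)
    finally show ?thesis by simp
  qed (simp add: hook_op_def act_length)
qed

lemma mset_place_perm:
  assumes "place_perm m s" "length w = m"
  shows "mset (map ((!) w) s) = mset w"
proof -
  have "mset s = mset [0..<m]"
    using set_eq_iff_mset_eq_distinct[of s "[0..<m]"] assms(1)
    by (simp add: place_perm_def lessThan_atLeast0)
  then have "mset (map ((!) w) s) = mset (map ((!) w) [0..<m])"
    by (simp only: mset_map)
  then show ?thesis using assms(2) map_nth[of w] by (simp only:)
qed

lemma hook_op_mset:
  assumes "hook_op m w \<noteq> 0"
  shows "\<exists>w'. m w' \<noteq> 0 \<and> mset w' = mset w"
proof (rule ccontr)
  assume none: "\<not> ?thesis"
  have len: "length w = 8" using assms by (auto simp: hook_op_def split: if_splits)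
  have "m (map ((!) w) s) = 0" if "place_perm 8 s" for s
    using none mset_place_perm[OF that len] by auto
  with assms place_perms_hook_op show False by (simp add: hook_op_def len del: list.map)
qed

lemma shuffle_sum_1_2:
  assumes "x \<noteq> []" "y \<noteq> []" "length x + length y = 3"
    and F: "\<And>a b c. f [a, b, c] + f [b, a, c] + f [b, c, a] = 0"
  shows "shuffle_sum f x y = 0"
proof -
  have "0 < length x" "0 < length y" using assms(1,2) by simp_all
  then have "length x = 1 \<and> length y = 2 \<or> length x = 2 \<and> length y = 1"
    using assms(3) by arith
  then obtain a b c where "x = [a] \<and> y = [b, c] \<or> x = [b, c] \<and> y = [a]"
    by (auto dest!: length_2D simp: length_Suc_conv)
  then show ?thesis using F[of a b c] by (auto simp: shuffle_sum_sym[of f "[b, c]"])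
qed

context
  fixes m :: tensor
  assumes m: "alt_from 2 m"
begin

lemma hook_op_block1: "length r = 6 \<Longrightarrow> hook_op m ([a, b] @ r) + hook_op m ([b, a] @ r) = 0"
proof -
  assume "length r = 6"
  then obtain c d e f g h where r: "r = [c, d, e, f, g, h]" by (auto dest!: length_6D)
  have "m [p, q, a, b, x, y, z, w] = - m [p, q, b, a, x, y, z, w]" for p q x y z w
    using alt_fromD[OF m, of "[p, q]" a b "[x, y, z, w]"] by simp
  from this[of e h c d f g] this[of c h d e f g] this[of e f c d g h] this[of c f d e g h]
  show ?thesis by (simp add: r hook_op_list)
qed

text \<open>The first identity is the vanishing on shuffles of one letter with two. The second is
  the vanishing of the block as a cyclic word, which holds because the block is a
  commutator.\<close>

lemma hook_op_block2:
  assumes "length p = 2" "length r = 3"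
  shows "hook_op m (p @ [x, y, z] @ r) + hook_op m (p @ [y, x, z] @ r) + hook_op m (p @ [y, z, x] @ r) = 0"
    "hook_op m (p @ [x, y, z] @ r) + hook_op m (p @ [y, z, x] @ r) + hook_op m (p @ [z, x, y] @ r) = 0"
proof -
  from assms obtain a b f g h where pr: "p = [a, b]" "r = [f, g, h]" by (auto dest!: length_2D length_3D)
  have "m [z, t, a, b, x, y, u, v] = - m [z, t, a, b, y, x, u, v]" for x y z t u v
    using alt_fromD[OF m, of "[z, t, a, b]" x y "[u, v]"] by simp
  from this[of z h x y f g] this[of z f x y g h] this[of y h x z f g] this[of y f x z g h]
  show "hook_op m (p @ [x, y, z] @ r) + hook_op m (p @ [y, x, z] @ r) + hook_op m (p @ [y, z, x] @ r) = 0"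
    by (simp add: pr hook_op_list)
  show "hook_op m (p @ [x, y, z] @ r) + hook_op m (p @ [y, z, x] @ r) + hook_op m (p @ [z, x, y] @ r) = 0"
    by (simp add: pr hook_op_list)
qed

lemma hook_op_block3:
  assumes "length p = 5"
  shows "hook_op m (p @ [x, y, z]) + hook_op m (p @ [y, x, z]) + hook_op m (p @ [y, z, x]) = 0"
    "hook_op m (p @ [x, y, z]) + hook_op m (p @ [y, z, x]) + hook_op m (p @ [z, x, y]) = 0"
proof -
  from assms obtain a b c d e where p: "p = [a, b, c, d, e]" by (auto dest!: length_5D)
  have "m [t, z, a, b, u, v, x, y] = - m [t, z, a, b, u, v, y, x]" for x y z t u v
    using alt_fromD[OF m, of "[t, z, a, b, u, v]" x y "[]"] by simp
  from this[of e z c d x y] this[of c z d e x y] this[of e y c d x z] this[of c y d e x z]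
  show "hook_op m (p @ [x, y, z]) + hook_op m (p @ [y, x, z]) + hook_op m (p @ [y, z, x]) = 0"
    by (simp add: p hook_op_list)
  show "hook_op m (p @ [x, y, z]) + hook_op m (p @ [y, z, x]) + hook_op m (p @ [z, x, y]) = 0"
    by (simp add: p hook_op_list)
qed

lemma shuffle_sum_block1:
  assumes "length u + length v = 8"
  shows "shuffle_sum (hook_op m) u v = (if 2 \<le> length u then shuffle_sum (\<lambda>b. hook_op m (take 2 u @ b)) (drop 2 u) v else 0) +
    (if 2 \<le> length v then shuffle_sum (\<lambda>b. hook_op m (take 2 v @ b)) u (drop 2 v) else 0)"
proof (rule shuffle_sum_Lie_block)
  fix x y r :: "nat list"
  assume xy: "x \<noteq> []" "y \<noteq> []" "length x + length y = 2" "length r = length u + length v - 2"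
  then have "length x = 1" "length y = 1" by (cases x; cases y; simp)+
  then obtain a b where "x = [a]" "y = [b]" by (auto simp: length_Suc_conv)
  then show "shuffle_sum (\<lambda>a. hook_op m (a @ r)) x y = 0"
    using hook_op_block1[of r a b] xy(4) assms by simp
qed (use assms in auto)

lemma shuffle_sum_block2:
  assumes "length u + length v = 6" "length p = 2"
  shows "shuffle_sum (\<lambda>b. hook_op m (p @ b)) u v =
    (if 3 \<le> length u then shuffle_sum (\<lambda>b. hook_op m (p @ take 3 u @ b)) (drop 3 u) v else 0) +
    (if 3 \<le> length v then shuffle_sum (\<lambda>b. hook_op m (p @ take 3 v @ b)) u (drop 3 v) else 0)"
proof (rule shuffle_sum_Lie_block)
  fix x y r :: "nat list"
  assume xy: "x \<noteq> []" "y \<noteq> []" "length x + length y = 3" "length r = length u + length v - 3"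
  show "shuffle_sum (\<lambda>a. hook_op m (p @ a @ r)) x y = 0"
    using hook_op_block2(1)[OF assms(2), of r] assms(1) xy by (intro shuffle_sum_1_2[OF xy(1-3)]) simp
qed (use assms in auto)

lemma shuffle_sum_block3:
  assumes "length u + length v = 3" "length p = 2" "length q = 3" "u \<noteq> []" "v \<noteq> []"
  shows "shuffle_sum (\<lambda>b. hook_op m (p @ q @ b)) u v = 0"
  using hook_op_block3(1)[of "p @ q"] assms by (intro shuffle_sum_1_2) simp_all

lemma sum_rotate_3:
  fixes F :: "nat list \<Rightarrow> rat"
  shows "(\<Sum>i<3. F (rotate i [a, b, c])) = F [a, b, c] + F [b, c, a] + F [c, a, b]"
proof -
  have "{..<3::nat} = {0, 1, 2}" by auto
  then show ?thesis by (simp add: rotate_drop_take add.assoc)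
qed

text \<open>Blocks of lengths 2, 3, 3 are each taken whole from \<open>u\<close> or from
  \<open>v\<close>, so lengths 1, 4 and 7 are impossible. By symmetry the shorter word has length 2
  or 3 and consists of a single Lie block, whose sum over rotations is zero.\<close>

lemma bicyc_sum_hook_op:
  assumes uv: "u \<noteq> []" "v \<noteq> []" "length u + length v = 8"
  shows "bicyc_sum (hook_op m) u v = 0"
proof -
  have le: "bicyc_sum (hook_op m) u v = 0" if uv: "u \<noteq> []" "length u \<le> 4" "length u + length v = 8" for u v :: "nat list"
  proof -
    have "0 < length u" using uv(1) by simp
    then consider "length u = 1" | "length u = 2" | "length u = 3" | "length u = 4"
      using uv(2) by linarith
    then show ?thesis
    proof cases
      case 1
      then have v: "length v = 7" using uv by simp
      have "shuffle_sum (hook_op m) x y = 0" if xy: "length x = 1" "length y = 7" for x y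
        using xy length_0_conv[of x] length_0_conv[of y] by (simp add: shuffle_sum_block1 shuffle_sum_block2 shuffle_sum_block3)
      then show ?thesis using 1 v by (simp add: bicyc_sum_def)
    next
      case 2
      then have v: "length v = 6" using uv by simp
      have "shuffle_sum (hook_op m) x y = hook_op m (x @ y)" if xy: "length x = 2" "length y = 6" for x y
        using xy length_0_conv[of x] length_0_conv[of y] by (simp add: shuffle_sum_block1 shuffle_sum_block2 shuffle_sum_block3)
      \<comment> \<open>The sums are exchanged so that the rotations of the single block
        \<open>u\<close> come innermost.\<close>
      then have "bicyc_sum (hook_op m) u v = (\<Sum>j<6. \<Sum>i<2. hook_op m (rotate i u @ rotate j v))"
        using 2 v by (simp add: bicyc_sum_def sum.swap[of _ "{..<2}"])
      also have "\<dots> = 0"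
      proof (rule sum.neutral, rule ballI)
        fix j :: nat
        obtain a b where "u = [a, b]" using 2 by (auto dest!: length_2D)
        then show "(\<Sum>i<2. hook_op m (rotate i u @ rotate j v)) = 0"
          using hook_op_block1[of "rotate j v" a b] v by (simp add: numeral_2_eq_2)
      qed
      finally show ?thesis .
    next
      case 3
      then have v: "length v = 5" using uv by simp
      have "shuffle_sum (hook_op m) x y = hook_op m (take 2 y @ x @ drop 2 y) + hook_op m (y @ x)"
        if xy: "length x = 3" "length y = 5" for x y
      proof -
        have "take 2 y @ take 3 (drop 2 y) = y"
          using xy append_take_drop_id[of 2 y] by simp
        then have "hook_op m (take 2 y @ take 3 (drop 2 y) @ x) = hook_op m (y @ x)"
          by (metis append.assoc)
        then show ?thesis
          using xy length_0_conv[of x] length_0_conv[of y] by (simp add: shuffle_sum_block1 shuffle_sum_block2 shuffle_sum_block3)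
      qed
      then have "bicyc_sum (hook_op m) u v = (\<Sum>j<5. \<Sum>i<3. hook_op m (take 2 (rotate j v) @ rotate i u @ drop 2 (rotate j v)) 
          + hook_op m (rotate j v @ rotate i u))"
        using 3 v by (simp add: bicyc_sum_def sum.swap[of _ "{..<3}"])
      also have "\<dots> = 0"
      proof (rule sum.neutral, rule ballI)
        fix j :: nat
        obtain a b c where u: "u = [a, b, c]" using 3 by (auto dest!: length_3D)
        show "(\<Sum>i<3. hook_op m (take 2 (rotate j v) @ rotate i u @ drop 2 (rotate j v)) + hook_op m (rotate j v @ rotate i u)) = 0"
          unfolding u sum_rotate_3[of "\<lambda>x. hook_op m (take 2 (rotate j v) @ x @ drop 2 (rotate j v)) + hook_op m (rotate j v @ x)"]
          using hook_op_block2(2)[of "take 2 (rotate j v)" "drop 2 (rotate j v)" a b c]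
            hook_op_block3(2)[of "rotate j v" a b c] v by simp
      qed
      finally show ?thesis .
    next
      case 4
      then have v: "length v = 4" using uv by simp
      have "shuffle_sum (hook_op m) x y = 0" if xy: "length x = 4" "length y = 4" for x y
        using xy length_0_conv[of x] length_0_conv[of y]
        by (simp add: shuffle_sum_block1 shuffle_sum_block2 shuffle_sum_block3
            shuffle_sum_block3)
      then show ?thesis using 4 v by (simp add: bicyc_sum_def)
    qed
  qed
  show ?thesis
  proof (cases "length u \<le> 4")
    case True
    with uv show ?thesis by (intro le)
  next
    case False
    with uv le[of v u] show ?thesis by (simp add: bicyc_sum_sym[of _ u])
  qed
qed

end

text \<open>For evaluation on explicit words: repeated letters already have sign 0, and
  \<open>b\<close> distinct letters below \<open>b\<close> fill \<open>{..<b}\<close>, so a bound on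
  the letters can replace the equality of sets.\<close>

lemma hw_vector_eq:
  "hw_vector a b w = (if length w = a + b \<and> take a w = replicate a 0 \<and> (\<forall>x\<in>set (drop a w). x < b) then word_sign (drop a w) else 0)"
proof (cases "length w = a + b \<and> distinct (drop a w)")
  case True
  then have "card (set (drop a w)) = card {..<b}" by (simp add: distinct_card)
  then have "set (drop a w) = {..<b} \<longleftrightarrow> set (drop a w) \<subseteq> {..<b}"
    by (metis card_subset_eq finite_lessThan order_refl)
  then show ?thesis by (auto simp: hw_vector_def)
next
  case False
  then have "length w = a + b \<Longrightarrow> word_sign (drop a w) = 0" using word_sign_nonzero_iff by blast
  then show ?thesis by (auto simp: hw_vector_def)
qed

lemma cyc_sum_8: "cyc_sum F [a, b, c, d, e, f, g, h] =
  F [a, b, c, d, e, f, g, h] + F [b, c, d, e, f, g, h, a] + F [c, d, e, f, g, h, a, b] +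
  F [d, e, f, g, h, a, b, c] + F [e, f, g, h, a, b, c, d] + F [f, g, h, a, b, c, d, e] +
  F [g, h, a, b, c, d, e, f] + F [h, a, b, c, d, e, f, g]"
  by (simp add: cyc_sum_def lessThan_Suc rotate_drop_take)

lemma hook_case:
  assumes "9 \<le> g"
  shows "KerC g 8 \<subset> KerD g 8 \<and> contains_irrep g (8 + 2) (KerD g 8) (KerC g 8) (hw_weight 2 6)"
proof (rule contains_irrep_caterpillar_sum[where \<theta> = hook_op and ?w0.0 = "[0, 1, 2, 3, 4, 0, 5, 0]"])
  have eq: "hw_vector 2 6 [a, b, c, d, e, f, g, h] =
    (if a = 0 \<and> b = 0 \<and> c < 6 \<and> d < 6 \<and> e < 6 \<and> f < 6 \<and> g < 6 \<and> h < 6 then word_sign [c, d, e, f, g, h] else 0)"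
    for a b c d e f g h
    by (auto simp: hw_vector_eq numeral_2_eq_2)
  \<comment> \<open>The witness has the letters of \<open>hw_vector 2 6\<close>, with cyclic gaps 5,
    2 and 1 between its zeros. Its rotations contribute -2 and those of its reversal 2, so the value
    is -4.\<close>
  show "cyc_sum (\<lambda>w. (-1) ^ 8 * hook_op (hw_vector 2 6) w - hook_op (hw_vector 2 6) (rev w)) [0, 1, 2, 3, 4, 0, 5, 0] \<noteq> 0"
    by (simp add: cyc_sum_8 hook_op_list eq)
qed (use assms in \<open>auto simp: hook_op_def fun_eq_iff algebra_simps act_hook_op alt_tensors_def intro: bicyc_sum_hook_op hook_op_mset\<close>)

theorem theorem1p2:
  fixes g k :: nat
  assumes "5 \<le> k" and "k + 1 \<le> g"
  shows "(k mod 4 = 1 \<longrightarrow>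
            KerC g k \<subset> KerD g k \<and>
            contains_irrep g (k + 2) (KerD g k) (KerC g k) (\<lambda>i. if i < k then 1 else 0))
       \<and> (k = 8 \<longrightarrow>
            KerC g k \<subseteq> KerD g k \<and>
            contains_irrep g (k + 2) (KerD g k) (KerC g k)
              (\<lambda>i. if i = 0 then 3 else if i \<le> 5 then 1 else 0))"
proof -
  have "hw_weight 0 k = (\<lambda>i. if i < k then 1 else 0)"
    using assms by (auto simp: hw_weight_def)
  moreover have "hw_weight 2 6 = (\<lambda>i. if i = 0 then 3 else if i \<le> 5 then 1 else 0)"
    by (auto simp: hw_weight_def)
  ultimately show ?thesis
    using exterior_power_case[OF assms] hook_case[of g] assms(2) by (auto simp: psubset_imp_subset)
qed

end
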